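(* For $a\in(-1,1)$ let $\Sigma_a=\{x\in\mathbb R^3: x_1^2+x_2^2+x_3^2=1,\ x_3\ge a\}$ with the Riemannian metric $\sigma$ induced from $\mathbb R^3$. For $k\ge 1$ and a Hölder exponent $\alpha$, let $\mathscr I^\alpha_k(\Sigma_a)$ be the space of isometric immersions $v:\Sigma_a\to\mathbb R^{2+k}$ of class $C^{1,\alpha}$ such that $v(x_1,x_2,a)=(x_1,x_2,0,\dots,0)$ for all $(x_1,x_2,a)\in\partial\Sigma_a$, and let $\gamma_a=v(\partial\Sigma_a)$, i.e. the circle $\{(x_1,x_2,0,\dots,0): x_1^2+x_2^2=1-a^2\}\subset\mathbb R^{2+k}$. Let $X$ be the interior unit normal to $\partial\Sigma_a$ in $\Sigma_a$, let $Z:\gamma_a\to\mathbb R^{2+k}$ be the unit vector field $Z(x_1,x_2,0,\dots,0)=-(1-a^2)^{-1/2}(x_1,x_2,0,\dots,0)$, and for $v\in\mathscr I^\alpha_k(\Sigma_a)$ let $Y:\gamma_a\to\mathbb R^{2+k}$ be the vector field $Y=v_*X$. Then: (a) If $\alpha>\frac12$, $-1<a<1$, $k\ge1$ and $v\in\mathscr I^\alpha_k(\Sigma_a)$, then $\langle Y,Z\rangle=a$ on $\gamma_a$. (b) For any $\alpha<\frac12$, any $0<a<1$ and any $k\ge 12$ there is $v\in\mathscr I^\alpha_k(\Sigma_a)$ such that $\langle Y,Z\rangle>a$ on $\gamma_a$.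
   Context: Hölder exponents $\alpha$ range in $(0,1)$, and $C^{1,\alpha}$ regularity is meant up to the boundary of the compact manifold with boundary $\Sigma_a$. A $C^1$ immersion $v:\Sigma_a\to\mathbb R^{N}$ is isometric if the pull-back $v^\sharp e$ of the Euclidean metric $e$ equals $\sigma$. $\langle\cdot,\cdot\rangle$ is the Euclidean scalar product. $v_*X$ is the push-forward: for $p\in\partial\Sigma_a$, $Y(v(p))=dv_p(X_p)$ (note that $v$ is injective on $\partial\Sigma_a$ by the boundary condition). *)

theory Defs
  imports "HOL-Analysis.Analysis"
begin

section \<open>The spherical cap\<close>

definition cap :: "real \<Rightarrow> (real^3) set" where
  "cap a = {x. (x$1)\<^sup>2 + (x$2)\<^sup>2 + (x$3)\<^sup>2 = 1 \<and> x$3 \<ge> a}"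

definition cap_boundary :: "real \<Rightarrow> (real^3) set" where
  "cap_boundary a = {x \<in> cap a. x$3 = a}"

text \<open>The tangent space, as a linear subspace of the ambient space, of the unit sphere at \<open>p\<close>.
  It is also the tangent space of the cap, at boundary points too.
  The metric of the cap is the restriction of the inner product to these subspaces.\<close>

definition tangent_space :: "real^3 \<Rightarrow> (real^3) set" where
  "tangent_space p = {w. p \<bullet> w = 0}"

text \<open>At a boundary point, \<open>w$3 = 0\<close> cuts out the tangent line of the boundary circle, and
  \<open>n$3 > 0\<close> says that \<open>n\<close> points to the side on which the cap lies.\<close>

definition is_interior_unit_normal :: "real^3 \<Rightarrow> real^3 \<Rightarrow> bool" where
  "is_interior_unit_normal p n \<longleftrightarrow>
     n \<in> tangent_space p \<and> norm n = 1 \<and>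
     (\<forall>w \<in> tangent_space p. w$3 = 0 \<longrightarrow> n \<bullet> w = 0) \<and> n$3 > 0"

definition interior_unit_normal :: "real^3 \<Rightarrow> real^3" where
  "interior_unit_normal p = (THE n. is_interior_unit_normal p n)"

section \<open>Differentials and isometric immersions\<close>

text \<open>The Frechet derivative of \<open>v\<close> within the cap is determined only on tangent
  vectors (see \<open>cap_differential_eq\<close>).  The differential is extended by zero in the normal
  direction, so that differentials at different points are linear maps on one common space.\<close>

definition tangent_proj :: "real^3 \<Rightarrow> real^3 \<Rightarrow> real^3" where
  "tangent_proj p w = w - (p \<bullet> w) *\<^sub>R p"

definition cap_differential ::
    "real \<Rightarrow> (real^3 \<Rightarrow> 'b::euclidean_space) \<Rightarrow> real^3 \<Rightarrow> real^3 \<Rightarrow> 'b" where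
  "cap_differential a v p w = frechet_derivative v (at p within cap a) (tangent_proj p w)"

text \<open>Regularity up to the boundary: differentiability (one-sided at boundary points)
  and the Hoelder bound are required on the whole closed cap.  As the cap is compact and the
  projections depend smoothly on \<open>p\<close>, this is the same as \<open>C\<^sup>1\<close> with Hoelder first derivatives
  in smooth charts of the manifold with boundary.\<close>

definition C1_holder_cap :: "real \<Rightarrow> real \<Rightarrow> (real^3 \<Rightarrow> 'b::euclidean_space) \<Rightarrow> bool" where
  "C1_holder_cap \<alpha> a v \<longleftrightarrow>
     (\<forall>p \<in> cap a. v differentiable (at p within cap a)) \<and>
     (\<exists>C. \<forall>p \<in> cap a. \<forall>q \<in> cap a.
        onorm (\<lambda>w. cap_differential a v p w - cap_differential a v q w) \<le> C * dist p q powr \<alpha>)"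

definition immersion_cap :: "real \<Rightarrow> (real^3 \<Rightarrow> 'b::euclidean_space) \<Rightarrow> bool" where
  "immersion_cap a v \<longleftrightarrow> (\<forall>p \<in> cap a. inj_on (cap_differential a v p) (tangent_space p))"

definition isometric_cap :: "real \<Rightarrow> (real^3 \<Rightarrow> 'b::euclidean_space) \<Rightarrow> bool" where
  "isometric_cap a v \<longleftrightarrow>
     (\<forall>p \<in> cap a. \<forall>u \<in> tangent_space p. \<forall>w \<in> tangent_space p.
        cap_differential a v p u \<bullet> cap_differential a v p w = u \<bullet> w)"

text \<open>The target, Euclidean space of dimension \<open>2 + CARD('k)\<close>, is the product
  \<open>(real^2) \<times> (real^'k)\<close>, whose library inner product is the Euclidean one.\<close>

definition isometric_immersions ::
    "real \<Rightarrow> real \<Rightarrow> (real^3 \<Rightarrow> (real^2) \<times> (real^'k::finite)) set" where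
  "isometric_immersions \<alpha> a =
     {v. C1_holder_cap \<alpha> a v \<and> immersion_cap a v \<and> isometric_cap a v \<and>
         (\<forall>x \<in> cap_boundary a. v x = (vector [x$1, x$2], 0))}"

section \<open>The boundary circle and the vector fields along it\<close>

definition boundary_circle :: "real \<Rightarrow> ((real^2) \<times> (real^'k::finite)) set" where
  "boundary_circle a = {(vector [x1, x2], 0) | x1 x2. x1\<^sup>2 + x2\<^sup>2 = 1 - a\<^sup>2}"

definition Z_field :: "real \<Rightarrow> (real^2) \<times> (real^'k::finite) \<Rightarrow> (real^2) \<times> (real^'k)" where
  "Z_field a q = - ((1 / sqrt (1 - a\<^sup>2)) *\<^sub>R q)"

definition Y_field ::
    "real \<Rightarrow> (real^3 \<Rightarrow> (real^2) \<times> (real^'k::finite)) \<Rightarrow> (real^2) \<times> (real^'k) \<Rightarrow> (real^2) \<times> (real^'k)"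
  where
  "Y_field a v q =
     (let p = the_inv_into (cap_boundary a) v q
      in cap_differential a v p (interior_unit_normal p))"

section \<open>Well-definedness\<close>

lemma inner_3: "(x::real^3) \<bullet> y = x$1 * y$1 + x$2 * y$2 + x$3 * y$3"
  by (simp add: inner_vec_def sum_3)

lemma cap_iff_norm: "x \<in> cap a \<longleftrightarrow> norm x = 1 \<and> x$3 \<ge> a"
  by (simp add: cap_def norm_eq_1 inner_3 power2_eq_square)

lemma interior_unit_normal_eq:
  assumes a: "-1 < a" "a < 1" and p: "p \<in> cap_boundary a"
  shows "is_interior_unit_normal p ((1 / sqrt (1 - a\<^sup>2)) *\<^sub>R (axis 3 1 - a *\<^sub>R p))" (is ?A)
    and "interior_unit_normal p = (1 / sqrt (1 - a\<^sup>2)) *\<^sub>R (axis 3 1 - a *\<^sub>R p)"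
proof -
  define s where "s = sqrt (1 - a\<^sup>2)"
  define N where "N = (1 / s) *\<^sub>R (axis 3 1 - a *\<^sub>R p)"
  have "a\<^sup>2 < 1" using a by (simp add: abs_square_less_1)
  then have s: "s > 0" "s * s = 1 - a\<^sup>2" by (simp_all add: s_def)
  have p3: "p$3 = a" and pp: "p \<bullet> p = 1"
    using p by (auto simp: cap_boundary_def cap_iff_norm norm_eq_1)
  have e3: "axis 3 1 \<bullet> w = w$3" "w \<bullet> axis 3 1 = w$3" for w :: "real^3"
    by (simp_all add: inner_3 axis_def)
  have N3: "N$3 = s"
    using s p3 by (simp add: N_def field_simps power2_eq_square)
  have pN: "p \<bullet> N = 0"
    by (simp add: N_def inner_diff_right e3 p3 pp)
  have NN: "N \<bullet> N = 1"
  proof -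
    have "N \<bullet> N = (1 / s) * (1 / s) * (1 - a\<^sup>2)"
      by (simp add: N_def inner_diff_right inner_diff_left e3 p3 pp)
         (simp add: power2_eq_square axis_def field_simps)
    then show ?thesis using s(1) unfolding s(2)[symmetric] by simp
  qed
  have orth: "N \<bullet> w = 0" if "p \<bullet> w = 0" "w$3 = 0" for w
    using that by (simp add: N_def inner_diff_left e3)
  have A: "is_interior_unit_normal p N"
    unfolding is_interior_unit_normal_def tangent_space_def
    using pN NN orth N3 s by (auto simp: norm_eq_1)
  have U: "n = N" if n: "is_interior_unit_normal p n" for n
  proof -
    have n1: "p \<bullet> n = 0" "n \<bullet> n = 1" "n$3 > 0"
      and n2: "\<And>w. p \<bullet> w = 0 \<Longrightarrow> w$3 = 0 \<Longrightarrow> n \<bullet> w = 0"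
      using n by (auto simp: is_interior_unit_normal_def tangent_space_def norm_eq_1)
    define c where "c = n$3 / s"
    define w where "w = n - c *\<^sub>R N"
    have w0: "p \<bullet> w = 0" "w$3 = 0"
      using n1 pN N3 s by (simp_all add: w_def c_def inner_diff_right)
    have "w \<bullet> w = 0"
      using n2[OF w0] orth[OF w0] by (simp add: w_def inner_diff_left)
    then have nc: "n = c *\<^sub>R N" by (simp add: w_def)
    then have "c * c = 1" using n1 NN by simp
    moreover have "c > 0" using n1 s by (simp add: c_def)
    ultimately have "c = 1" by (metis abs_of_pos power2_eq_square real_sqrt_abs real_sqrt_one)
    with nc show ?thesis by simp
  qed
  show ?A using A by (simp add: N_def s_def)
  show "interior_unit_normal p = (1 / sqrt (1 - a\<^sup>2)) *\<^sub>R (axis 3 1 - a *\<^sub>R p)"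
    unfolding interior_unit_normal_def s_def[symmetric] N_def[symmetric]
    using A U by (rule the_equality)
qed

lemma derivative_within_cap_unique_inward:
  fixes v :: "real^3 \<Rightarrow> 'b::euclidean_space"
  assumes p: "p \<in> cap a" and w: "p \<bullet> w = 0" and inw: "p$3 > a \<or> w$3 > 0"
    and D: "(v has_derivative D) (at p within cap a)"
    and E: "(v has_derivative E) (at p within cap a)"
  shows "D w = E w"
proof (cases "w = 0")
  case True
  then show ?thesis using D E has_derivative_bounded_linear linear_0 bounded_linear.linear by metis
next
  case False
  define u where "u = w /\<^sub>R norm w"
  have w_u: "w = norm w *\<^sub>R u" using False by (simp add: u_def)
  have uu: "u \<bullet> u = 1" using False by (simp add: u_def dot_square_norm power2_eq_square)
  have pu: "p \<bullet> u = 0" using w by (simp add: u_def)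
  have pp: "p \<bullet> p = 1" "p$3 \<ge> a" using p by (auto simp: cap_iff_norm norm_eq_1)
  have inu: "p$3 > a \<or> u$3 > 0" using inw False by (auto simp: u_def)
  define c where "c = (\<lambda>t::real. cos t *\<^sub>R p + sin t *\<^sub>R u)"
  define h where "h = (\<lambda>t::real. cos t * p$3 + sin t * u$3 - a)"
  have c0: "c 0 = p" by (simp add: c_def)
  have dc: "(c has_vector_derivative u) (at 0 within T)" for T
    unfolding c_def by (auto intro!: derivative_eq_intros)
  have "\<exists>e>0. \<forall>t\<in>{0<..<e}. h t > 0"
  proof (cases "p$3 > a")
    case True
    have "(h \<longlongrightarrow> h 0) (at 0)"
      unfolding h_def by (intro tendsto_intros)
    then have "\<forall>\<^sub>F t in at 0. h t > 0"
      using True by (intro order_tendstoD) (auto simp: h_def)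
    then obtain d where "d > 0" "\<And>t. t \<noteq> 0 \<Longrightarrow> dist t 0 < d \<Longrightarrow> h t > 0"
      by (auto simp: eventually_at)
    then show ?thesis by (intro exI[of _ d]) auto
  next
    case False
    then have "p$3 = a" "u$3 > 0" using pp inu by auto
    have "DERIV h 0 :> u$3"
      unfolding h_def by (auto intro!: derivative_eq_intros)
    from DERIV_pos_inc_right[OF this \<open>u$3 > 0\<close>] obtain d where
      "d > 0" "\<And>t. t > 0 \<Longrightarrow> t < d \<Longrightarrow> h 0 < h (0 + t)" by auto
    then show ?thesis using \<open>p$3 = a\<close> by (intro exI[of _ d]) (auto simp: h_def)
  qed
  then obtain e where e: "e > 0" "\<And>t. 0 < t \<Longrightarrow> t < e \<Longrightarrow> h t > 0" by auto
  define T where "T = {0..e/2}"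
  have cT: "c ` T \<subseteq> cap a"
  proof (clarify)
    fix t assume t: "t \<in> T"
    have "c t \<bullet> c t = 1"
      using pp uu pu by (simp add: c_def inner_add_left inner_add_right inner_commute)
    moreover have "c t $ 3 \<ge> a"
      using e(2)[of t] t e(1) pp by (cases "t = 0") (auto simp: c_def h_def T_def)
    ultimately show "c t \<in> cap a" by (simp add: cap_iff_norm norm_eq_1)
  qed
  have key: "((v \<circ> c) has_vector_derivative F u) (at 0 within T)"
    if F: "(v has_derivative F) (at p within cap a)" for F
  proof -
    have "(v has_derivative F) (at (c 0) within c ` T)"
      using F cT c0 has_derivative_subset by metis
    then have "((v \<circ> c) has_derivative (F \<circ> (\<lambda>x. x *\<^sub>R u))) (at 0 within T)"
      by (intro diff_chain_within dc[unfolded has_vector_derivative_def])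
    moreover have "F \<circ> (\<lambda>x. x *\<^sub>R u) = (\<lambda>x. x *\<^sub>R F u)"
      using has_derivative_bounded_linear[OF F] by (auto simp: linear_simps)
    ultimately show ?thesis by (simp add: has_vector_derivative_def)
  qed
  have "D u = E u"
    using key[OF D] key[OF E] e(1)
    by (intro vector_derivative_unique_within_closed_interval[of 0 "e/2" 0 "v \<circ> c"])
       (auto simp: T_def)
  moreover have "F w = norm w *\<^sub>R F u" if "bounded_linear F" for F :: "real^3 \<Rightarrow> 'b"
    by (subst w_u, rule linear_scale[OF bounded_linear.linear[OF that]])
  ultimately show ?thesis
    using has_derivative_bounded_linear[OF D] has_derivative_bounded_linear[OF E] by metis
qed

text \<open>On tangent vectors the derivative within the cap is unique, hence
  \<open>cap_differential\<close> is the intrinsic differential.\<close>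

lemma cap_differential_eq:
  fixes v :: "real^3 \<Rightarrow> 'b::euclidean_space"
  assumes a: "-1 < a" "a < 1" and p: "p \<in> cap a" and w: "w \<in> tangent_space p"
    and D: "(v has_derivative D) (at p within cap a)"
  shows "cap_differential a v p w = D w"
proof -
  define E where "E = frechet_derivative v (at p within cap a)"
  have E: "(v has_derivative E) (at p within cap a)"
    using D unfolding E_def by (meson differentiableI frechet_derivative_works)
  have w0: "p \<bullet> w = 0" using w by (simp add: tangent_space_def)
  have "E w = D w"
  proof (cases "p$3 > a")
    case True
    then show ?thesis using derivative_within_cap_unique_inward[OF p w0 _ E D] by simp
  next
    case False
    then have pb: "p \<in> cap_boundary a" using p by (auto simp: cap_boundary_def cap_def)
    define n where "n = interior_unit_normal p"
    have n: "p \<bullet> n = 0" "n$3 > 0"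
      using interior_unit_normal_eq[OF a pb]
      by (auto simp: n_def is_interior_unit_normal_def tangent_space_def)
    define s where "s = (\<bar>w$3\<bar> + 1) / n$3"
    have "s * n$3 = \<bar>w$3\<bar> + 1" using n by (simp add: s_def)
    then have 1: "(w + s *\<^sub>R n)$3 > 0" by simp
    have 2: "p \<bullet> (w + s *\<^sub>R n) = 0" using n w0 by (simp add: inner_add_right)
    have "E (w + s *\<^sub>R n) = D (w + s *\<^sub>R n)" "E n = D n"
      using derivative_within_cap_unique_inward[OF p 2 _ E D] 1
        derivative_within_cap_unique_inward[OF p n(1) _ E D] n by auto
    then show ?thesis
      using has_derivative_bounded_linear[OF D] has_derivative_bounded_linear[OF E]
      by (simp add: linear_simps)
  qed
  then show ?thesis
    using w0 by (simp add: cap_differential_def tangent_proj_def E_def)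
qed

lemma boundary_circle_eq_image:
  assumes "v \<in> isometric_immersions \<alpha> a"
  shows "v ` cap_boundary a = boundary_circle a"
    and "inj_on v (cap_boundary a)"
proof -
  have v: "v x = (vector [x$1, x$2], 0)" if "x \<in> cap_boundary a" for x
    using assms that by (simp add: isometric_immersions_def)
  show "v ` cap_boundary a = boundary_circle a"
  proof (intro equalityI subsetI)
    fix q assume "q \<in> v ` cap_boundary a"
    then obtain x where "x \<in> cap_boundary a" "q = v x" by blast
    then show "q \<in> boundary_circle a"
      using v by (force simp: boundary_circle_def cap_boundary_def cap_def)
  next
    fix q :: "(real^2) \<times> (real^'a)" assume "q \<in> boundary_circle a"
    then obtain x1 x2 where q: "q = (vector [x1, x2], 0)" "x1\<^sup>2 + x2\<^sup>2 = 1 - a\<^sup>2"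
      by (auto simp: boundary_circle_def)
    define x :: "real^3" where "x = vector [x1, x2, a]"
    have "x \<in> cap_boundary a" using q by (simp add: x_def cap_boundary_def cap_def)
    moreover have "v x = q" using v[OF calculation] q by (simp add: x_def)
    ultimately show "q \<in> v ` cap_boundary a" by blast
  qed
  show "inj_on v (cap_boundary a)"
  proof (rule inj_onI)
    fix x y assume xy: "x \<in> cap_boundary a" "y \<in> cap_boundary a" "v x = v y"
    then have "(vector [x$1, x$2] :: real^2) = vector [y$1, y$2]" using v by simp
    then have "x$1 = y$1" "x$2 = y$2" by (metis vector_2)+
    moreover have "x$3 = y$3" using xy by (simp add: cap_boundary_def)
    ultimately show "x = y" by (simp add: vec_eq_iff forall_3)
  qed
qed

end

theory Submission
  imports Defs
begin

text \<open>
  \<^emph>\<open>Rigidity.\<close>  In geodesic coordinates \<open>(s,\<theta>)\<close> at the boundary write \<open>V = v \<circ> P\<close>, so that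
  \<open>|V\<^sub>\<theta>|\<^sup>2 = r(s)\<^sup>2\<close> and \<open>V\<^sub>s \<bottom> V\<^sub>\<theta>\<close>.  For smooth \<open>v\<close> one has
  \<open>\<langle>V\<^sub>\<theta>\<^sub>\<theta>, V\<^sub>s\<rangle> = - (r\<^sup>2)'/2\<close>, which at \<open>s = 0\<close> is the claim.  As \<open>V(0,\<sqdot>)\<close> is a circle, only
  the derivative of \<open>|V\<^sub>\<theta>|\<^sup>2\<close> in \<open>s\<close> needs care, and the difference quotient
  over \<open>[0,h]\<close> has an error \<open>O(h\<^sup>2\<^sup>\<alpha>\<^sup>-\<^sup>1)\<close>.

  \<^emph>\<open>Flexibility.\<close>  Shrink the parallel at distance \<open>s\<close>
  from the boundary by a little more than the cap demands, creating a defect of order \<open>s\<close> in the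
  length of the parallels.  Fill it by oscillations \<open>w\<^sub>q(s) e\<^sup>i\<^sup>\<lambda>\<^sup>\<theta>\<close> with
  \<open>\<lambda> = 2\<^sup>q\<close> and \<open>w\<^sub>q \<approx> \<surd>s / 2\<^sup>q\<close> supported in the dyadic band \<open>s \<approx> 2\<^sup>-\<^sup>q\<close>,
  in one extra plane for the even and one for the odd \<open>q\<close>.  In each band the map is equivariant under
  rotations, so the induced metric is diagonal and depends on \<open>s\<close> only; one more coordinate, a function
  of the height, corrects the length of the meridians.  Amplitude \<open>\<surd>s\<close> at frequency \<open>1/s\<close>
  makes the first derivatives Hoelder continuous of exponent \<open>1/2\<close> up to the boundary.
\<close>

text \<open>With no second derivatives available, rigidity rests on polarization: the lengths of
  \<open>Vt\<close> are prescribed, so the product of \<open>Vt 0 \<theta>\<close> with the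
  increment \<open>Vt h \<theta> - Vt 0 \<theta>\<close> is known up to half the square of that
  increment, and squaring turns the exponent \<alpha> into 2\<alpha>. In the construction only the
  first-order shrinking of the parallels changes the product of \<open>Y\<close> with
  \<open>Z\<close>: oscillations of size s^(3/2) have vanishing derivative at s = 0, and the extra
  coordinates are orthogonal to \<open>Z\<close>. Frequencies must be integers, so they cannot
  follow 1/s continuously and neighbouring bands have to overlap. Two frequencies in one plane would
  create cross terms depending on \<theta>; the split by parity leaves at most one frequency per
  plane at each height. Squared angular speeds add up, so the cutoffs form a partition of unity
  through their squares. The angle is singular at the pole, therefore every perturbation stops
  halfway up. The cost of the oscillations along the meridians is bounded, and a small factor
  \<epsilon> makes it affordable.\<close>

section \<open>Rigidity above the exponent one half\<close>

lemma abs_diff_half_le: "\<bar>x - n / 2\<bar> \<le> b + m / 2"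
  if "\<bar>x\<bar> \<le> b" "0 \<le> n" "n \<le> m" for x n b m :: real
  using that by (auto simp: abs_le_iff)

text \<open>The mean value theorem is applied to \<open>\<langle>V\<^sub>t(0,\<theta>), V(h,\<theta>) - V(0,\<theta>)\<rangle>\<close>, which is
  \<open>O(h\<^sup>1\<^sup>+\<^sup>\<alpha>)\<close>, over an interval of length \<open>h\<^sup>\<alpha>\<^sup>/\<^sup>2\<close>; the error
  \<open>|V\<^sub>t(h,\<theta>) - V\<^sub>t(0,\<theta>)|\<^sup>2 = O(h\<^sup>2\<^sup>\<alpha>)\<close> in its derivative is \<open>o(h)\<close> because
  \<open>\<alpha> > 1/2\<close>.\<close>

lemma inner_second_derivative_eq:
  fixes V Vs Vt :: "real \<Rightarrow> real \<Rightarrow> 'b::real_inner" and W :: "real \<Rightarrow> 'b" and R :: "real \<Rightarrow> real"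
  assumes \<alpha>: "1/2 < \<alpha>" and s0: "0 < s0"
    and ds: "\<And>s \<theta>. s \<in> {0..s0} \<Longrightarrow>
          ((\<lambda>s. V s \<theta>) has_vector_derivative Vs s \<theta>) (at s within {0..s0})"
    and dt: "\<And>s \<theta>. s \<in> {0..s0} \<Longrightarrow> (V s has_vector_derivative Vt s \<theta>) (at \<theta>)"
    and normt: "\<And>s \<theta>. s \<in> {0..s0} \<Longrightarrow> Vt s \<theta> \<bullet> Vt s \<theta> = R s"
    and orth: "\<And>\<theta>. Vt 0 \<theta> \<bullet> Vs 0 \<theta> = 0"
    and hs: "\<And>s \<theta>. s \<in> {0..s0} \<Longrightarrow> norm (Vs s \<theta> - Vs 0 \<theta>) \<le> C * s powr \<alpha>"
    and ht: "\<And>s \<theta>. s \<in> {0..s0} \<Longrightarrow> norm (Vt s \<theta> - Vt 0 \<theta>) \<le> C * s powr \<alpha>"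
    and R': "(R has_real_derivative R') (at_right 0)"
    and W: "\<And>\<theta>. (Vt 0 has_vector_derivative W \<theta>) (at \<theta>)"
    and WB: "\<And>\<theta>. norm (W \<theta>) \<le> B"
    and cont: "isCont (\<lambda>\<theta>. W \<theta> \<bullet> Vs 0 \<theta>) \<theta>0"
  shows "W \<theta>0 \<bullet> Vs 0 \<theta>0 = - R' / 2"
proof -
  define y where "y = (\<lambda>\<theta>. W \<theta> \<bullet> Vs 0 \<theta>)"
  define q where "q = sqrt (R 0)"
  \<comment> \<open>Error after division by h. The three terms come from pairing \<open>W\<close>
    with the linearization error of \<open>V\<close> in s, from half the squared increment of
    \<open>Vt\<close>, and from the mean slope of \<Phi>. The middle one tends to zero precisely
    because 2\<alpha> > 1.\<close>
  define E where "E = (\<lambda>h::real. B * C * h powr \<alpha> + C\<^sup>2 / 2 * h powr (2*\<alpha> - 1)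
                          + 2 * q * C * h powr (\<alpha>/2))"
  have normt0: "norm (Vt 0 \<theta>) = q" for \<theta>
    using normt[of 0 \<theta>] s0 by (simp add: q_def norm_eq_sqrt_inner)
  have C0: "0 \<le> C"
    using order_trans[OF norm_ge_zero hs[of s0 0]] s0 by (simp add: zero_le_mult_iff)
  have main: "\<exists>\<xi>. \<bar>\<xi> - \<theta>0\<bar> \<le> h powr (\<alpha>/2) \<and> \<bar>y \<xi> + (R h - R 0) / h / 2\<bar> \<le> E h"
    if h: "0 < h" "h \<le> s0" for h
  proof -
    define K where "K = (\<lambda>\<theta>. V h \<theta> - V 0 \<theta>)"
    define \<Phi> where "\<Phi> = (\<lambda>\<theta>. Vt 0 \<theta> \<bullet> K \<theta>)"
    define \<Phi>' where "\<Phi>' = (\<lambda>\<theta>. Vt 0 \<theta> \<bullet> (Vt h \<theta> - Vt 0 \<theta>) + W \<theta> \<bullet> K \<theta>)"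
    \<comment> \<open>A positive exponent is needed for \<xi> to tend to \<theta>0, and an exponent
      below \<alpha> for the slope of \<Phi> = O(h^(1+\<alpha>)) over the interval to be o(h). Half
      of \<alpha> meets both.\<close>
    define \<Delta> where "\<Delta> = h powr (\<alpha>/2)"
    have K: "norm (K \<theta> - h *\<^sub>R Vs 0 \<theta>) \<le> h * (C * h powr \<alpha>)" for \<theta>
    proof -
      have "norm (V h \<theta> - V 0 \<theta> - (h - 0) *\<^sub>R Vs 0 \<theta>) \<le> norm (h - 0) * (C * h powr \<alpha>)"
      proof (rule vector_differentiable_bound_linearization[where S = "{0..h}" and f = "\<lambda>s. V s \<theta>" and f' = "\<lambda>s. Vs s \<theta>"])
        show "((\<lambda>s. V s \<theta>) has_vector_derivative Vs s \<theta>) (at s within {0..h})"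
          if "s \<in> {0..h}" for s
          using that h by (intro has_vector_derivative_within_subset[OF ds]) auto
        show "norm (Vs s \<theta> - Vs 0 \<theta>) \<le> C * h powr \<alpha>" if "s \<in> {0..h}" for s
          using that h hs[of s \<theta>] C0 \<alpha>
          by (intro order_trans[OF hs[of s \<theta>] mult_left_mono] powr_mono2) auto
      qed (use h in \<open>auto simp: closed_segment_eq_real_ivl\<close>)
      then show ?thesis using h by (simp add: K_def)
    qed
    have \<Phi>: "(\<Phi> has_real_derivative \<Phi>' \<theta>) (at \<theta>)" for \<theta>
    proof -
      have "(K has_vector_derivative (Vt h \<theta> - Vt 0 \<theta>)) (at \<theta>)"
        unfolding K_def using h by (intro has_vector_derivative_diff dt) auto
      from bounded_bilinear.has_vector_derivative[OF bounded_bilinear_inner W[of \<theta>] this]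
      show ?thesis
        by (simp add: \<Phi>_def[abs_def] \<Phi>'_def has_real_derivative_iff_has_vector_derivative)
    qed
    have \<Phi>0: "\<bar>\<Phi> \<theta>\<bar> \<le> q * (h * (C * h powr \<alpha>))" for \<theta>
    proof -
      \<comment> \<open>Orthogonality removes the first-order term of \<open>K\<close>, which leaves
        only its linearization error.\<close>
      have "\<Phi> \<theta> = Vt 0 \<theta> \<bullet> (K \<theta> - h *\<^sub>R Vs 0 \<theta>)"
        using orth by (simp add: \<Phi>_def inner_diff_right)
      then have "\<bar>\<Phi> \<theta>\<bar> \<le> norm (Vt 0 \<theta>) * norm (K \<theta> - h *\<^sub>R Vs 0 \<theta>)"
        by (simp add: Cauchy_Schwarz_ineq2)
      also have "\<dots> \<le> q * (h * (C * h powr \<alpha>))"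
        unfolding normt0 using K normt0 norm_ge_zero by (metis mult_left_mono)
      finally show ?thesis .
    qed
    have \<Phi>'_eq: "\<bar>\<Phi>' \<theta> - (h * y \<theta> + (R h - R 0) / 2)\<bar>
        \<le> B * (h * (C * h powr \<alpha>)) + (C * h powr \<alpha>)\<^sup>2 / 2" for \<theta>
    proof -
      \<comment> \<open>Polarization: both lengths are given by \<open>R\<close>, so the unknown
        increment enters only through its square.\<close>
      have "Vt 0 \<theta> \<bullet> (Vt h \<theta> - Vt 0 \<theta>) - (R h - R 0) / 2 = - (norm (Vt h \<theta> - Vt 0 \<theta>))\<^sup>2 / 2"
        using normt[of h \<theta>] normt[of 0 \<theta>] h s0
        by (simp add: power2_norm_eq_inner inner_diff_left inner_diff_right inner_commute field_simps)
      moreover have "W \<theta> \<bullet> K \<theta> - h * y \<theta> = W \<theta> \<bullet> (K \<theta> - h *\<^sub>R Vs 0 \<theta>)"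
        by (simp add: y_def inner_diff_right)
      ultimately have *: "\<Phi>' \<theta> - (h * y \<theta> + (R h - R 0) / 2)
          = W \<theta> \<bullet> (K \<theta> - h *\<^sub>R Vs 0 \<theta>) - (norm (Vt h \<theta> - Vt 0 \<theta>))\<^sup>2 / 2"
        unfolding \<Phi>'_def by linarith
      have "\<bar>W \<theta> \<bullet> (K \<theta> - h *\<^sub>R Vs 0 \<theta>)\<bar> \<le> norm (W \<theta>) * norm (K \<theta> - h *\<^sub>R Vs 0 \<theta>)"
        by (rule Cauchy_Schwarz_ineq2)
      also have "\<dots> \<le> B * (h * (C * h powr \<alpha>))"
        using WB[of \<theta>] K[of \<theta>] order_trans[OF norm_ge_zero WB[of \<theta>]] by (intro mult_mono) auto
      finally have 1: "\<bar>W \<theta> \<bullet> (K \<theta> - h *\<^sub>R Vs 0 \<theta>)\<bar> \<le> B * (h * (C * h powr \<alpha>))" .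
      have "(norm (Vt h \<theta> - Vt 0 \<theta>))\<^sup>2 \<le> (C * h powr \<alpha>)\<^sup>2"
        using ht[of h \<theta>] h by (intro power_mono) auto
      with 1 show ?thesis
        unfolding * by (intro abs_diff_half_le) auto
    qed
    have \<Delta>: "\<Delta> > 0" using h by (simp add: \<Delta>_def)
    have "\<exists>\<xi>\<in>{\<theta>0..\<theta>0+\<Delta>}. \<Phi> (\<theta>0+\<Delta>) - \<Phi> \<theta>0 = \<Phi>' \<xi> * (\<theta>0 + \<Delta> - \<theta>0)"
      using \<Delta> \<Phi> by (intro mvt_very_simple[where f' = "\<lambda>x. (*) (\<Phi>' x)"])
        (auto simp: has_field_derivative_def intro: has_derivative_at_withinI)
    then obtain \<xi> where \<xi>: "\<xi> \<in> {\<theta>0..\<theta>0+\<Delta>}" "\<Phi>' \<xi> * \<Delta> = \<Phi> (\<theta>0+\<Delta>) - \<Phi> \<theta>0" by auto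
    have "\<bar>\<Phi>' \<xi>\<bar> * \<Delta> = \<bar>\<Phi> (\<theta>0+\<Delta>) - \<Phi> \<theta>0\<bar>"
      using \<Delta> \<xi>(2) by (simp flip: \<xi>(2) add: abs_mult)
    also have "\<dots> \<le> 2 * (q * (h * (C * h powr \<alpha>)))"
      using \<Phi>0[of \<theta>0] \<Phi>0[of "\<theta>0 + \<Delta>"] by linarith
    also have "h powr \<alpha> = h powr (\<alpha>/2) * \<Delta>"
      by (simp add: \<Delta>_def flip: powr_add)
    finally have "\<bar>\<Phi>' \<xi>\<bar> * \<Delta> \<le> (2 * q * h * C * h powr (\<alpha>/2)) * \<Delta>" by (simp add: ac_simps)
    then have "\<bar>\<Phi>' \<xi>\<bar> \<le> 2 * q * h * C * h powr (\<alpha>/2)" using \<Delta> by simp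
    then have "\<bar>h * y \<xi> + (R h - R 0) / 2\<bar>
        \<le> B * (h * (C * h powr \<alpha>)) + (C * h powr \<alpha>)\<^sup>2 / 2 + 2 * q * h * C * h powr (\<alpha>/2)"
      using \<Phi>'_eq[of \<xi>] by linarith
    also have "(C * h powr \<alpha>)\<^sup>2 / 2 = h * (C\<^sup>2 / 2 * h powr (2*\<alpha> - 1))"
    proof -
      have "(h powr \<alpha>)\<^sup>2 = h powr (2*\<alpha>)" by (simp add: power2_eq_square flip: powr_add)
      also have "\<dots> = h * h powr (2*\<alpha> - 1)" using h by (simp add: powr_diff)
      finally show ?thesis by (simp add: power_mult_distrib)
    qed
    finally have hy: "\<bar>h * y \<xi> + (R h - R 0) / 2\<bar> \<le> B * (h * (C * h powr \<alpha>))
          + h * (C\<^sup>2 / 2 * h powr (2 * \<alpha> - 1)) + 2 * q * h * C * h powr (\<alpha> / 2)" .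
    have "h * \<bar>y \<xi> + (R h - R 0) / h / 2\<bar> \<le> h * E h"
    proof -
      have "h * (y \<xi> + (R h - R 0) / h / 2) = h * y \<xi> + (R h - R 0) / 2"
        using h by (simp add: field_simps)
      then have "h * \<bar>y \<xi> + (R h - R 0) / h / 2\<bar> = \<bar>h * y \<xi> + (R h - R 0) / 2\<bar>"
        using h by (metis abs_mult abs_of_pos)
      with hy show ?thesis by (simp add: E_def algebra_simps)
    qed
    then have "\<bar>y \<xi> + (R h - R 0) / h / 2\<bar> \<le> E h" using h by simp
    with \<xi>(1) show ?thesis by (intro exI[of _ \<xi>]) (auto simp: \<Delta>_def)
  qed
  then obtain \<xi> where \<xi>: "\<And>h. 0 < h \<Longrightarrow> h \<le> s0 \<Longrightarrow> \<bar>\<xi> h - \<theta>0\<bar> \<le> h powr (\<alpha>/2)"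
      "\<And>h. 0 < h \<Longrightarrow> h \<le> s0 \<Longrightarrow> \<bar>y (\<xi> h) + (R h - R 0) / h / 2\<bar> \<le> E h"
    by metis
  have ev: "\<forall>\<^sub>F h in at_right 0. 0 < h \<and> h \<le> s0"
    using s0 eventually_at_right_less[of "0::real"] eventually_at_right_real[of 0 s0]
    by (auto elim: eventually_mono)
  have powr0: "((\<lambda>h::real. h powr p) \<longlongrightarrow> 0) (at_right 0)" if "p > 0" for p
    by (rule tendsto_zero_powrI[OF tendsto_ident_at tendsto_const _ that])
      (use eventually_at_right_less[of "0::real"] in \<open>rule eventually_mono, simp\<close>)
  have "((\<lambda>h. \<xi> h - \<theta>0) \<longlongrightarrow> 0) (at_right 0)"
  proof (rule Lim_null_comparison)
    show "\<forall>\<^sub>F h in at_right 0. norm (\<xi> h - \<theta>0) \<le> h powr (\<alpha>/2)"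
      using ev by (rule eventually_mono) (use \<xi>(1) in auto)
  qed (use \<alpha> in \<open>intro powr0, simp\<close>)
  then have "(\<xi> \<longlongrightarrow> \<theta>0) (at_right 0)" by (simp add: LIM_zero_iff)
  then have 1: "((\<lambda>h. y (\<xi> h)) \<longlongrightarrow> y \<theta>0) (at_right 0)"
    using cont unfolding y_def by (rule isCont_tendsto_compose[rotated])
  have "((\<lambda>h. (R h - R 0) / h) \<longlongrightarrow> R') (at_right 0)"
    using R' by (simp add: has_field_derivative_iff)
  from tendsto_add[OF 1 tendsto_divide[OF this tendsto_const[of 2]]]
  have 2: "((\<lambda>h. y (\<xi> h) + (R h - R 0) / h / 2) \<longlongrightarrow> y \<theta>0 + R' / 2) (at_right 0)" by simp
  have "(E \<longlongrightarrow> B * C * 0 + C\<^sup>2 / 2 * 0 + 2 * q * C * 0) (at_right 0)"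
    unfolding E_def by (intro tendsto_add tendsto_mult tendsto_const powr0) (use \<alpha> in simp_all)
  then have E0: "(E \<longlongrightarrow> 0) (at_right 0)" by simp
  have "((\<lambda>h. y (\<xi> h) + (R h - R 0) / h / 2) \<longlongrightarrow> 0) (at_right 0)"
  proof (rule Lim_null_comparison[OF _ E0])
    show "\<forall>\<^sub>F h in at_right 0. norm (y (\<xi> h) + (R h - R 0) / h / 2) \<le> E h"
      using ev by (rule eventually_mono) (use \<xi>(2) in auto)
  qed
  from tendsto_unique[OF _ 2 this] show ?thesis by (simp add: y_def)
qed

section \<open>Linearity and bounds of the differential on the cap\<close>

lemma cap_differential_linear:
  assumes "v differentiable (at p within cap a)"
  shows "bounded_linear (cap_differential a v p)"
proof -
  have "bounded_linear (frechet_derivative v (at p within cap a))"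
    using assms frechet_derivative_works has_derivative_bounded_linear by blast
  moreover have "bounded_linear (tangent_proj p)"
    unfolding tangent_proj_def[abs_def]
    by (intro bounded_linear_sub bounded_linear_ident
        bounded_linear_compose[OF bounded_linear_scaleR_left bounded_linear_inner_right])
  ultimately show ?thesis
    unfolding cap_differential_def[abs_def] by (rule bounded_linear_compose)
qed

lemma tangent_proj_in_tangent_space: "p \<in> cap a \<Longrightarrow> tangent_proj p w \<in> tangent_space p"
  by (simp add: tangent_proj_def tangent_space_def cap_iff_norm norm_eq_1 inner_diff_right)

lemma tangent_proj_tangent: "w \<in> tangent_space p \<Longrightarrow> tangent_proj p w = w"
  by (simp add: tangent_proj_def tangent_space_def)

lemma norm_tangent_proj_le: "p \<in> cap a \<Longrightarrow> norm (tangent_proj p w) \<le> norm w"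
proof -
  assume "p \<in> cap a"
  then have pp: "p \<bullet> p = 1" by (simp add: cap_iff_norm norm_eq_1)
  have "tangent_proj p w \<bullet> tangent_proj p w = w \<bullet> w - (p \<bullet> w)\<^sup>2"
    using pp inner_commute[of w p]
    by (simp add: tangent_proj_def inner_diff_left inner_diff_right power2_eq_square)
  then have "(norm (tangent_proj p w))\<^sup>2 \<le> (norm w)\<^sup>2"
    unfolding power2_norm_eq_inner using zero_le_power2[of "p \<bullet> w"] by linarith
  then show ?thesis by (rule power2_le_imp_le) (rule norm_ge_zero)
qed

lemma cap_differential_tangent_proj:
  "p \<in> cap a \<Longrightarrow> cap_differential a v p (tangent_proj p w) = cap_differential a v p w"
  by (simp add: cap_differential_def tangent_proj_tangent tangent_proj_in_tangent_space)

lemma norm_cap_differential_le: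
  assumes "isometric_cap a v" "p \<in> cap a"
  shows "norm (cap_differential a v p w) \<le> norm w"
proof -
  have "norm (cap_differential a v p (tangent_proj p w)) = norm (tangent_proj p w)"
    using assms tangent_proj_in_tangent_space[OF assms(2)]
    by (simp add: isometric_cap_def norm_eq_sqrt_inner)
  then show ?thesis
    using norm_tangent_proj_le[OF assms(2), of w] cap_differential_tangent_proj[OF assms(2), of v w]
    by simp
qed

text \<open>Tangency of the velocity is what makes the derivative within the cap agree with
  \<open>cap_differential\<close>. The parameter set is arbitrary, so curves that start at the
  boundary are covered.\<close>

lemma cap_curve_has_vector_derivative:
  assumes a: "-1 < a" "a < 1" and v: "v differentiable (at (c t) within cap a)"
    and c: "c ` T \<subseteq> cap a" "t \<in> T" "(c has_vector_derivative c') (at t within T)"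
    and c': "c' \<in> tangent_space (c t)"
  shows "((\<lambda>t. v (c t)) has_vector_derivative cap_differential a v (c t) c') (at t within T)"
proof -
  obtain F where F: "(v has_derivative F) (at (c t) within cap a)"
    using v by (auto simp: differentiable_def)
  have "((v \<circ> c) has_derivative (F \<circ> (\<lambda>x. x *\<^sub>R c'))) (at t within T)"
    using has_derivative_subset[OF F c(1)] c(3)
    by (intro diff_chain_within) (auto simp: has_vector_derivative_def)
  moreover have "F \<circ> (\<lambda>x. x *\<^sub>R c') = (\<lambda>x. x *\<^sub>R F c')"
    using has_derivative_bounded_linear[OF F] by (auto simp: linear_simps)
  moreover have "cap_differential a v (c t) c' = F c'"
    using c by (intro cap_differential_eq[OF a _ c' F]) auto
  ultimately show ?thesis by (simp add: has_vector_derivative_def o_def)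
qed

lemma C1_holder_capD:
  assumes "C1_holder_cap \<alpha> a v"
  obtains C where "0 \<le> C" "\<And>p q w. p \<in> cap a \<Longrightarrow> q \<in> cap a \<Longrightarrow>
    norm (cap_differential a v p w - cap_differential a v q w) \<le> C * dist p q powr \<alpha> * norm w"
proof -
  obtain C where C: "\<And>p q. p \<in> cap a \<Longrightarrow> q \<in> cap a \<Longrightarrow>
      onorm (\<lambda>w. cap_differential a v p w - cap_differential a v q w) \<le> C * dist p q powr \<alpha>"
    using assms by (auto simp: C1_holder_cap_def)
  have "norm (cap_differential a v p w - cap_differential a v q w) \<le> max C 0 * dist p q powr \<alpha> * norm w"
    if pq: "p \<in> cap a" "q \<in> cap a" for p q w
  proof -
    have "bounded_linear (\<lambda>w. cap_differential a v p w - cap_differential a v q w)"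
      using assms pq by (intro bounded_linear_sub cap_differential_linear) (auto simp: C1_holder_cap_def)
    from onorm[OF this, of w]
    have "norm (cap_differential a v p w - cap_differential a v q w)
        \<le> onorm (\<lambda>w. cap_differential a v p w - cap_differential a v q w) * norm w" .
    also have "\<dots> \<le> max C 0 * dist p q powr \<alpha> * norm w"
      by (rule mult_right_mono[OF order_trans[OF C[OF pq] mult_right_mono]]) auto
    finally show ?thesis .
  qed
  then show ?thesis by (intro that[of "max C 0"]) auto
qed

text \<open>In the coordinates \<open>P\<close>, the curve \<open>V 0\<close> is the circle of
  radius \<rho>, so the second \<theta>-derivative is \<open>- \<rho> *\<^sub>R U \<theta>\<close>
  with \<open>U\<close> equal to minus \<open>Z\<close>, while the squared radius has derivative -2
  \<rho> a at s = 0. The previous result then gives \<rho> times the claim.\<close>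

theorem boundary_normal_rigid:
  fixes v :: "real^3 \<Rightarrow> (real^2) \<times> (real^'k::finite)"
  assumes \<alpha>: "1/2 < \<alpha>" "\<alpha> < 1" and a: "-1 < a" "a < 1" and v: "v \<in> isometric_immersions \<alpha> a"
    and q: "q \<in> boundary_circle a"
  shows "Y_field a v q \<bullet> Z_field a q = a"
proof -
  define D where "D = cap_differential a v"
  define \<rho> where "\<rho> = sqrt (1 - a\<^sup>2)"
  have "a\<^sup>2 < 1" using a by (simp add: abs_square_less_1)
  then have \<rho>: "\<rho> > 0" "\<rho> * \<rho> = 1 - a * a" by (simp_all add: \<rho>_def power2_eq_square)
  have holder: "C1_holder_cap \<alpha> a v" and iso: "isometric_cap a v"
    and bd: "\<And>x. x \<in> cap_boundary a \<Longrightarrow> v x = (vector [x$1, x$2], 0)"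
    using v by (auto simp: isometric_immersions_def)
  have diff: "v differentiable (at p within cap a)" if "p \<in> cap a" for p
    using holder that by (simp add: C1_holder_cap_def)
  obtain C where C: "0 \<le> C" "\<And>p q w. p \<in> cap a \<Longrightarrow> q \<in> cap a \<Longrightarrow>
      norm (D p w - D q w) \<le> C * dist p q powr \<alpha> * norm w"
    using C1_holder_capD[OF holder] unfolding D_def by metis
  \<comment> \<open>Base point and vector both move. The Hoelder bound pays for the first; an
    isometric differential extended by zero along the normal does not increase norms, which pays for
    the second.\<close>
  have D_diff: "norm (D p w - D q w') \<le> C * dist p q powr \<alpha> * norm w + norm (w - w')"
    if "p \<in> cap a" "q \<in> cap a" for p q w w'
  proof -
    have lin: "linear (D q)"
      unfolding D_def by (rule bounded_linear.linear[OF cap_differential_linear[OF diff[OF that(2)]]])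
    have "norm (D q (w - w')) \<le> norm (w - w')"
      unfolding D_def by (rule norm_cap_differential_le[OF iso that(2)])
    moreover have "norm (D p w - D q w') = norm ((D p w - D q w) + D q (w - w'))"
      unfolding linear_diff[OF lin] by simp
    ultimately show ?thesis
      using C(2)[OF that, of w] norm_triangle_ineq[of "D p w - D q w" "D q (w - w')"] by linarith
  qed
  define e3 :: "real^3" where "e3 = axis 3 1"
  define u :: "real \<Rightarrow> real^3" where "u = (\<lambda>\<theta>. cos \<theta> *\<^sub>R axis 1 1 + sin \<theta> *\<^sub>R axis 2 1)"
  define u' :: "real \<Rightarrow> real^3" where "u' = (\<lambda>\<theta>. - sin \<theta> *\<^sub>R axis 1 1 + cos \<theta> *\<^sub>R axis 2 1)"
  have inn: "u \<theta> \<bullet> u \<theta> = 1" "u' \<theta> \<bullet> u' \<theta> = 1" "u \<theta> \<bullet> u' \<theta> = 0" "u' \<theta> \<bullet> u \<theta> = 0" "u \<theta> \<bullet> e3 = 0" "u' \<theta> \<bullet> e3 = 0"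
    "e3 \<bullet> u \<theta> = 0" "e3 \<bullet> u' \<theta> = 0" "e3 \<bullet> e3 = 1" for \<theta>
    by (simp_all add: u_def u'_def e3_def inner_3 axis_def flip: power2_eq_square)
  have comp: "u \<theta> $ 1 = cos \<theta>" "u \<theta> $ 2 = sin \<theta>" "u \<theta> $ 3 = 0" "e3 $ 1 = 0" "e3 $ 2 = 0" "e3 $ 3 = 1" for \<theta>
    by (simp_all add: u_def e3_def axis_def)
  have norm1: "norm (u \<theta>) = 1" "norm (u' \<theta>) = 1" "norm e3 = 1" for \<theta>
    using inn by (simp_all add: norm_eq_1)
  \<comment> \<open>Radius and height of the parallel at arc length s from the boundary: the point
    (\<rho>, a) of the unit circle rotated by s.\<close>
  define r where "r = (\<lambda>s. \<rho> * cos s - a * sin s)"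
  define H where "H = (\<lambda>s. a * cos s + \<rho> * sin s)"
  have rH: "r s * r s + H s * H s = 1" for s
  proof -
    have "r s * r s + H s * H s = (\<rho> * \<rho> + a * a) * (cos s * cos s + sin s * sin s)"
      unfolding r_def H_def by algebra
    then show ?thesis using \<rho> by (simp only: sin_cos_squared_add3) simp
  qed
  have dr: "(r has_real_derivative - H s) (at s within S)" for s S
    unfolding r_def H_def by (auto intro!: derivative_eq_intros)
  have dH: "(H has_real_derivative r s) (at s within S)" for s S
    unfolding r_def H_def by (auto intro!: derivative_eq_intros)
  have rH1: "\<bar>r s\<bar> \<le> 1" "\<bar>H s\<bar> \<le> 1" for s
  proof -
    have "(r s)\<^sup>2 \<le> 1" "(H s)\<^sup>2 \<le> 1"
      using rH[of s] zero_le_square[of "r s"] zero_le_square[of "H s"]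
      unfolding power2_eq_square by linarith+
    then show "\<bar>r s\<bar> \<le> 1" "\<bar>H s\<bar> \<le> 1" by (simp_all add: abs_square_le_1)
  qed
  have rlip: "\<bar>r s - r t\<bar> \<le> \<bar>s - t\<bar>" and Hlip: "\<bar>H s - H t\<bar> \<le> \<bar>s - t\<bar>" for s t
    using field_differentiable_bound[of UNIV r "\<lambda>s. - H s" 1 s t] dr rH1(2)
      field_differentiable_bound[of UNIV H r 1 s t] dH rH1(1) by auto
  have r0: "r 0 = \<rho>" "H 0 = a" by (simp_all add: r_def H_def)
  define P where "P = (\<lambda>s \<theta>. r s *\<^sub>R u \<theta> + H s *\<^sub>R e3)"
  define Ps where "Ps = (\<lambda>s \<theta>. r s *\<^sub>R e3 - H s *\<^sub>R u \<theta>)"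
  define Pt where "Pt = (\<lambda>s \<theta>. r s *\<^sub>R u' \<theta>)"
  have P3: "P s \<theta> $ 3 = H s" for s \<theta> by (simp add: P_def comp)
  have P1: "norm (P s \<theta>) = 1" for s \<theta>
    using rH[of s] by (simp add: P_def norm_eq_1 inner_add_left inner_add_right inn)
  have Ps1: "norm (Ps s \<theta>) = 1" for s \<theta>
    using rH[of s] by (simp add: Ps_def norm_eq_1 inner_diff_left inner_diff_right inner_add_left inner_add_right inn)
  have tan: "Ps s \<theta> \<in> tangent_space (P s \<theta>)" "Pt s \<theta> \<in> tangent_space (P s \<theta>)" for s \<theta>
    by (simp_all add: tangent_space_def P_def Ps_def Pt_def inner_diff_left inner_diff_right inner_add_left inner_add_right inn)
  obtain d where d: "d > 0" "\<And>s. 0 < s \<Longrightarrow> s < d \<Longrightarrow> H 0 < H (0 + s)"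
    using DERIV_pos_inc_right[OF dH[of 0 UNIV]] r0 \<rho> by auto
  \<comment> \<open>\<open>d/2\<close> keeps the strip inside the cap; the bound 1 gives s \<le>
    s^\<alpha>, which absorbs the Lipschitz terms into the Hoelder bound.\<close>
  define s0 where "s0 = min (d/2) 1"
  have s0: "0 < s0" "s0 \<le> 1" using d by (auto simp: s0_def)
  have Pcap: "P s \<theta> \<in> cap a" if "s \<in> {0..s0}" for s \<theta>
  proof -
    have "H s \<ge> a" using that d(2)[of s] d(1) r0 by (cases "s = 0") (auto simp: s0_def)
    then show ?thesis using P1 P3 by (simp add: cap_iff_norm)
  qed
  have z0: "(0::real) \<in> {0..s0}" using s0 by simp
  define V where "V = (\<lambda>s \<theta>. v (P s \<theta>))"
  define Vs where "Vs = (\<lambda>s \<theta>. D (P s \<theta>) (Ps s \<theta>))"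
  define Vt where "Vt = (\<lambda>s \<theta>. D (P s \<theta>) (Pt s \<theta>))"
  have du: "(u has_vector_derivative u' \<theta>) (at \<theta> within S)" for \<theta> S
    unfolding u_def u'_def by (auto intro!: derivative_eq_intros)
  have dPs: "((\<lambda>s. P s \<theta>) has_vector_derivative Ps s \<theta>) (at s within S)" for s \<theta> S
    unfolding P_def Ps_def
    by (rule has_vector_derivative_eq_rhs,
        (rule has_vector_derivative_add has_vector_derivative_scaleR dr dH has_vector_derivative_const)+, simp)
  have dPt: "(P s has_vector_derivative Pt s \<theta>) (at \<theta> within S)" for s \<theta> S
    unfolding P_def Pt_def using du by (auto intro!: derivative_eq_intros)
  have ds: "((\<lambda>s. V s \<theta>) has_vector_derivative Vs s \<theta>) (at s within {0..s0})"
    if "s \<in> {0..s0}" for s \<theta>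
    unfolding V_def Vs_def D_def
    using cap_curve_has_vector_derivative[OF a, of v "\<lambda>s. P s \<theta>" s "{0..s0}"] Pcap dPs tan diff that
    by blast
  have dt: "(V s has_vector_derivative Vt s \<theta>) (at \<theta>)" if "s \<in> {0..s0}" for s \<theta>
    unfolding V_def Vt_def D_def
    using cap_curve_has_vector_derivative[OF a, of v "P s" \<theta> UNIV] Pcap dPt tan diff that
    by blast
  have PP: "dist (P s \<theta>) (P 0 \<theta>) \<le> 2 * s" if "s \<in> {0..s0}" for s \<theta>
  proof -
    have "P s \<theta> - P 0 \<theta> = (r s - r 0) *\<^sub>R u \<theta> + (H s - H 0) *\<^sub>R e3"
      by (simp add: P_def algebra_simps)
    also have "norm \<dots> \<le> \<bar>r s - r 0\<bar> + \<bar>H s - H 0\<bar>"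
      by (rule order_trans[OF norm_triangle_ineq]) (simp add: norm1)
    finally show ?thesis using rlip[of s 0] Hlip[of s 0] that by (simp add: dist_norm)
  qed
  have PsPs: "norm (Ps s \<theta> - Ps 0 \<theta>) \<le> 2 * s" if "s \<in> {0..s0}" for s \<theta>
  proof -
    have "Ps s \<theta> - Ps 0 \<theta> = (H 0 - H s) *\<^sub>R u \<theta> + (r s - r 0) *\<^sub>R e3"
      by (simp add: Ps_def algebra_simps)
    also have "norm \<dots> \<le> \<bar>H s - H 0\<bar> + \<bar>r s - r 0\<bar>"
      by (rule order_trans[OF norm_triangle_ineq]) (simp add: norm1)
    finally show ?thesis using rlip[of s 0] Hlip[of s 0] that by simp
  qed
  have PtPt: "norm (Pt s \<theta> - Pt 0 \<theta>) \<le> 2 * s" if "s \<in> {0..s0}" for s \<theta>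
    using rlip[of s 0] that by (simp add: Pt_def norm1 flip: scaleR_diff_left)
  have bound: "C * dist (P s \<theta>) (P 0 \<theta>) powr \<alpha> * norm w + x \<le> (C * 2 powr \<alpha> + 2) * s powr \<alpha>"
    if s: "s \<in> {0..s0}" and "norm w \<le> 1" "x \<le> 2 * s" for s \<theta> x and w :: "real^3"
  proof -
    have "dist (P s \<theta>) (P 0 \<theta>) powr \<alpha> \<le> (2 * s) powr \<alpha>"
      using PP[OF s] \<alpha> by (intro powr_mono2) auto
    also have "\<dots> = 2 powr \<alpha> * s powr \<alpha>" using s by (simp add: powr_mult)
    finally have "C * dist (P s \<theta>) (P 0 \<theta>) powr \<alpha> * norm w \<le> C * (2 powr \<alpha> * s powr \<alpha>) * 1"
      using C(1) that(2) by (intro mult_mono) auto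
    moreover have "s \<le> s powr \<alpha>"
    proof (cases "s = 0")
      case False
      then have "s powr 1 \<le> s powr \<alpha>" using s s0 \<alpha> by (intro powr_mono') auto
      then show ?thesis using s by simp
    qed simp
    ultimately show ?thesis using that(3) by (simp add: algebra_simps)
  qed
  have hs: "norm (Vs s \<theta> - Vs 0 \<theta>) \<le> (C * 2 powr \<alpha> + 2) * s powr \<alpha>" if "s \<in> {0..s0}" for s \<theta>
    unfolding Vs_def
    using D_diff[OF Pcap[OF that] Pcap[OF z0], of \<theta> "Ps s \<theta>" \<theta> "Ps 0 \<theta>"]
      bound[OF that _ PsPs[OF that], of "Ps s \<theta>" \<theta> \<theta>] by (simp add: Ps1)
  have ht: "norm (Vt s \<theta> - Vt 0 \<theta>) \<le> (C * 2 powr \<alpha> + 2) * s powr \<alpha>" if "s \<in> {0..s0}" for s \<theta>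
    unfolding Vt_def
    using D_diff[OF Pcap[OF that] Pcap[OF z0], of \<theta> "Pt s \<theta>" \<theta> "Pt 0 \<theta>"]
      bound[OF that _ PtPt[OF that], of "Pt s \<theta>" \<theta> \<theta>] rH1(1)[of s] by (simp add: Pt_def norm1)
  have iso': "D p w \<bullet> D p w' = w \<bullet> w'" if "p \<in> cap a" "w \<in> tangent_space p" "w' \<in> tangent_space p" for p w w'
    using iso that unfolding isometric_cap_def D_def by blast
  have normt: "Vt s \<theta> \<bullet> Vt s \<theta> = (r s)\<^sup>2" if "s \<in> {0..s0}" for s \<theta>
    unfolding Vt_def using iso'[OF Pcap[OF that] tan(2) tan(2)]
    by (simp add: Pt_def inn power2_eq_square)
  have orth: "Vt 0 \<theta> \<bullet> Vs 0 \<theta> = 0" for \<theta>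
    unfolding Vt_def Vs_def using iso'[OF Pcap[OF z0] tan(2) tan(1)]
    by (simp add: Pt_def Ps_def inn inner_add_right inner_diff_right)
  have R': "((\<lambda>s. (r s)\<^sup>2) has_real_derivative - 2 * \<rho> * a) (at_right 0)"
    using dr[of 0] r0 by (auto intro!: derivative_eq_intros)
  define U :: "real \<Rightarrow> (real^2) \<times> (real^'k)" where "U = (\<lambda>\<theta>. cos \<theta> *\<^sub>R (axis 1 1, 0) + sin \<theta> *\<^sub>R (axis 2 1, 0))"
  define U' :: "real \<Rightarrow> (real^2) \<times> (real^'k)" where "U' = (\<lambda>\<theta>. - sin \<theta> *\<^sub>R (axis 1 1, 0) + cos \<theta> *\<^sub>R (axis 2 1, 0))"
  have dU: "(U has_vector_derivative U' \<theta>) (at \<theta>)" for \<theta>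
    unfolding U_def U'_def by (rule derivative_eq_intros refl | simp)+
  have dU': "(U' has_vector_derivative - U \<theta>) (at \<theta>)" for \<theta>
    unfolding U_def U'_def by (rule derivative_eq_intros refl | simp)+
  have Pbd: "P 0 \<theta> \<in> cap_boundary a" for \<theta>
    using Pcap[OF z0, of \<theta>] by (simp add: cap_boundary_def P3 r0)
  have V0: "V 0 = (\<lambda>\<theta>. \<rho> *\<^sub>R U \<theta>)"
  proof
    fix \<theta>
    have "(vector [\<rho> * cos \<theta>, \<rho> * sin \<theta>] :: real^2) = \<rho> *\<^sub>R (cos \<theta> *\<^sub>R axis 1 1 + sin \<theta> *\<^sub>R axis 2 1)"
      by (simp add: vec_eq_iff forall_2 axis_def)
    then show "V 0 \<theta> = \<rho> *\<^sub>R U \<theta>"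
      using bd[OF Pbd, of \<theta>] by (simp add: V_def U_def P_def comp r0 scaleR_add_right)
  qed
  have Vt0: "Vt 0 = (\<lambda>\<theta>. \<rho> *\<^sub>R U' \<theta>)"
  proof
    fix \<theta>
    have "(V 0 has_vector_derivative \<rho> *\<^sub>R U' \<theta>) (at \<theta>)"
      unfolding V0 using dU by (auto intro!: derivative_eq_intros)
    from vector_derivative_unique_at[OF dt[OF z0] this] show "Vt 0 \<theta> = \<rho> *\<^sub>R U' \<theta>" .
  qed
  have W: "(Vt 0 has_vector_derivative - \<rho> *\<^sub>R U \<theta>) (at \<theta>)" for \<theta>
    unfolding Vt0 using dU' by (auto intro!: derivative_eq_intros)
  have normU: "norm (U \<theta>) = 1" for \<theta>
    by (simp add: U_def norm_eq_1 inner_add_left inner_add_right inner_axis_axis flip: power2_eq_square)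
  have WB: "norm (- \<rho> *\<^sub>R U \<theta>) \<le> \<rho>" for \<theta> using \<rho> by (simp add: normU)
  have cont: "isCont (\<lambda>\<theta>. (- \<rho> *\<^sub>R U \<theta>) \<bullet> Vs 0 \<theta>) \<theta>0" for \<theta>0
  proof -
    have cP: "isCont (P 0) \<theta>0" using dPt[of 0 \<theta>0 UNIV] by (rule has_vector_derivative_continuous)
    have cU: "isCont U \<theta>0" using dU by (rule has_vector_derivative_continuous)
    have cPs: "isCont (Ps 0) \<theta>0"
      unfolding Ps_def using has_vector_derivative_continuous[OF du[of \<theta>0 UNIV]] by (intro continuous_intros)
    have "((\<lambda>\<theta>. Vs 0 \<theta> - Vs 0 \<theta>0) \<longlongrightarrow> 0) (at \<theta>0)"
    proof (rule Lim_null_comparison)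
      show "\<forall>\<^sub>F \<theta> in at \<theta>0. norm (Vs 0 \<theta> - Vs 0 \<theta>0)
          \<le> C * dist (P 0 \<theta>) (P 0 \<theta>0) powr \<alpha> * norm (Ps 0 \<theta>) + norm (Ps 0 \<theta> - Ps 0 \<theta>0)"
        unfolding Vs_def using D_diff[OF Pcap[OF z0] Pcap[OF z0]] by (intro always_eventually) blast
      have "((\<lambda>\<theta>. dist (P 0 \<theta>) (P 0 \<theta>0)) \<longlongrightarrow> dist (P 0 \<theta>0) (P 0 \<theta>0)) (at \<theta>0)"
        using cP unfolding isCont_def by (rule tendsto_dist[OF _ tendsto_const])
      then have 0: "((\<lambda>\<theta>. dist (P 0 \<theta>) (P 0 \<theta>0) powr \<alpha>) \<longlongrightarrow> 0) (at \<theta>0)"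
        using \<alpha> by (intro tendsto_zero_powrI[OF _ tendsto_const]) auto
      have 1: "((\<lambda>\<theta>. norm (Ps 0 \<theta> - Ps 0 \<theta>0)) \<longlongrightarrow> 0) (at \<theta>0)"
        using cPs unfolding isCont_def by (simp add: LIM_zero tendsto_norm_zero)
      show "((\<lambda>\<theta>. C * dist (P 0 \<theta>) (P 0 \<theta>0) powr \<alpha> * norm (Ps 0 \<theta>) + norm (Ps 0 \<theta> - Ps 0 \<theta>0)) \<longlongrightarrow> 0) (at \<theta>0)"
        using tendsto_add[OF tendsto_mult[OF tendsto_const[of C] 0] 1] by (simp add: Ps1)
    qed
    then have "isCont (Vs 0) \<theta>0" unfolding isCont_def by (simp add: LIM_zero_iff)
    with cU show ?thesis by (intro continuous_intros)
  qed
  have key: "- \<rho> *\<^sub>R U \<theta>0 \<bullet> Vs 0 \<theta>0 = - (- 2 * \<rho> * a) / 2" for \<theta>0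
  proof (rule inner_second_derivative_eq[where V = V and Vs = Vs and Vt = Vt and R = "\<lambda>s. (r s)\<^sup>2"
        and W = "\<lambda>\<theta>. - \<rho> *\<^sub>R U \<theta>" and B = \<rho> and C = "C * 2 powr \<alpha> + 2" and \<alpha> = \<alpha> and ?s0.0 = s0
        and R' = "- 2 * \<rho> * a" and ?\<theta>0.0 = \<theta>0])
    show "1/2 < \<alpha>" by (rule \<alpha>)
    show "0 < s0" by (rule s0)
    show "((\<lambda>s. V s \<theta>) has_vector_derivative Vs s \<theta>) (at s within {0..s0})" if "s \<in> {0..s0}" for s \<theta>
      using that by (rule ds)
    show "(V s has_vector_derivative Vt s \<theta>) (at \<theta>)" if "s \<in> {0..s0}" for s \<theta>
      using that by (rule dt)
    show "Vt s \<theta> \<bullet> Vt s \<theta> = (r s)\<^sup>2" if "s \<in> {0..s0}" for s \<theta>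
      using that by (rule normt)
    show "((\<lambda>s. (r s)\<^sup>2) has_real_derivative - 2 * \<rho> * a) (at_right 0)" by (rule R')
    show "isCont (\<lambda>\<theta>. - \<rho> *\<^sub>R U \<theta> \<bullet> Vs 0 \<theta>) \<theta>0" by (rule cont)
  qed (rule orth hs ht W WB | assumption)+
  obtain p where p: "p \<in> cap_boundary a" "v p = q"
  proof -
    have "q \<in> v ` cap_boundary a" unfolding boundary_circle_eq_image(1)[OF v] by (rule q)
    then show ?thesis using that by (elim imageE) simp
  qed
  have inv: "the_inv_into (cap_boundary a) v q = p"
    using the_inv_into_f_f[OF boundary_circle_eq_image(2)[OF v] p(1)] p(2) by simp
  have p3: "p $ 3 = a" and p12: "(p$1)\<^sup>2 + (p$2)\<^sup>2 = \<rho> * \<rho>"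
    using p(1) \<rho> by (auto simp: cap_boundary_def cap_def power2_eq_square)
  have "(p$1 / \<rho>)\<^sup>2 + (p$2 / \<rho>)\<^sup>2 = 1"
    using p12 \<rho>(1) by (simp add: power_divide power2_eq_square flip: add_divide_distrib)
  then obtain \<theta> where "p$1 / \<rho> = cos \<theta>" "p$2 / \<rho> = sin \<theta>" using sincos_total_2pi by metis
  then have "p$1 = \<rho> * cos \<theta>" "p$2 = \<rho> * sin \<theta>" using \<rho>(1) by (auto simp: field_simps)
  then have pP: "p = P 0 \<theta>" using p3 by (simp add: vec_eq_iff forall_3 P_def comp r0)
  have n: "interior_unit_normal p = Ps 0 \<theta>"
  proof -
    have "\<rho> *\<^sub>R interior_unit_normal p = e3 - a *\<^sub>R p"
      using interior_unit_normal_eq(2)[OF a p(1)] \<rho>(1) by (simp add: \<rho>_def[symmetric] e3_def)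
    also have "\<dots> = (1 - a * a) *\<^sub>R e3 - (a * \<rho>) *\<^sub>R u \<theta>"
      by (simp add: pP P_def r0 algebra_simps)
    also have "\<dots> = \<rho> *\<^sub>R Ps 0 \<theta>"
      by (simp add: Ps_def r0 scaleR_add_right scaleR_diff_right mult.commute flip: \<rho>(2))
    finally show ?thesis using \<rho>(1) by simp
  qed
  have "q = V 0 \<theta>" unfolding V_def pP[symmetric] by (rule p(2)[symmetric])
  also have "\<dots> = \<rho> *\<^sub>R U \<theta>" by (simp only: V0)
  finally have "q = \<rho> *\<^sub>R U \<theta>" .
  then have Z: "Z_field a q = - U \<theta>"
    using \<rho>(1) unfolding Z_field_def \<rho>_def[symmetric] by simp
  have Y: "Y_field a v q = Vs 0 \<theta>"
    unfolding Y_field_def inv Let_def n Vs_def D_def by (simp only: pP)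
  have "\<rho> * (- (U \<theta> \<bullet> Vs 0 \<theta>)) = \<rho> * a" using key[of \<theta>] by simp
  then have "- (U \<theta> \<bullet> Vs 0 \<theta>) = a" unfolding mult_cancel_left using \<rho>(1) by simp
  then show ?thesis unfolding Y Z by (simp add: inner_commute)
qed

section \<open>Moduli of continuity\<close>

text \<open>\<open>lipschitz_le\<close> admits Lipschitz functions on bounded sets to the class. The
  bound \<open>D\<close> is there because the square root dominates the identity only up to a
  constant depending on the diameter.\<close>

locale modulus =
  fixes w :: "nat \<Rightarrow> real \<Rightarrow> real"
  assumes nonneg: "0 \<le> d \<Longrightarrow> 0 \<le> w q d"
    and mono: "0 \<le> d \<Longrightarrow> d \<le> d' \<Longrightarrow> w q d \<le> w q d'"
    and lipschitz_le: "\<exists>c\<ge>0. \<forall>q d. 0 \<le> d \<and> d \<le> D \<longrightarrow> d \<le> c * w q d"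
begin

text \<open>Uniform control of a family: the \<open>q\<close>-th member has modulus of continuity \<open>w q\<close> up to a
  common constant.  With \<open>w q d = 2\<^sup>q d\<close> this is Lipschitz control of oscillations of frequency
  \<open>2\<^sup>q\<close>, with \<open>w q d = \<surd>d\<close> it is a uniform Hoelder bound.  A single function is a
  constant family.\<close>

definition ctl :: "'a::metric_space set \<Rightarrow> (nat \<Rightarrow> 'a \<Rightarrow> 'b::real_normed_vector) \<Rightarrow> bool" where
  "ctl S f \<longleftrightarrow> (\<exists>C. \<forall>q. \<forall>x\<in>S. norm (f q x) \<le> C \<and>
      (\<forall>y\<in>S. norm (f q x - f q y) \<le> C * w q (dist x y)))"

lemma ctlI:
  assumes "\<And>q x. x \<in> S \<Longrightarrow> norm (f q x) \<le> C"
    and "\<And>q x y. x \<in> S \<Longrightarrow> y \<in> S \<Longrightarrow> norm (f q x - f q y) \<le> C' * w q (dist x y)"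
  shows "ctl S f"
proof -
  have "norm (f q x - f q y) \<le> max C C' * w q (dist x y)" if "x \<in> S" "y \<in> S" for q x y
    using assms(2)[OF that, of q] mult_right_mono[of C' "max C C'" "w q (dist x y)"] nonneg[of "dist x y" q]
    by simp
  moreover have "norm (f q x) \<le> max C C'" if "x \<in> S" for q x
    using assms(1)[OF that, of q] by simp
  ultimately show ?thesis unfolding ctl_def by blast
qed

lemma ctlE:
  assumes "ctl S f"
  obtains C where "0 \<le> C" "\<And>q x. x \<in> S \<Longrightarrow> norm (f q x) \<le> C"
    "\<And>q x y. x \<in> S \<Longrightarrow> y \<in> S \<Longrightarrow> norm (f q x - f q y) \<le> C * w q (dist x y)"
proof -
  obtain C where C: "\<And>q x. x \<in> S \<Longrightarrow> norm (f q x) \<le> C"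
    "\<And>q x y. x \<in> S \<Longrightarrow> y \<in> S \<Longrightarrow> norm (f q x - f q y) \<le> C * w q (dist x y)"
    using assms unfolding ctl_def by blast
  have "norm (f q x - f q y) \<le> max C 0 * w q (dist x y)" if "x \<in> S" "y \<in> S" for q x y
    using C(2)[OF that, of q] mult_right_mono[of C "max C 0" "w q (dist x y)"] nonneg[of "dist x y" q]
    by simp
  then show ?thesis using C(1) by (intro that[of "max C 0"]) (auto intro: max.coboundedI1)
qed

lemma ctl_const: "ctl S (\<lambda>q x. c)"
  by (rule ctlI[of _ _ "norm c" 0]) auto

lemma ctl_add:
  assumes "ctl S f" "ctl S g"
  shows "ctl S (\<lambda>q x. f q x + g q x)"
proof -
  obtain C where C: "\<And>q x. x \<in> S \<Longrightarrow> norm (f q x) \<le> C"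
    "\<And>q x y. x \<in> S \<Longrightarrow> y \<in> S \<Longrightarrow> norm (f q x - f q y) \<le> C * w q (dist x y)"
    using assms(1) by (rule ctlE) (rule that; blast)
  obtain D where D: "\<And>q x. x \<in> S \<Longrightarrow> norm (g q x) \<le> D"
    "\<And>q x y. x \<in> S \<Longrightarrow> y \<in> S \<Longrightarrow> norm (g q x - g q y) \<le> D * w q (dist x y)"
    using assms(2) by (rule ctlE) (rule that; blast)
  show ?thesis
  proof (rule ctlI)
    show "norm (f q x + g q x) \<le> C + D" if "x \<in> S" for q x
      using C(1)[OF that, of q] D(1)[OF that, of q] norm_triangle_ineq[of "f q x" "g q x"] by linarith
    show "norm (f q x + g q x - (f q y + g q y)) \<le> (C + D) * w q (dist x y)"
      if "x \<in> S" "y \<in> S" for q x y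
      using C(2)[OF that, of q] D(2)[OF that, of q]
        norm_triangle_ineq[of "f q x - f q y" "g q x - g q y"]
      by (simp add: algebra_simps)
  qed
qed

lemma ctl_bounded_linear:
  assumes "bounded_linear h" "ctl S f"
  shows "ctl S (\<lambda>q x. h (f q x))"
proof -
  interpret h: bounded_linear h by fact
  obtain C where C: "\<And>q x. x \<in> S \<Longrightarrow> norm (f q x) \<le> C"
    "\<And>q x y. x \<in> S \<Longrightarrow> y \<in> S \<Longrightarrow> norm (f q x - f q y) \<le> C * w q (dist x y)"
    using assms(2) by (rule ctlE) (rule that; blast)
  obtain K where K: "0 \<le> K" "\<And>x. norm (h x) \<le> norm x * K" using h.nonneg_bounded by blast
  show ?thesis
  proof (rule ctlI)
    show "norm (h (f q x)) \<le> C * K" if "x \<in> S" for q x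
      using K(2) C(1)[OF that] by (rule order_trans[OF _ mult_right_mono[OF _ K(1)]])
    show "norm (h (f q x) - h (f q y)) \<le> (C * K) * w q (dist x y)" if "x \<in> S" "y \<in> S" for q x y
    proof -
      have "norm (h (f q x) - h (f q y)) \<le> norm (f q x - f q y) * K"
        using K(2)[of "f q x - f q y"] by (simp add: h.diff)
      also have "\<dots> \<le> C * w q (dist x y) * K" by (rule mult_right_mono[OF C(2)[OF that] K(1)])
      finally show ?thesis by (simp add: ac_simps)
    qed
  qed
qed

lemma ctl_diff: "ctl S f \<Longrightarrow> ctl S g \<Longrightarrow> ctl S (\<lambda>q x. f q x - g q x)"
  using ctl_add[OF _ ctl_bounded_linear[OF bounded_linear_minus[OF bounded_linear_ident]], of S f g] by simp

lemma ctl_bilinear: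
  assumes "bounded_bilinear h" "ctl S f" "ctl S g"
  shows "ctl S (\<lambda>q x. h (f q x) (g q x))"
proof -
  interpret h: bounded_bilinear h by fact
  obtain C where C: "0 \<le> C" "\<And>q x. x \<in> S \<Longrightarrow> norm (f q x) \<le> C"
    "\<And>q x y. x \<in> S \<Longrightarrow> y \<in> S \<Longrightarrow> norm (f q x - f q y) \<le> C * w q (dist x y)"
    using assms(2) by (rule ctlE) (rule that; blast)
  obtain D where D: "0 \<le> D" "\<And>q x. x \<in> S \<Longrightarrow> norm (g q x) \<le> D"
    "\<And>q x y. x \<in> S \<Longrightarrow> y \<in> S \<Longrightarrow> norm (g q x - g q y) \<le> D * w q (dist x y)"
    using assms(3) by (rule ctlE) (rule that; blast)
  obtain K where K: "0 \<le> K" "\<And>x y. norm (h x y) \<le> norm x * norm y * K"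
    using h.nonneg_bounded by blast
  have hK: "norm (h x y) \<le> a * b * K" if "norm x \<le> a" "norm y \<le> b" for x y a b
    using that K(1) order_trans[OF norm_ge_zero that(1)]
    by (intro order_trans[OF K(2)] mult_right_mono mult_mono) auto
  show ?thesis
  proof (rule ctlI)
    show "norm (h (f q x) (g q x)) \<le> C * D * K" if "x \<in> S" for q x
      using that by (intro hK C D)
    show "norm (h (f q x) (g q x) - h (f q y) (g q y)) \<le> (2 * C * D * K) * w q (dist x y)"
      if "x \<in> S" "y \<in> S" for q x y
    proof -
      have "h (f q x) (g q x) - h (f q y) (g q y) = h (f q x - f q y) (g q x) + h (f q y) (g q x - g q y)"
        by (simp add: h.diff_left h.diff_right)
      also have "norm \<dots> \<le> (C * w q (dist x y)) * D * K + C * (D * w q (dist x y)) * K"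
        using that by (intro order_trans[OF norm_triangle_ineq] add_mono hK C D)
      finally show ?thesis by (simp add: algebra_simps)
    qed
  qed
qed

lemmas ctl_mult = ctl_bilinear[OF bounded_bilinear_mult]
lemmas ctl_scaleR = ctl_bilinear[OF bounded_bilinear_scaleR]

lemma ctl_power: "ctl S f \<Longrightarrow> ctl S (\<lambda>q x. (f q x) ^ n)"
  for f :: "nat \<Rightarrow> 'a::metric_space \<Rightarrow> 'b::real_normed_algebra_1"
  by (induction n) (simp_all add: ctl_const ctl_mult)

text \<open>The restriction to \<open>T\<close> is meant for \<open>sqrt\<close> and
  \<open>inverse\<close>, which are Lipschitz only away from zero.\<close>

lemma ctl_compose_lipschitz:
  assumes "ctl S f" "L-lipschitz_on T g" "\<And>q x. x \<in> S \<Longrightarrow> f q x \<in> T"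
  shows "ctl S (\<lambda>q x. g (f q x))"
proof (cases "S = {}")
  case True
  then show ?thesis by (simp add: ctl_def)
next
  case False
  then obtain t where t: "t \<in> T" using assms(3) by blast
  have L: "0 \<le> L" using assms(2) by (rule lipschitz_on_nonneg)
  obtain C where C: "\<And>q x. x \<in> S \<Longrightarrow> norm (f q x) \<le> C"
    "\<And>q x y. x \<in> S \<Longrightarrow> y \<in> S \<Longrightarrow> norm (f q x - f q y) \<le> C * w q (dist x y)"
    using assms(1) by (rule ctlE) (rule that; blast)
  have g: "norm (g u - g v) \<le> L * norm (u - v)" if "u \<in> T" "v \<in> T" for u v
    using lipschitz_onD[OF assms(2) that] by (simp add: dist_norm)
  show ?thesis
  proof (rule ctlI)
    show "norm (g (f q x)) \<le> norm (g t) + L * (C + norm t)" if "x \<in> S" for q x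
    proof -
      have "norm (f q x - t) \<le> C + norm t"
        using C(1)[OF that, of q] norm_triangle_ineq4[of "f q x" t] by linarith
      then have "L * norm (f q x - t) \<le> L * (C + norm t)" using L by (rule mult_left_mono)
      then show ?thesis
        using g[OF assms(3)[OF that] t, of q] norm_triangle_sub[of "g (f q x)" "g t"] by linarith
    qed
    show "norm (g (f q x) - g (f q y)) \<le> (L * C) * w q (dist x y)" if "x \<in> S" "y \<in> S" for q x y
      using order_trans[OF g[OF assms(3)[OF that(1)] assms(3)[OF that(2)]] mult_left_mono[OF C(2)[OF that] L]]
      by (simp add: ac_simps)
  qed
qed

lemma ctl_lipschitz:
  assumes "L-lipschitz_on S f" "bounded S"
  shows "ctl S (\<lambda>_. f)"
proof (cases "S = {}")
  case True
  then show ?thesis by (simp add: ctl_def)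
next
  case False
  then obtain x0 where x0: "x0 \<in> S" by blast
  obtain D where D: "\<And>x y. x \<in> S \<Longrightarrow> y \<in> S \<Longrightarrow> dist x y \<le> D"
    using assms(2) bounded_two_points by metis
  obtain c where c: "0 \<le> c" "\<And>q d. 0 \<le> d \<Longrightarrow> d \<le> D \<Longrightarrow> d \<le> c * w q d" using lipschitz_le by meson
  have L: "0 \<le> L" using assms(1) by (rule lipschitz_on_nonneg)
  have f: "norm (f x - f y) \<le> L * dist x y" if "x \<in> S" "y \<in> S" for x y
    using lipschitz_onD[OF assms(1) that] by (simp add: dist_norm)
  show ?thesis
  proof (rule ctlI)
    show "norm (f x) \<le> norm (f x0) + L * D" if "x \<in> S" for x
      using f[OF that x0] mult_left_mono[OF D[OF that x0] L] norm_triangle_sub[of "f x" "f x0"] by linarith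
    show "norm (f x - f y) \<le> (L * c) * w q (dist x y)" if "x \<in> S" "y \<in> S" for q x y
      using order_trans[OF f[OF that] mult_left_mono[OF c(2)[OF zero_le_dist D[OF that], of q] L]]
      by (simp add: ac_simps)
  qed
qed

lemma ctl_comp_nonexpansive:
  assumes "ctl T f" "1-lipschitz_on S h" "h ` S \<subseteq> T"
  shows "ctl S (\<lambda>q x. f q (h x))"
proof -
  obtain C where C: "0 \<le> C" "\<And>q x. x \<in> T \<Longrightarrow> norm (f q x) \<le> C"
    "\<And>q x y. x \<in> T \<Longrightarrow> y \<in> T \<Longrightarrow> norm (f q x - f q y) \<le> C * w q (dist x y)"
    using assms(1) by (rule ctlE) (rule that; blast)
  show ?thesis
  proof (rule ctlI)
    show "norm (f q (h x)) \<le> C" if "x \<in> S" for q x using that assms(3) C(2) by blast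
    show "norm (f q (h x) - f q (h y)) \<le> C * w q (dist x y)" if "x \<in> S" "y \<in> S" for q x y
    proof -
      have "w q (dist (h x) (h y)) \<le> w q (dist x y)"
        using lipschitz_onD[OF assms(2) that] by (intro mono) auto
      then show ?thesis
        using that assms(3) C(1) by (intro order_trans[OF C(3) mult_left_mono]) auto
    qed
  qed
qed

lemma ctl_Pair:
  assumes "ctl S f" "ctl S g"
  shows "ctl S (\<lambda>q x. (f q x, g q x))"
proof -
  have "bounded_linear (\<lambda>x. (x, 0))" "bounded_linear (\<lambda>x. (0, x))"
    by (intro bounded_linear_Pair bounded_linear_ident bounded_linear_zero)+
  from ctl_add[OF ctl_bounded_linear[OF this(1) assms(1)] ctl_bounded_linear[OF this(2) assms(2)]]
  show ?thesis by simp
qed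

lemma ctl_cong: "ctl S f \<Longrightarrow> (\<And>q x. x \<in> S \<Longrightarrow> f q x = g q x) \<Longrightarrow> ctl S g"
  unfolding ctl_def by simp

text \<open>If the selected indices at x and y differ, the member selected at x vanishes at y and
  conversely. Inserting these zeros writes the difference as two increments of single members,
  whence the factor 2.\<close>

lemma ctl_select:
  assumes "\<And>q. w q = w 0" "ctl S u"
    and N: "\<And>x. N x \<in> J" "\<And>x q. x \<in> S \<Longrightarrow> q \<in> J \<Longrightarrow> q \<noteq> N x \<Longrightarrow> u q x = 0"
  shows "ctl S (\<lambda>_ x. u (N x) x)"
proof -
  obtain C where C: "0 \<le> C" "\<And>q x. x \<in> S \<Longrightarrow> norm (u q x) \<le> C"
    "\<And>q x y. x \<in> S \<Longrightarrow> y \<in> S \<Longrightarrow> norm (u q x - u q y) \<le> C * w q (dist x y)"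
    using assms(2) by (rule ctlE) (rule that; blast)
  show ?thesis
  proof (rule ctlI)
    show "norm (u (N x) x) \<le> C" if "x \<in> S" for x using that C by blast
    show "norm (u (N x) x - u (N y) y) \<le> (2 * C) * w q (dist x y)" if "x \<in> S" "y \<in> S" for q x y
    proof (cases "N x = N y")
      case True
      have "0 \<le> C * w q (dist x y)" using C(1) nonneg[of "dist x y" q] by simp
      then show ?thesis using C(3)[OF that, of "N x"] assms(1)[of "N x"] assms(1)[of q] True by simp
    next
      case False
      then have "u (N x) x - u (N y) y = (u (N x) x - u (N x) y) + (u (N y) x - u (N y) y)"
        using N that by auto
      also have "norm \<dots> \<le> C * w q (dist x y) + C * w q (dist x y)"
        using C(3)[OF that] assms(1)[of q] assms(1)[of "N x"] assms(1)[of "N y"]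
        by (intro order_trans[OF norm_triangle_ineq] add_mono) metis+
      finally show ?thesis by simp
    qed
  qed
qed

end

interpretation lip: modulus "\<lambda>q d. 2 ^ q * d"
proof
  show "\<exists>c\<ge>0. \<forall>q d. 0 \<le> d \<and> d \<le> D \<longrightarrow> d \<le> c * (2 ^ q * d)" for D :: real
  proof (intro exI[of _ 1] conjI allI impI)
    show "d \<le> 1 * (2 ^ q * d)" if "0 \<le> d \<and> d \<le> D" for q :: nat and d :: real
      using that mult_right_mono[of 1 "2 ^ q" d] by simp
  qed simp
qed auto

interpretation hol: modulus "\<lambda>q d. sqrt d"
proof
  show "\<exists>c\<ge>0. \<forall>q d. 0 \<le> d \<and> d \<le> D \<longrightarrow> d \<le> c * sqrt d" for D :: real
  proof (intro exI[of _ "sqrt \<bar>D\<bar>"] conjI allI impI)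
    fix d :: real assume d: "0 \<le> d \<and> d \<le> D"
    then have "sqrt d * sqrt d \<le> sqrt \<bar>D\<bar> * sqrt d" by (intro mult_right_mono) auto
    then show "d \<le> sqrt \<bar>D\<bar> * sqrt d" using d by simp
  qed auto
qed auto

text \<open>Interpolation between the size \<open>2\<^sup>-\<^sup>q\<^sup>/\<^sup>2\<close> and the Lipschitz constant
  \<open>2\<^sup>q\<^sup>/\<^sup>2\<close>.\<close>

lemma hol_ctl_interpolate:
  assumes "lip.ctl S u"
  shows "hol.ctl S (\<lambda>q x. (1 / sqrt 2) ^ q *\<^sub>R u q x)"
proof -
  obtain C where C: "0 \<le> C" "\<And>q x. x \<in> S \<Longrightarrow> norm (u q x) \<le> C"
    "\<And>q x y. x \<in> S \<Longrightarrow> y \<in> S \<Longrightarrow> norm (u q x - u q y) \<le> C * (2 ^ q * dist x y)"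
    using assms by (rule lip.ctlE) (rule that; blast)
  define b where "b = (\<lambda>q::nat. sqrt 2 ^ q)"
  have b: "1 \<le> b q" "b q * b q = 2 ^ q" for q
    by (simp_all add: b_def flip: power_mult_distrib)
  have eq: "(1 / sqrt 2) ^ q = 1 / b q" for q by (simp add: b_def power_divide)
  show ?thesis unfolding eq
  proof (rule hol.ctlI)
    show "norm ((1 / b q) *\<^sub>R u q x) \<le> C" if "x \<in> S" for q x
    proof -
      have "norm (u q x) / b q \<le> norm (u q x) / 1" using b(1) by (intro divide_left_mono) (auto intro: less_le_trans[OF zero_less_one])
      then show ?thesis using C(2)[OF that, of q] b(1)[of q] by simp
    qed
    show "norm ((1 / b q) *\<^sub>R u q x - (1 / b q) *\<^sub>R u q y) \<le> (2 * C) * sqrt (dist x y)"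
      if xy: "x \<in> S" "y \<in> S" for q x y
    proof -
      have bq: "0 < b q" using b(1)[of q] by linarith
      define n where "n = norm (u q x - u q y)"
      define r where "r = sqrt (dist x y)"
      have r: "0 \<le> r" "r * r = dist x y" by (simp_all add: r_def)
      have 1: "n \<le> 2 * C"
        using C(2)[OF xy(1), of q] C(2)[OF xy(2), of q] norm_triangle_ineq4[of "u q x" "u q y"]
        unfolding n_def by linarith
      have 2: "n \<le> C * (b q * b q * (r * r))"
        using C(3)[OF xy, of q] by (simp add: n_def b r)
      \<comment> \<open>\<open>b q\<close> is 2^(q/2) and \<open>r\<close> the square root of the
        distance. Beyond distance 2^(-q) the size bound is the better one, below it the Lipschitz
        bound.\<close>
      have "n \<le> 2 * C * (b q * r)"
      proof (cases "1 \<le> b q * r")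
        case True
        then show ?thesis using 1 C(1) mult_left_mono[of 1 "b q * r" "2 * C"] by simp
      next
        case False
        then have "(b q * r) * (b q * r) \<le> 1 * (b q * r)" using bq r(1) by (intro mult_right_mono) auto
        then have "C * ((b q * r) * (b q * r)) \<le> C * (2 * (b q * r))"
          using C(1) bq r(1) by (intro mult_left_mono) (auto intro: order_trans)
        then show ?thesis using 2 by (simp add: ac_simps)
      qed
      then have "n / b q \<le> 2 * C * r" using bq by (simp add: field_simps)
      moreover have "norm ((1 / b q) *\<^sub>R u q x - (1 / b q) *\<^sub>R u q y) = n / b q"
        using bq by (simp add: n_def flip: scaleR_diff_right)
      ultimately show ?thesis by (simp add: r_def)
    qed
  qed
qed

lemma lip_ctl_rescale:
  fixes g :: "real \<Rightarrow> 'b::real_normed_vector"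
  assumes g: "lip.ctl UNIV (\<lambda>_. g)" and s: "K-lipschitz_on S s"
  shows "lip.ctl S (\<lambda>q x. g (2 ^ q * s x))"
proof -
  obtain L where L: "0 \<le> L" "\<And>t. norm (g t) \<le> L" "\<And>t u. norm (g t - g u) \<le> L * (2 ^ 0 * dist t u)"
    using g by (rule lip.ctlE) (rule that; blast)
  show ?thesis
  proof (rule lip.ctlI)
    show "norm (g (2 ^ q * s x)) \<le> L" for q x by (rule L)
    show "norm (g (2 ^ q * s x) - g (2 ^ q * s y)) \<le> (L * K) * (2 ^ q * dist x y)"
      if "x \<in> S" "y \<in> S" for q x y
    proof -
      have "dist (g (2 ^ q * s x)) (g (2 ^ q * s y)) \<le> L * dist (2 ^ q * s x) (2 ^ q * s y)"
        using L(3) by (simp add: dist_norm)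
      also have "dist (2 ^ q * s x) (2 ^ q * s y) = 2 ^ q * dist (s x) (s y)"
        by (simp add: dist_real_def abs_mult flip: right_diff_distrib)
      also have "L * (2 ^ q * dist (s x) (s y)) \<le> L * (2 ^ q * (K * dist x y))"
        using L(1) lipschitz_onD[OF s that] by (intro mult_left_mono) auto
      finally show ?thesis by (simp add: dist_norm ac_simps)
    qed
  qed
qed

text \<open>In the unit disc the n-th power is n-Lipschitz. A bound on the exponent instead of
  equality covers both 2^q and the exponent 2^q - 1 that differentiation produces.\<close>

lemma lip_ctl_power:
  fixes e :: "'a::metric_space \<Rightarrow> complex"
  assumes e: "L-lipschitz_on S e" "\<And>x. x \<in> S \<Longrightarrow> norm (e x) \<le> 1" and n: "\<And>q. n q \<le> 2 ^ q"
  shows "lip.ctl S (\<lambda>q x. e x ^ n q)"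
proof (rule lip.ctlI)
  show "norm (e x ^ n q) \<le> 1" if "x \<in> S" for q x
    using e(2)[OF that] by (simp add: norm_power power_le_one)
  show "norm (e x ^ n q - e y ^ n q) \<le> L * (2 ^ q * dist x y)" if "x \<in> S" "y \<in> S" for q x y
  proof -
    have "norm (e x ^ n q - e y ^ n q) \<le> n q * norm (e x - e y)"
      using e(2) that by (intro norm_power_diff)
    also have "\<dots> \<le> 2 ^ q * (L * dist x y)"
      using lipschitz_onD[OF e(1) that] n[of q] by (intro mult_mono) (auto simp: dist_norm numeral_power_le_of_nat_cancel_iff simp flip: of_nat_power)
    finally show ?thesis by (simp add: ac_simps)
  qed
qed

section \<open>Dyadic profiles\<close>

lemma lip_ctl_UNIV:
  fixes f :: "'a::metric_space \<Rightarrow> 'b::real_normed_vector"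
  assumes "\<And>x. norm (f x) \<le> B" "\<And>x y. norm (f x - f y) \<le> L * dist x y"
  shows "lip.ctl UNIV (\<lambda>_. f)"
proof (rule lip.ctlI)
  show "norm (f x - f y) \<le> max L 0 * (2 ^ q * dist x y)" for q x y
  proof -
    have "L * dist x y \<le> max L 0 * (1 * dist x y)" by (simp add: mult_right_mono)
    also have "\<dots> \<le> max L 0 * (2 ^ q * dist x y)"
      by (intro mult_left_mono mult_right_mono) auto
    finally show ?thesis using assms(2)[of x y] by linarith
  qed
qed (rule assms)

lemma lip_ctl_real_derivative:
  fixes f :: "real \<Rightarrow> real"
  assumes "\<And>x. \<bar>f x\<bar> \<le> B" "\<And>x. (f has_real_derivative f' x) (at x)" "\<And>x. \<bar>f' x\<bar> \<le> L"
  shows "lip.ctl UNIV (\<lambda>_. f)"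
proof (rule lip_ctl_UNIV)
  show "norm (f x - f y) \<le> L * dist x y" for x y
    using field_differentiable_bound[of UNIV f f' L x y] assms(2,3) by (auto simp: dist_norm)
qed (use assms(1) in simp)

lemma hol_ctl_of_lip:
  assumes "lip.ctl UNIV (\<lambda>_. f)" "K-lipschitz_on S s" "bounded S"
  shows "hol.ctl S (\<lambda>_ x. f (s x))"
proof -
  obtain C where C: "0 \<le> C" "\<And>x y. norm (f x - f y) \<le> C * (2 ^ 0 * dist x y)"
    using assms(1) by (rule lip.ctlE) (rule that; blast)
  have "C-lipschitz_on (s ` S) f" using C by (intro lipschitz_onI) (auto simp: dist_norm)
  from hol.ctl_lipschitz[OF lipschitz_on_compose2[OF assms(2) this] assms(3)] show ?thesis by simp
qed

text \<open>Its square is continuously differentiable with Lipschitz derivative; combinations of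
  shifted squares give \<open>angle\<close>.\<close>

definition ramp :: "real \<Rightarrow> real" where
  "ramp t = max 0 t"

lemma ramp_lipschitz: "\<bar>ramp x - ramp y\<bar> \<le> \<bar>x - y\<bar>"
  by (auto simp: ramp_def)

lemma ramp_sq_derivative: "((\<lambda>t. (ramp t)\<^sup>2) has_real_derivative 2 * ramp t) (at t)"
proof -
  consider "t < 0" | "t > 0" | "t = 0" by linarith
  then show ?thesis
  proof cases
    case 1
    have "((\<lambda>t. 0) has_real_derivative 0) (at t)" by simp
    then have "((\<lambda>t. (ramp t)\<^sup>2) has_real_derivative 0) (at t)"
      by (rule has_field_derivative_transform_within_open[where S = "{..<0}"]) (use 1 in \<open>auto simp: ramp_def\<close>)
    then show ?thesis using 1 by (simp add: ramp_def)
  next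
    case 2
    have "((\<lambda>t. t\<^sup>2) has_real_derivative 2 * t) (at t)" by (auto intro!: derivative_eq_intros)
    then have "((\<lambda>t. (ramp t)\<^sup>2) has_real_derivative 2 * t) (at t)"
      by (rule has_field_derivative_transform_within_open[where S = "{0<..}"]) (use 2 in \<open>auto simp: ramp_def\<close>)
    then show ?thesis using 2 by (simp add: ramp_def)
  next
    case 3
    have "(ramp \<longlongrightarrow> 0) (at 0)"
      unfolding ramp_def using tendsto_max[OF tendsto_const[of 0] tendsto_ident_at[of "0::real" UNIV]] by simp
    moreover have "((ramp (0 + h))\<^sup>2 - (ramp 0)\<^sup>2) / h = ramp h" for h
      by (simp add: ramp_def power2_eq_square max_def)
    ultimately show ?thesis unfolding 3 DERIV_def by (simp add: ramp_def[of 0])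
  qed
qed

text \<open>A piecewise quadratic transition from \<open>0\<close> on \<open>x \<le> 1\<close> to \<open>\<pi>/2\<close> on \<open>x \<ge> 2\<close> with
  Lipschitz derivative.\<close>

definition angle :: "real \<Rightarrow> real" where
  "angle x = pi / 2 * (2 * (ramp (x - 1))\<^sup>2 - 4 * (ramp (x - 3/2))\<^sup>2 + 2 * (ramp (x - 2))\<^sup>2)"

definition angle' :: "real \<Rightarrow> real" where
  "angle' x = pi / 2 * (4 * ramp (x - 1) - 8 * ramp (x - 3/2) + 4 * ramp (x - 2))"

lemma angle_le_1: "x \<le> 1 \<Longrightarrow> angle x = 0" and angle'_le_1: "x \<le> 1 \<Longrightarrow> angle' x = 0"
  by (simp_all add: angle_def angle'_def ramp_def)

lemma angle_ge_2: "x \<ge> 2 \<Longrightarrow> angle x = pi / 2" and angle'_ge_2: "x \<ge> 2 \<Longrightarrow> angle' x = 0"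
  by (simp_all add: angle_def angle'_def ramp_def power2_eq_square algebra_simps)

lemma angle_derivative: "(angle has_real_derivative angle' x) (at x)"
proof -
  have "((\<lambda>x. (ramp (x - c))\<^sup>2) has_real_derivative 2 * ramp (x - c)) (at x)" for c
  proof -
    have "((\<lambda>x. x - c) has_real_derivative 1) (at x)" by (auto intro!: derivative_eq_intros)
    from DERIV_chain2[where f = "\<lambda>t. (ramp t)\<^sup>2", OF ramp_sq_derivative this] show ?thesis by simp
  qed
  then have "(angle has_real_derivative
      pi / 2 * (2 * (2 * ramp (x - 1)) - 4 * (2 * ramp (x - 3/2)) + 2 * (2 * ramp (x - 2)))) (at x)"
    unfolding angle_def[abs_def] by (intro DERIV_cmult DERIV_add DERIV_diff)
  then show ?thesis by (simp add: angle'_def)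
qed

lemma angle'_lipschitz: "\<bar>angle' x - angle' y\<bar> \<le> 8 * pi * dist x y"
proof -
  have "angle' x - angle' y = pi / 2 * (4 * (ramp (x - 1) - ramp (y - 1))
      - 8 * (ramp (x - 3/2) - ramp (y - 3/2)) + 4 * (ramp (x - 2) - ramp (y - 2)))"
    by (simp add: angle'_def algebra_simps)
  moreover have "\<bar>4 * (ramp (x - 1) - ramp (y - 1)) - 8 * (ramp (x - 3/2) - ramp (y - 3/2))
      + 4 * (ramp (x - 2) - ramp (y - 2))\<bar> \<le> 16 * \<bar>x - y\<bar>"
  proof -
    have *: "\<bar>4 * u - 8 * v + 4 * w\<bar> \<le> 16 * d" if "\<bar>u\<bar> \<le> d" "\<bar>v\<bar> \<le> d" "\<bar>w\<bar> \<le> d" for u v w d :: real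
      using that by (simp add: abs_le_iff)
    show ?thesis
      using ramp_lipschitz[of "x - 1" "y - 1"] ramp_lipschitz[of "x - 3/2" "y - 3/2"]
        ramp_lipschitz[of "x - 2" "y - 2"] by (intro *) simp_all
  qed
  ultimately have "\<bar>angle' x - angle' y\<bar> \<le> pi / 2 * (16 * \<bar>x - y\<bar>)"
    by (simp only: abs_mult) (intro mult_mono, simp_all)
  then show ?thesis by (simp add: dist_real_def)
qed

lemma angle'_bounded: "\<bar>angle' x\<bar> \<le> 8 * pi"
proof -
  consider "x \<le> 1" | "x \<ge> 2" | "1 < x" "x < 2" by linarith
  then show ?thesis
  proof cases
    case 3
    have "\<bar>angle' x - angle' 1\<bar> \<le> 8 * pi * dist x 1" by (rule angle'_lipschitz)
    also have "\<dots> \<le> 8 * pi * 1" using 3 by (intro mult_left_mono) (auto simp: dist_real_def)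
    finally show ?thesis by (simp add: angle'_le_1)
  qed (simp_all add: angle'_le_1 angle'_ge_2)
qed

text \<open>Sine and cosine of one angle are used so that the squares of \<open>rise (x / 2)\<close>
  and \<open>fall x\<close> add up to 1. The halved argument of \<open>fall\<close> confines
  \<open>bump\<close> to the interval from 1 to 4, so that a dyadic dilate overlaps only its
  immediate neighbours.\<close>

definition rise :: "real \<Rightarrow> real" where "rise x = sin (angle x)"
definition rise' :: "real \<Rightarrow> real" where "rise' x = cos (angle x) * angle' x"
definition fall :: "real \<Rightarrow> real" where "fall x = cos (angle (x / 2))"
definition fall' :: "real \<Rightarrow> real" where "fall' x = - sin (angle (x / 2)) * angle' (x / 2) / 2"
definition bump :: "real \<Rightarrow> real" where "bump x = rise x * fall x"
definition bump' :: "real \<Rightarrow> real" where "bump' x = rise' x * fall x + rise x * fall' x"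

lemma rise_derivative: "(rise has_real_derivative rise' x) (at x)"
  unfolding rise_def[abs_def] rise'_def by (auto intro!: derivative_eq_intros angle_derivative)

lemma fall_derivative: "(fall has_real_derivative fall' x) (at x)"
proof -
  have "((\<lambda>x. angle (x / 2)) has_real_derivative angle' (x / 2) * (1 / 2)) (at x)"
    by (rule DERIV_chain2[OF angle_derivative]) (auto intro!: derivative_eq_intros)
  then show ?thesis
    unfolding fall_def[abs_def] fall'_def by (auto intro!: derivative_eq_intros)
qed

lemma bump_derivative: "(bump has_real_derivative bump' x) (at x)"
  unfolding bump_def[abs_def] bump'_def
  by (auto intro!: derivative_eq_intros rise_derivative fall_derivative)

lemma lip_ctl_half: "lip.ctl UNIV (\<lambda>_. f) \<Longrightarrow> lip.ctl UNIV (\<lambda>_ x. f (x / 2))" for f :: "real \<Rightarrow> real"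
  by (rule lip.ctl_comp_nonexpansive[where T = UNIV]) (auto intro!: lipschitz_onI simp: dist_real_def)

lemma lip_ctl_angle': "lip.ctl UNIV (\<lambda>_. angle')"
  by (rule lip_ctl_UNIV) (use angle'_bounded angle'_lipschitz in auto)

lemma lip_ctl_sin_angle: "lip.ctl UNIV (\<lambda>_ x. sin (angle x))"
  and lip_ctl_cos_angle: "lip.ctl UNIV (\<lambda>_ x. cos (angle x))"
proof -
  have *: "\<bar>c * angle' x\<bar> \<le> 8 * pi" if "\<bar>c\<bar> \<le> 1" for c x
    using mult_mono[of "\<bar>c\<bar>" 1 "\<bar>angle' x\<bar>" "8 * pi"] that angle'_bounded[of x] by (simp add: abs_mult)
  show "lip.ctl UNIV (\<lambda>_ x. sin (angle x))"
    by (rule lip_ctl_real_derivative[where f' = "\<lambda>x. cos (angle x) * angle' x" and B = 1 and L = "8 * pi"])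
      (auto intro!: derivative_eq_intros angle_derivative *)
  show "lip.ctl UNIV (\<lambda>_ x. cos (angle x))"
    by (rule lip_ctl_real_derivative[where f' = "\<lambda>x. (- sin (angle x)) * angle' x" and B = 1 and L = "8 * pi"])
      (auto intro!: derivative_eq_intros angle_derivative * simp del: mult_minus_left)
qed

lemma lip_ctl_rise: "lip.ctl UNIV (\<lambda>_. rise)" and lip_ctl_fall: "lip.ctl UNIV (\<lambda>_. fall)"
  and lip_ctl_rise': "lip.ctl UNIV (\<lambda>_. rise')" and lip_ctl_fall': "lip.ctl UNIV (\<lambda>_. fall')"
proof -
  show "lip.ctl UNIV (\<lambda>_. rise)" unfolding rise_def[abs_def] by (rule lip_ctl_sin_angle)
  show "lip.ctl UNIV (\<lambda>_. fall)" unfolding fall_def[abs_def] by (rule lip_ctl_half[OF lip_ctl_cos_angle])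
  show "lip.ctl UNIV (\<lambda>_. rise')" unfolding rise'_def[abs_def]
    by (rule lip.ctl_mult[OF lip_ctl_cos_angle lip_ctl_angle'])
  have "lip.ctl UNIV (\<lambda>_ x. (- 1 / 2) * (sin (angle (x / 2)) * angle' (x / 2)))"
    by (intro lip.ctl_mult lip.ctl_const lip_ctl_half lip_ctl_sin_angle lip_ctl_angle')
  then show "lip.ctl UNIV (\<lambda>_. fall')" unfolding fall'_def[abs_def] by simp
qed

lemma rise_le_1: "x \<le> 1 \<Longrightarrow> rise x = 0" "x \<le> 1 \<Longrightarrow> rise' x = 0"
  and rise_ge_2: "x \<ge> 2 \<Longrightarrow> rise x = 1"
  and fall_le_2: "x \<le> 2 \<Longrightarrow> fall x = 1" "x \<le> 2 \<Longrightarrow> fall' x = 0"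
  and fall_ge_4: "x \<ge> 4 \<Longrightarrow> fall x = 0" "x \<ge> 4 \<Longrightarrow> fall' x = 0"
  by (simp_all add: rise_def rise'_def fall_def fall'_def angle_le_1 angle'_le_1 angle_ge_2 angle'_ge_2)

lemma bump_eq_0: "x \<le> 1 \<or> 4 \<le> x \<Longrightarrow> bump x = 0" "x \<le> 1 \<or> 4 \<le> x \<Longrightarrow> bump' x = 0"
  by (auto simp: bump_def bump'_def rise_le_1 fall_ge_4)

lemma abs_bump_le_1: "\<bar>bump x\<bar> \<le> 1"
  using mult_mono[of "\<bar>rise x\<bar>" 1 "\<bar>fall x\<bar>" 1] by (simp add: bump_def abs_mult rise_def fall_def)

text \<open>The squares of the dyadic rescalings of \<open>bump\<close> telescope, so that they form a partition of
  unity near \<open>0\<close>.\<close>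

lemma bump_square: "(bump x)\<^sup>2 = (rise x)\<^sup>2 - (rise (x / 2))\<^sup>2"
proof (cases "x \<le> 2")
  case True
  then show ?thesis by (simp add: bump_def fall_le_2 rise_le_1)
next
  case False
  then have "bump x = fall x" by (simp add: bump_def rise_ge_2)
  then show ?thesis
    using False by (simp add: fall_def rise_ge_2 cos_squared_eq) (simp add: rise_def)
qed

lemma sum_bump_square: "(\<Sum>q<n. (bump (2 ^ q * s))\<^sup>2) = (rise (2 ^ n * s / 2))\<^sup>2 - (rise (s / 2))\<^sup>2"
  by (induction n) (simp_all add: bump_square)

text \<open>Chosen so that 2^(-q/2) \<open>profile (2 ^ q * s)\<close> is the square root of s, cut
  off to the q-th band.\<close>

definition profile :: "real \<Rightarrow> real" where "profile x = sqrt x * bump x"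
text \<open>Clamping the argument of the root between 1 and 4 avoids its singularity at 0. Values
  are unaffected, since \<open>bump\<close> and \<open>bump'\<close> vanish outside that
  interval.\<close>

definition profile' :: "real \<Rightarrow> real" where
  "profile' x = bump x / (2 * sqrt (max 1 (min 4 x))) + sqrt (max 1 (min 4 x)) * bump' x"

lemma profile_eq_0: "x \<le> 1 \<or> 4 \<le> x \<Longrightarrow> profile x = 0" "x \<le> 1 \<or> 4 \<le> x \<Longrightarrow> profile' x = 0"
  by (auto simp: profile_def profile'_def bump_eq_0)

lemma profile_eq: "profile x = sqrt (max 1 (min 4 x)) * bump x"
  by (cases "x \<le> 1 \<or> 4 \<le> x") (auto simp: profile_def bump_eq_0)

lemma profile_derivative: "(profile has_real_derivative profile' x) (at x)"
proof (cases "x < 1")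
  case True
  have "((\<lambda>t. 0) has_real_derivative 0) (at x)" by simp
  then have "(profile has_real_derivative 0) (at x)"
    by (rule has_field_derivative_transform_within_open[where S = "{..<1}"])
      (use True in \<open>auto simp: profile_eq_0\<close>)
  then show ?thesis using True by (simp add: profile_eq_0)
next
  case False
  then have "(profile has_real_derivative (inverse (sqrt x) / 2) * bump x + bump' x * sqrt x) (at x)"
    unfolding profile_def[abs_def]
    by (intro DERIV_mult DERIV_real_sqrt bump_derivative) auto
  moreover have "profile' x = (inverse (sqrt x) / 2) * bump x + bump' x * sqrt x"
    using False by (cases "4 \<le> x") (auto simp: profile'_def bump_eq_0 field_simps)
  ultimately show ?thesis by simp
qed

lemma lip_ctl_profile: "lip.ctl UNIV (\<lambda>_. profile)" and lip_ctl_profile': "lip.ctl UNIV (\<lambda>_. profile')"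
proof -
  define \<omega> where "\<omega> = (\<lambda>x::real. sqrt (max 1 (min 4 x)))"
  have \<omega>: "1 \<le> \<omega> x" "\<omega> x \<le> 2" for x
    unfolding \<omega>_def using real_sqrt_le_mono[of "max 1 (min 4 x)" 4] by auto
  have \<omega>_diff: "\<bar>\<omega> x - \<omega> y\<bar> \<le> 1 * dist x y" for x y
  proof -
    have "(\<omega> x - \<omega> y) * (\<omega> x + \<omega> y) = max 1 (min 4 x) - max 1 (min 4 y)"
      by (simp add: \<omega>_def algebra_simps)
    then have "\<bar>\<omega> x - \<omega> y\<bar> * \<bar>\<omega> x + \<omega> y\<bar> = \<bar>max 1 (min 4 x) - max 1 (min 4 y)\<bar>"
      by (simp only: abs_mult[symmetric])
    also have "\<dots> \<le> \<bar>x - y\<bar>" by (auto simp: max_def min_def)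
    finally have "\<bar>\<omega> x - \<omega> y\<bar> * \<bar>\<omega> x + \<omega> y\<bar> \<le> \<bar>x - y\<bar>" .
    moreover have "\<bar>\<omega> x - \<omega> y\<bar> * 1 \<le> \<bar>\<omega> x - \<omega> y\<bar> * \<bar>\<omega> x + \<omega> y\<bar>"
      using \<omega>(1)[of x] \<omega>(1)[of y] by (intro mult_left_mono) auto
    ultimately show ?thesis by (simp add: dist_real_def)
  qed
  have 1: "lip.ctl UNIV (\<lambda>_. \<omega>)"
  proof (rule lip_ctl_UNIV)
    show "norm (\<omega> x) \<le> 2" for x using \<omega>[of x] by simp
    show "norm (\<omega> x - \<omega> y) \<le> 1 * dist x y" for x y using \<omega>_diff[of x y] by simp
  qed
  have 2: "lip.ctl UNIV (\<lambda>_ x. 1 / \<omega> x)"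
  proof (rule lip_ctl_UNIV)
    show "norm (1 / \<omega> x) \<le> 1" for x using \<omega>[of x] by simp
    show "norm (1 / \<omega> x - 1 / \<omega> y) \<le> 1 * dist x y" for x y
    proof -
      have "1 / \<omega> x - 1 / \<omega> y = (\<omega> y - \<omega> x) / (\<omega> x * \<omega> y)"
        using \<omega>(1)[of x] \<omega>(1)[of y] by (simp add: field_simps)
      then have "\<bar>1 / \<omega> x - 1 / \<omega> y\<bar> = \<bar>\<omega> y - \<omega> x\<bar> / (\<omega> x * \<omega> y)"
        using \<omega>(1)[of x] \<omega>(1)[of y] by (simp add: abs_mult)
      also have "\<dots> \<le> \<bar>\<omega> y - \<omega> x\<bar> / 1"
        using \<omega>(1)[of x] \<omega>(1)[of y] mult_mono[of 1 "\<omega> x" 1 "\<omega> y"]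
        by (intro divide_left_mono) (auto intro!: mult_pos_pos)
      finally show ?thesis using \<omega>_diff[of y x] by (simp add: dist_commute)
    qed
  qed
  have b: "lip.ctl UNIV (\<lambda>_. bump)" "lip.ctl UNIV (\<lambda>_. bump')"
    unfolding bump_def[abs_def] bump'_def[abs_def]
    by (intro lip.ctl_mult lip.ctl_add lip_ctl_rise lip_ctl_rise' lip_ctl_fall lip_ctl_fall')+
  show "lip.ctl UNIV (\<lambda>_. profile)"
    unfolding profile_eq[abs_def] \<omega>_def[symmetric] using lip.ctl_mult[OF 1 b(1)] by (simp add: \<omega>_def)
  have "lip.ctl UNIV (\<lambda>_ x. (1 / 2) * (bump x * (1 / \<omega> x)) + \<omega> x * bump' x)"
    by (intro lip.ctl_mult lip.ctl_add lip.ctl_const 1 2 b)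
  then show "lip.ctl UNIV (\<lambda>_. profile')"
    unfolding profile'_def[abs_def] by (simp add: \<omega>_def)
qed

text \<open>At most one index of each parity sees \<open>s\<close> in the support of the bump.\<close>

definition active :: "nat \<Rightarrow> real \<Rightarrow> nat" where
  "active j s = 2 * (SOME m. 1 < 2 ^ (2 * m + j) * s \<and> 2 ^ (2 * m + j) * s < 4) + j"

text \<open>True also when no index of the parity sees s: \<open>SOME\<close> is then arbitrary, but
  the parity is built into the definition.\<close>

lemma active_parity: "active j s \<in> {q. \<exists>m. q = 2 * m + j}"
  by (auto simp: active_def)

text \<open>Passing to a larger index of the same parity multiplies \<open>2 ^ q * s\<close> by at
  least 4, which leaves the open window from 1 to 4. Hence the index chosen by \<open>SOME\<close>
  is the only candidate.\<close>

lemma inactive: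
  assumes "q \<in> {q. \<exists>m. q = 2 * m + j}" "q \<noteq> active j s"
  shows "2 ^ q * s \<le> 1 \<or> 4 \<le> 2 ^ q * s"
proof (rule ccontr)
  assume n: "\<not> ?thesis"
  define P where "P = (\<lambda>m. 1 < 2 ^ (2 * m + j) * s \<and> 2 ^ (2 * m + j) * s < 4)"
  obtain m where m: "q = 2 * m + j" using assms(1) by blast
  have Pm: "P m" using n m by (auto simp: P_def)
  define m' where "m' = (SOME m. P m)"
  have Pm': "P m'" unfolding m'_def using Pm by (rule someI)
  have not_lt: "\<not> i < k" if "P i" "P k" for i k
  proof
    assume "i < k"
    then obtain d where d: "k = i + Suc d" using less_iff_Suc_add by auto
    have "4 * 1 \<le> (2 ^ (2 * Suc d) :: real) * (2 ^ (2 * i + j) * s)"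
    proof (rule mult_mono)
      show "(4::real) \<le> 2 ^ (2 * Suc d)" using one_le_power[of "4::real" d] by (simp add: power_mult)
    qed (use that in \<open>auto simp: P_def\<close>)
    also have "\<dots> = 2 ^ (2 * k + j) * s" by (simp add: d power_add algebra_simps)
    finally show False using that(2) by (simp add: P_def)
  qed
  have "m = m'" using not_lt[OF Pm Pm'] not_lt[OF Pm' Pm] by simp
  then show False using assms(2) m by (simp add: active_def m'_def P_def)
qed

lemma active_bump_square:
  assumes "0 < s"
  shows "(bump (2 ^ active 0 s * s))\<^sup>2 + (bump (2 ^ active 1 s * s))\<^sup>2 = (fall s)\<^sup>2"
proof -
  obtain n where n: "4 / s < 2 ^ n" using real_arch_pow[of 2 "4 / s"] by auto
  \<comment> \<open>Large enough for the telescoped sum to have reached 1 at its upper end, and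
    above both selected indices, even arbitrary ones, so that the sum can be cut down to these
    two.\<close>
  define m where "m = max n (Suc (max (active 0 s) (active 1 s)))"
  have "(2::real) ^ n \<le> 2 ^ m" by (simp add: m_def)
  then have "4 / s < 2 ^ m" using n by linarith
  then have "2 \<le> 2 ^ m * s / 2" using assms by (simp add: field_simps)
  then have "(\<Sum>q<m. (bump (2 ^ q * s))\<^sup>2) = 1 - (rise (s / 2))\<^sup>2"
    by (simp add: sum_bump_square rise_ge_2)
  also have "\<dots> = (fall s)\<^sup>2" by (simp add: rise_def fall_def cos_squared_eq)
  also have "(\<Sum>q<m. (bump (2 ^ q * s))\<^sup>2) = (\<Sum>q\<in>{active 0 s, active 1 s}. (bump (2 ^ q * s))\<^sup>2)"
  proof (rule sum.mono_neutral_right)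
    show "\<forall>q\<in>{..<m} - {active 0 s, active 1 s}. (bump (2 ^ q * s))\<^sup>2 = 0"
    proof
      fix q assume q: "q \<in> {..<m} - {active 0 s, active 1 s}"
      have "q = 2 * (q div 2) + 0 \<or> q = 2 * (q div 2) + 1" by presburger
      then have "2 ^ q * s \<le> 1 \<or> 4 \<le> 2 ^ q * s"
        using q inactive[of q 0 s] inactive[of q 1 s] by blast
      then show "(bump (2 ^ q * s))\<^sup>2 = 0" by (simp add: bump_eq_0)
    qed
  qed (auto simp: m_def)
  also have "active 0 s \<noteq> active 1 s" unfolding active_def by presburger
  then have "(\<Sum>q\<in>{active 0 s, active 1 s}. (bump (2 ^ q * s))\<^sup>2)
      = (bump (2 ^ active 0 s * s))\<^sup>2 + (bump (2 ^ active 1 s * s))\<^sup>2" by simp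
  finally show ?thesis .
qed

section \<open>The metric defect on the cap\<close>

text \<open>A first-order zero of \<open>f\<close> makes the product differentiable whatever the
  bounded factor does. This carries the construction across the height \<open>upper\<close>, where
  \<open>irad\<close> has a kink.\<close>

lemma has_derivative_zero_scaleR:
  fixes f :: "'a::real_normed_vector \<Rightarrow> real" and u :: "'a \<Rightarrow> 'b::real_normed_vector"
  assumes f: "(f has_derivative (\<lambda>_. 0)) (at p within S)" "f p = 0"
    and u: "\<And>x. x \<in> S \<Longrightarrow> norm (u x) \<le> B"
  shows "((\<lambda>x. f x *\<^sub>R u x) has_derivative (\<lambda>_. 0)) (at p within S)"
proof -
  have f': "((\<lambda>y. \<bar>f y\<bar> / norm (y - p)) \<longlongrightarrow> 0) (at p within S)"
    using f by (simp add: has_derivative_iff_norm)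
  have "((\<lambda>y. norm (f y *\<^sub>R u y) / norm (y - p)) \<longlongrightarrow> 0) (at p within S)"
  proof (rule Lim_null_comparison)
    show "\<forall>\<^sub>F y in at p within S. norm (norm (f y *\<^sub>R u y) / norm (y - p)) \<le> \<bar>f y\<bar> / norm (y - p) * \<bar>B\<bar>"
      unfolding eventually_at_filter
    proof (intro always_eventually allI impI)
      fix y assume "y \<in> S"
      then have "norm (u y) \<le> \<bar>B\<bar>" using u by force
      then have "\<bar>f y\<bar> * norm (u y) / norm (y - p) \<le> \<bar>f y\<bar> * \<bar>B\<bar> / norm (y - p)"
        by (intro divide_right_mono mult_left_mono) auto
      then show "norm (norm (f y *\<^sub>R u y) / norm (y - p)) \<le> \<bar>f y\<bar> / norm (y - p) * \<bar>B\<bar>" by simp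
    qed
    show "((\<lambda>y. \<bar>f y\<bar> / norm (y - p) * \<bar>B\<bar>) \<longlongrightarrow> 0) (at p within S)"
      using tendsto_mult_left_zero[OF f'] .
  qed
  then show ?thesis using f(2) by (simp add: has_derivative_iff_norm)
qed

lemma lip_ctl_lipschitz:
  assumes "lip.ctl S (\<lambda>_. f)"
  obtains L where "L-lipschitz_on S f"
proof -
  obtain C where C: "0 \<le> C" "\<And>x y. x \<in> S \<Longrightarrow> y \<in> S \<Longrightarrow> norm (f x - f y) \<le> C * (2 ^ 0 * dist x y)"
    using assms by (rule lip.ctlE) (rule that; blast)
  show ?thesis using C by (intro that[of C] lipschitz_onI) (auto simp: dist_norm)
qed

lemma inverse_lipschitz: "(inverse (c\<^sup>2))-lipschitz_on {c..} (inverse :: real \<Rightarrow> real)" if "0 < c" for c :: real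
proof (rule lipschitz_onI)
  fix x y :: real assume xy: "x \<in> {c..}" "y \<in> {c..}"
  then have "inverse x - inverse y = (y - x) / (x * y)" using that by (simp add: field_simps)
  then have "dist (inverse x) (inverse y) = \<bar>x - y\<bar> / (x * y)"
    using xy that by (simp add: dist_real_def abs_mult abs_minus_commute)
  also have "\<dots> \<le> \<bar>x - y\<bar> / (c * c)"
    using xy that by (intro divide_left_mono mult_mono mult_pos_pos) auto
  finally show "dist (inverse x) (inverse y) \<le> inverse (c\<^sup>2) * dist x y"
    by (simp add: dist_real_def power2_eq_square field_simps)
qed simp

lemma sqrt_lipschitz: "(inverse (sqrt c))-lipschitz_on {c..} sqrt" if "0 < c" for c :: real
proof (rule lipschitz_onI)
  fix x y :: real assume xy: "x \<in> {c..}" "y \<in> {c..}"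
  have "sqrt c \<le> sqrt x" "0 \<le> sqrt y" "0 < sqrt c" using xy that by auto
  then have "sqrt c \<le> sqrt x + sqrt y" by linarith
  then have "sqrt c * \<bar>sqrt x - sqrt y\<bar> \<le> (sqrt x + sqrt y) * \<bar>sqrt x - sqrt y\<bar>"
    by (intro mult_right_mono) auto
  also have "\<dots> = \<bar>(sqrt x + sqrt y) * (sqrt x - sqrt y)\<bar>"
    using \<open>sqrt c \<le> sqrt x\<close> \<open>0 \<le> sqrt y\<close> \<open>0 < sqrt c\<close> by (simp add: abs_mult)
  also have "(sqrt x + sqrt y) * (sqrt x - sqrt y) = x - y"
    using xy that by (simp add: algebra_simps)
  finally show "dist (sqrt x) (sqrt y) \<le> inverse (sqrt c) * dist x y"
    using \<open>0 < sqrt c\<close> by (simp add: dist_real_def field_simps)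
qed (use that in simp)

lemma cap_subset_ball: "bounded (cap a)"
  unfolding bounded_iff by (intro exI[of _ 1]) (auto simp: cap_iff_norm)

lemma component_lipschitz: "1-lipschitz_on S (\<lambda>x::real^3. x $ i)"
  by (rule lipschitz_onI) (auto simp: dist_vec_nth_le)

lemma cap_component_3: "(\<lambda>x. x $ 3) ` cap a \<subseteq> {a..1}"
proof clarify
  fix x assume "x \<in> cap a"
  then show "x $ 3 \<in> {a..1}" using component_le_norm_cart[of x 3] by (simp add: cap_iff_norm)
qed

section \<open>Height scale, defect and wave coefficients\<close>

locale positive_cap =
  fixes a :: real
  assumes a: "0 < a" "a < 1"
begin

text \<open>The unit is an eighth of the height of the cap, so that \<open>sc\<close> reaches 4,
  where \<open>fall\<close> vanishes, exactly at \<open>upper\<close>, halfway to the pole.\<close>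

definition len where "len = (1 - a) / 8"
definition upper where "upper = (1 + a) / 2"
definition sc where "sc h = (h - a) / len"

text \<open>Below height \<open>upper\<close> this is the inverse radius of the parallel at height \<open>h\<close>; all perturbations
  are supported there.\<close>
definition irad where "irad h = inverse (sqrt (1 - (min h upper)\<^sup>2))"

text \<open>Relative loss of squared length of a parallel, up to the factor \<epsilon>. The
  oscillations return \<open>sc h * (fall (sc h))\<^sup>2\<close> per squared unit of angle;
  \<open>(irad h)\<^sup>2\<close> converts this to the squared radius as unit.\<close>

definition defect where "defect h = sc h * (fall (sc h))\<^sup>2 * (irad h)\<^sup>2"
definition defect' where
  "defect' h = ((fall (sc h))\<^sup>2 / len + sc h * (2 * fall (sc h) * fall' (sc h) / len)) * (irad h)\<^sup>2
     + sc h * (fall (sc h))\<^sup>2 * (2 * h * (irad h) ^ 4)"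

lemma len: "0 < len" and upper: "a < upper" "upper < 1" "0 < upper"
  using a by (auto simp: len_def upper_def)

lemma sc_upper: "upper \<le> h \<Longrightarrow> 4 \<le> sc h"
  using len by (simp add: sc_def upper_def len_def field_simps)

lemma sc_a: "sc a = 0" by (simp add: sc_def)

lemma sc_nonneg: "a \<le> h \<Longrightarrow> 0 \<le> sc h" using len by (simp add: sc_def)

lemma sc_lipschitz: "(inverse len)-lipschitz_on S sc"
  using len by (intro lipschitz_onI) (auto simp: sc_def dist_real_def field_simps simp flip: diff_divide_distrib)

lemma sc_derivative: "(sc has_real_derivative inverse len) (at h within S)"
  unfolding sc_def[abs_def] using len by (auto intro!: derivative_eq_intros simp: field_simps)

lemma upper_sq: "(min h upper)\<^sup>2 \<le> upper\<^sup>2" "upper\<^sup>2 < 1" if "a \<le> h"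
  using that a upper by (auto intro!: power_mono simp: abs_square_less_1)

lemma irad_pos: "0 < irad h" if "a \<le> h"
  using upper_sq[OF that] by (simp add: irad_def)

lemma irad_eq: "(irad h)\<^sup>2 = inverse (1 - (min h upper)\<^sup>2)" if "a \<le> h"
  using upper_sq[OF that] by (simp add: irad_def power_inverse)

lemma irad_sq: "(irad h)\<^sup>2 * (1 - h\<^sup>2) = 1" if "a \<le> h" "h \<le> upper"
  using upper_sq[OF that(1)] that irad_eq[OF that(1)] by (simp add: min_def)

text \<open>Above \<open>upper\<close> the radius goes on shrinking while \<open>irad\<close> is
  frozen. This keeps the phase in the unit disc up to the pole.\<close>

lemma irad_sq_le: "(irad h)\<^sup>2 * (1 - h\<^sup>2) \<le> 1" if "a \<le> h"
proof -
  have "1 - h\<^sup>2 \<le> 1 - (min h upper)\<^sup>2" using that a upper by (auto intro!: power_mono)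
  then show ?thesis
    using upper_sq[OF that] irad_eq[OF that] by (simp add: inverse_eq_divide divide_le_eq)
qed

lemma lip_ctl_irad: "lip.ctl {a..1} (\<lambda>_. irad)"
proof -
  define k where "k = 1 - upper\<^sup>2"
  have k: "0 < k" using upper_sq[of a] by (simp add: k_def)
  have "lip.ctl {a..1} (\<lambda>_ h. min h upper)"
    by (rule lip.ctl_lipschitz[of 1]) (auto intro!: lipschitz_onI simp: dist_real_def)
  then have 1: "lip.ctl {a..1} (\<lambda>_ h. 1 - (min h upper)\<^sup>2)"
    by (intro lip.ctl_diff lip.ctl_const lip.ctl_power)
  have 2: "lip.ctl {a..1} (\<lambda>_ h. sqrt (1 - (min h upper)\<^sup>2))"
    by (rule lip.ctl_compose_lipschitz[OF 1 sqrt_lipschitz[OF k]]) (use upper_sq in \<open>auto simp: k_def\<close>)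
  show ?thesis
    unfolding irad_def[abs_def]
    by (rule lip.ctl_compose_lipschitz[OF 2 inverse_lipschitz[of "sqrt k"]]) (use k upper_sq in \<open>auto simp: k_def\<close>)
qed

lemma hol_ctl_irad: "hol.ctl {a..1} (\<lambda>_. irad)"
proof -
  obtain L where "L-lipschitz_on {a..1} irad" using lip_ctl_irad by (rule lip_ctl_lipschitz)
  then show ?thesis by (rule hol.ctl_lipschitz) simp
qed

lemma hol_ctl_sc: "hol.ctl {a..1} (\<lambda>_. sc)"
  by (rule hol.ctl_lipschitz[OF sc_lipschitz]) simp

lemma hol_ctl_id: "hol.ctl {a..1} (\<lambda>_ h. h)"
  by (rule hol.ctl_lipschitz[OF lipschitz_on_id]) simp

lemma hol_ctl_defect: "hol.ctl {a..1} (\<lambda>_. defect)"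
  and hol_ctl_defect': "hol.ctl {a..1} (\<lambda>_. defect')"
proof -
  have f: "hol.ctl {a..1} (\<lambda>_ h. fall (sc h))" "hol.ctl {a..1} (\<lambda>_ h. fall' (sc h))"
    by (rule hol_ctl_of_lip[OF lip_ctl_fall sc_lipschitz] hol_ctl_of_lip[OF lip_ctl_fall' sc_lipschitz]; simp)+
  show "hol.ctl {a..1} (\<lambda>_. defect)"
    unfolding defect_def[abs_def]
    by (intro hol.ctl_mult hol.ctl_power f hol_ctl_sc hol_ctl_irad)
  have "hol.ctl {a..1} (\<lambda>_ h. ((fall (sc h))\<^sup>2 * inverse len
      + sc h * (2 * fall (sc h) * fall' (sc h) * inverse len)) * (irad h)\<^sup>2
     + sc h * (fall (sc h))\<^sup>2 * (2 * h * (irad h) ^ 4))"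
    by (intro hol.ctl_mult hol.ctl_add hol.ctl_const hol.ctl_power f hol_ctl_sc hol_ctl_irad hol_ctl_id)
  then show "hol.ctl {a..1} (\<lambda>_. defect')"
    unfolding defect'_def[abs_def] by (simp add: divide_inverse)
qed

lemma defect_upper: "upper \<le> h \<Longrightarrow> defect h = 0" "upper \<le> h \<Longrightarrow> defect' h = 0"
  using sc_upper[of h] by (simp_all add: defect_def defect'_def fall_ge_4)

lemma defect_a: "defect a = 0" "0 < defect' a"
proof -
  show "defect a = 0" by (simp add: defect_def sc_a)
  have "defect' a = (irad a)\<^sup>2 / len" by (simp add: defect'_def sc_a fall_le_2)
  then show "0 < defect' a" using irad_pos[of a] len by simp
qed

lemma defect_derivative:
  assumes h: "a \<le> h" "h \<le> 1"
  shows "(defect has_real_derivative defect' h) (at h within {a..1})"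
proof -
  define f where "f = (\<lambda>h. sc h * (fall (sc h))\<^sup>2)"
  define f' where "f' = (fall (sc h))\<^sup>2 / len + sc h * (2 * fall (sc h) * fall' (sc h) / len)"
  have "((\<lambda>h. fall (sc h)) has_real_derivative fall' (sc h) * inverse len) (at h within {a..1})"
    by (rule DERIV_chain2[where f = fall and g = sc, OF fall_derivative sc_derivative])
  then have f: "(f has_real_derivative f') (at h within {a..1})"
    unfolding f_def f'_def
    by (auto intro!: derivative_eq_intros sc_derivative simp: divide_inverse)
  show ?thesis
  proof (cases "h < upper")
    case True
    have ne: "1 - h\<^sup>2 \<noteq> 0" using irad_sq[of h] h True by auto
    have ih: "(irad h)\<^sup>2 = inverse (1 - h\<^sup>2)" using irad_eq[of h] h True by simp
    then have ih4: "(irad h) ^ 4 = inverse ((1 - h\<^sup>2)\<^sup>2)"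
      using power_mult[of "irad h" 2 2] by (simp add: power_inverse)
    have "((\<lambda>h. inverse (1 - h\<^sup>2)) has_real_derivative 2 * h * inverse ((1 - h\<^sup>2)\<^sup>2)) (at h within {a..1})"
      using ne by (auto intro!: derivative_eq_intros simp: power2_eq_square)
    from DERIV_mult[OF f this]
    have "((\<lambda>h. f h * inverse (1 - h\<^sup>2)) has_real_derivative defect' h) (at h within {a..1})"
      unfolding defect'_def f'_def[symmetric] ih ih4 by (simp add: f_def mult.commute)
    then show ?thesis
    proof (rule has_field_derivative_transform_within[where d = "upper - h"])
      show "f x * inverse (1 - x\<^sup>2) = defect x" if "x \<in> {a..1}" "dist x h < upper - h" for x
        using that irad_eq[of x] by (simp add: defect_def f_def dist_real_def)
    qed (use True h in auto)
  next
    case False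
    \<comment> \<open>From \<open>upper\<close> on, \<open>irad\<close> need not be differentiated,
      because the other factor vanishes there together with its derivative.\<close>
    have z: "f h = 0" "f' = 0" using False sc_upper[of h] by (simp_all add: f_def f'_def fall_ge_4)
    obtain C where C: "\<And>x. x \<in> {a..1} \<Longrightarrow> norm ((irad x)\<^sup>2) \<le> C"
      using hol.ctl_power[OF hol_ctl_irad, of 2] by (rule hol.ctlE) (rule that; blast)
    have "((\<lambda>x. f x *\<^sub>R (irad x)\<^sup>2) has_derivative (\<lambda>_. 0)) (at h within {a..1})"
    proof (rule has_derivative_zero_scaleR[where f = f and u = "\<lambda>x. (irad x)\<^sup>2" and B = C])
      show "(f has_derivative (\<lambda>_. 0)) (at h within {a..1})"
        using f unfolding z(2) has_field_derivative_def lambda_zero .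
    qed (use z(1) C in auto)
    then have "(defect has_real_derivative 0) (at h within {a..1})"
      unfolding has_field_derivative_def lambda_zero by (simp add: defect_def[abs_def] f_def)
    then show ?thesis using False defect_upper[of h] by simp
  qed
qed

text \<open>Coefficients of the differential of the selected oscillation: \<open>wave\<close> is
  frequency times amplitude, while \<open>wave'\<close> is the height derivative of the amplitude
  and not of \<open>wave\<close>. Both carry the weight 2^(-q/2).\<close>

definition wave where
  "wave j h = (1 / sqrt 2) ^ active j (sc h) * profile (2 ^ active j (sc h) * sc h)"
definition wave' where
  "wave' j h = (1 / sqrt 2) ^ active j (sc h) * (inverse len * profile' (2 ^ active j (sc h) * sc h))"

lemma hol_ctl_wave': "hol.ctl {a..1} (\<lambda>_. wave' j)"
proof -
  have "lip.ctl {a..1} (\<lambda>q h. inverse len * profile' (2 ^ q * sc h))"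
    by (intro lip.ctl_mult lip.ctl_const lip_ctl_rescale[OF lip_ctl_profile' sc_lipschitz])
  from hol_ctl_interpolate[OF this]
  have "hol.ctl {a..1} (\<lambda>q h. (1 / sqrt 2) ^ q * (inverse len * profile' (2 ^ q * sc h)))" by simp
  from hol.ctl_select[OF refl this, where N = "\<lambda>h. active j (sc h)", OF active_parity]
  show ?thesis
    unfolding wave'_def[abs_def] using inactive profile_eq_0(2) by simp
qed

text \<open>Squaring cancels the dyadic weights and leaves \<open>sc h\<close> times the squared
  bumps, whose sum over the two active indices is the squared \<open>fall\<close>.\<close>

lemma wave_square_sum:
  assumes "a \<le> h"
  shows "(wave 0 h)\<^sup>2 + (wave 1 h)\<^sup>2 = sc h * (fall (sc h))\<^sup>2"
proof (cases "sc h = 0")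
  case True
  then show ?thesis by (simp add: wave_def profile_def)
next
  case False
  then have s: "0 < sc h" using sc_nonneg[OF assms] by simp
  have "((1 / sqrt 2) ^ q * profile (2 ^ q * sc h))\<^sup>2 = sc h * (bump (2 ^ q * sc h))\<^sup>2" for q
  proof -
    have "((1 / sqrt 2) ^ q)\<^sup>2 = (1 / 2) ^ q"
      by (simp add: power2_eq_square flip: power_mult_distrib)
    then show ?thesis
      using s by (simp add: profile_def power_mult_distrib power_divide)
  qed
  then show ?thesis
    using active_bump_square[OF s] by (simp add: wave_def flip: distrib_left)
qed

lemma wave_upper: "upper \<le> h \<Longrightarrow> wave j h = 0" "upper \<le> h \<Longrightarrow> wave' j h = 0"
proof -
  assume "upper \<le> h"
  then have "4 \<le> sc h" by (rule sc_upper)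
  then have "4 \<le> 2 ^ q * sc h" for q :: nat
    using mult_mono[of 1 "2 ^ q" 4 "sc h"] by simp
  then show "wave j h = 0" "wave' j h = 0" by (simp_all add: wave_def wave'_def profile_eq_0)
qed

end

section \<open>Oscillations on the cap\<close>

text \<open>A differential is recorded by its three columns, so that Hoelder control of the
  differential becomes Hoelder control of three vector fields.\<close>

definition lin3 :: "'b::real_vector \<Rightarrow> 'b \<Rightarrow> 'b \<Rightarrow> real^3 \<Rightarrow> 'b" where
  "lin3 A B C w = w $ 1 *\<^sub>R A + w $ 2 *\<^sub>R B + w $ 3 *\<^sub>R C"

lemma has_derivative_component: "((\<lambda>x::real^3. x $ i) has_derivative (\<lambda>w. w $ i)) (at p within S)"
  by (rule bounded_linear_imp_has_derivative[OF bounded_linear_vec_nth])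

lemma cap_height_has_derivative:
  assumes "(f has_real_derivative f') (at (p $ 3) within {a..1})"
  shows "((\<lambda>x. f (x $ 3)) has_derivative (\<lambda>w. w $ 3 * f')) (at p within cap a)"
proof -
  have "(f has_derivative (*) f') (at (p $ 3) within (\<lambda>x. x $ 3) ` cap a)"
    using has_derivative_subset[OF _ cap_component_3] assms by (auto simp: has_field_derivative_def)
  from diff_chain_within[OF has_derivative_component this] show ?thesis
    by (simp add: o_def mult.commute)
qed

definition plane :: "real^3 \<Rightarrow> complex" where "plane x = Complex (x $ 1) (x $ 2)"

lemma bounded_linear_plane: "bounded_linear plane"
proof -
  have "bounded_linear (\<lambda>x::real^3. complex_of_real (x $ 1) + \<i> * complex_of_real (x $ 2))"
    by (intro bounded_linear_add bounded_linear_compose[OF bounded_linear_mult_right]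
        bounded_linear_compose[OF bounded_linear_of_real] bounded_linear_vec_nth)
  then show ?thesis by (simp add: plane_def[abs_def] complex_eq_iff Complex_eq)
qed

lemma norm_plane_cap: "p \<in> cap a \<Longrightarrow> (norm (plane p))\<^sup>2 = 1 - (p $ 3)\<^sup>2"
  by (simp add: plane_def cmod_power2 cap_def)

context positive_cap
begin

lemma cap_height: "p \<in> cap a \<Longrightarrow> a \<le> p $ 3" "p \<in> cap a \<Longrightarrow> p $ 3 \<le> 1"
  using cap_component_3[of a] by force+

definition phase where "phase x = plane x * of_real (irad (x $ 3))"
definition phase' where
  "phase' p w = plane w * of_real (irad (p $ 3)) + plane p * of_real (w $ 3 * (p $ 3 * (irad (p $ 3)) ^ 3))"

lemma norm_phase_le: "p \<in> cap a \<Longrightarrow> norm (phase p) \<le> 1"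
proof -
  assume p: "p \<in> cap a"
  have "(norm (phase p))\<^sup>2 = (irad (p $ 3))\<^sup>2 * (1 - (p $ 3)\<^sup>2)"
    by (simp add: phase_def norm_mult power_mult_distrib norm_plane_cap[OF p])
  also have "\<dots> \<le> 1\<^sup>2" using irad_sq_le[OF cap_height(1)[OF p]] by simp
  finally show ?thesis by (rule power2_le_imp_le) simp
qed

lemma norm_phase_eq: "p \<in> cap a \<Longrightarrow> p $ 3 \<le> upper \<Longrightarrow> norm (phase p) = 1"
proof -
  assume p: "p \<in> cap a" "p $ 3 \<le> upper"
  have "(norm (phase p))\<^sup>2 = (irad (p $ 3))\<^sup>2 * (1 - (p $ 3)\<^sup>2)"
    by (simp add: phase_def norm_mult power_mult_distrib norm_plane_cap[OF p(1)])
  then have "(norm (phase p))\<^sup>2 = 1\<^sup>2" using irad_sq[OF cap_height(1)[OF p(1)] p(2)] by simp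
  then show ?thesis by (rule power2_eq_imp_eq) simp_all
qed

lemma irad_derivative:
  assumes "a \<le> h" "h < upper"
  shows "(irad has_real_derivative h * (irad h) ^ 3) (at h within {a..1})"
proof -
  have pos: "0 < 1 - h\<^sup>2" using upper_sq[of h] assms by simp
  have "((\<lambda>h. inverse (sqrt (1 - h\<^sup>2))) has_real_derivative h * (irad h) ^ 3) (at h within {a..1})"
    using pos assms by (auto intro!: derivative_eq_intros simp: irad_def min_def power3_eq_cube power2_eq_square field_simps)
  then show ?thesis
    by (rule has_field_derivative_transform_within[where d = "upper - h"])
      (use assms upper in \<open>auto simp: irad_def dist_real_def min_def\<close>)
qed

lemma phase_derivative:
  assumes p: "p \<in> cap a" "p $ 3 < upper"
  shows "(phase has_derivative phase' p) (at p within cap a)"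
proof -
  have "((\<lambda>x. complex_of_real (irad (x $ 3))) has_derivative
      (\<lambda>w. of_real (w $ 3 * (p $ 3 * (irad (p $ 3)) ^ 3)))) (at p within cap a)"
    by (rule bounded_linear.has_derivative[OF bounded_linear_of_real cap_height_has_derivative
          [OF irad_derivative[OF cap_height(1)[OF p(1)] p(2)]]])
  from has_derivative_mult[OF bounded_linear_imp_has_derivative[OF bounded_linear_plane] this]
  show ?thesis
    by (simp add: phase_def[abs_def] phase'_def[abs_def] add.commute)
qed

text \<open>Since \<open>phase\<close> has unit modulus there, it can only rotate along tangent
  vectors; the real factor is the angular velocity d\<theta>(w). The identity uses that
  \<open>irad\<close> inverts the radius and that w is tangent.\<close>

lemma phase'_tangent:
  assumes p: "p \<in> cap a" "p $ 3 \<le> upper" and w: "w \<in> tangent_space p"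
  shows "phase' p w = \<i> * of_real ((p $ 1 * w $ 2 - p $ 2 * w $ 1) * (irad (p $ 3))\<^sup>2) * phase p"
proof -
  define x y h r where "x = p $ 1" and "y = p $ 2" and "h = p $ 3" and "r = irad h"
  define u v t where "u = w $ 1" and "v = w $ 2" and "t = w $ 3"
  have r: "r\<^sup>2 * (x\<^sup>2 + y\<^sup>2) = 1"
  proof -
    have "x\<^sup>2 + y\<^sup>2 = 1 - h\<^sup>2" using p(1) by (simp add: cap_def x_def y_def h_def)
    then show ?thesis using irad_sq[OF cap_height(1)[OF p(1)] p(2)] by (simp add: r_def h_def)
  qed
  have o: "x * u + y * v = - h * t"
    using w by (simp add: tangent_space_def inner_3 x_def y_def h_def u_def v_def t_def)
  have 1: "u * r + x * (t * (h * r ^ 3)) = - ((x * v - y * u) * r\<^sup>2) * (y * r)"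
  proof -
    have "u * r + x * (t * (h * r ^ 3)) + ((x * v - y * u) * r\<^sup>2) * (y * r)
        = r * (u * (1 - r\<^sup>2 * (x\<^sup>2 + y\<^sup>2)) + r\<^sup>2 * x * ((x * u + y * v) + h * t))" by algebra
    then show ?thesis unfolding r o by simp
  qed
  have 2: "v * r + y * (t * (h * r ^ 3)) = ((x * v - y * u) * r\<^sup>2) * (x * r)"
  proof -
    have "v * r + y * (t * (h * r ^ 3)) - ((x * v - y * u) * r\<^sup>2) * (x * r)
        = r * (v * (1 - r\<^sup>2 * (x\<^sup>2 + y\<^sup>2)) + r\<^sup>2 * y * ((x * u + y * v) + h * t))" by algebra
    then show ?thesis unfolding r o by simp
  qed
  show ?thesis
    using 1 2
    unfolding phase'_def phase_def plane_def x_def[symmetric] y_def[symmetric] h_def[symmetric]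
      r_def[symmetric] u_def[symmetric] v_def[symmetric] t_def[symmetric]
    by (simp add: complex_eq_iff)
qed

text \<open>The weight 2^(-3q/2) makes the amplitude the square root of s divided by the frequency,
  of order s^(3/2) within its band.\<close>

definition amp where "amp q h = (1 / (2 * sqrt 2)) ^ q * profile (2 ^ q * sc h)"
definition amp' where "amp' q h = (1 / sqrt 2) ^ q * (inverse len * profile' (2 ^ q * sc h))"

lemma pow_half_sqrt: "(1 / (2 * sqrt 2)) ^ q * 2 ^ q = (1 / sqrt 2) ^ q"
  by (simp flip: power_mult_distrib)

lemma amp_derivative: "(amp q has_real_derivative amp' q h) (at h within S)"
proof -
  have 1: "((\<lambda>h. 2 ^ q * sc h) has_real_derivative 2 ^ q * inverse len) (at h within S)"
    by (rule DERIV_cmult[OF sc_derivative])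
  have "((\<lambda>h. profile (2 ^ q * sc h)) has_real_derivative profile' (2 ^ q * sc h) * (2 ^ q * inverse len)) (at h within S)"
    by (rule DERIV_chain2[OF profile_derivative 1])
  from DERIV_cmult[OF this, of "(1 / (2 * sqrt 2)) ^ q"]
  show ?thesis
    unfolding amp_def[abs_def] amp'_def pow_half_sqrt[symmetric] by (simp add: ac_simps)
qed

lemma amp_upper: "upper \<le> h \<Longrightarrow> amp q h = 0" "upper \<le> h \<Longrightarrow> amp' q h = 0"
proof -
  assume "upper \<le> h"
  then have "4 \<le> 2 ^ q * sc h" using sc_upper[of h] mult_mono[of 1 "2 ^ q" 4 "sc h"] by simp
  then show "amp q h = 0" "amp' q h = 0" by (simp_all add: amp_def amp'_def profile_eq_0)
qed

definition osc where "osc q x = amp q (x $ 3) *\<^sub>R phase x ^ (2 ^ q)"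

text \<open>Columns of the differential of \<open>osc q\<close>, with the weight 2^(-q/2) pulled out
  to fit \<open>hol_ctl_interpolate\<close>.\<close>

definition osc1 where
  "osc1 q x = (1 / sqrt 2) ^ q *\<^sub>R (profile (2 ^ q * sc (x $ 3)) *\<^sub>R (phase x ^ (2 ^ q - 1) * of_real (irad (x $ 3))))"
definition osc2 where
  "osc2 q x = (1 / sqrt 2) ^ q *\<^sub>R (profile (2 ^ q * sc (x $ 3)) *\<^sub>R (phase x ^ (2 ^ q - 1) * (\<i> * of_real (irad (x $ 3)))))"
definition osc3 where
  "osc3 q x = (1 / sqrt 2) ^ q *\<^sub>R ((inverse len * profile' (2 ^ q * sc (x $ 3))) *\<^sub>R phase x ^ (2 ^ q)
     + profile (2 ^ q * sc (x $ 3)) *\<^sub>R (phase x ^ (2 ^ q - 1) * (plane x * of_real (x $ 3 * (irad (x $ 3)) ^ 3))))"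

lemma lin3_osc:
  "lin3 (osc1 q p) (osc2 q p) (osc3 q p) w = (1 / sqrt 2) ^ q *\<^sub>R
     ((w $ 3 * (inverse len * profile' (2 ^ q * sc (p $ 3)))) *\<^sub>R phase p ^ (2 ^ q)
      + profile (2 ^ q * sc (p $ 3)) *\<^sub>R (phase p ^ (2 ^ q - 1) * phase' p w))"
  unfolding lin3_def osc1_def osc2_def osc3_def phase'_def
  by (simp add: plane_def Complex_eq scaleR_conv_of_real algebra_simps)

lemma osc_derivative:
  assumes p: "p \<in> cap a"
  shows "(osc q has_derivative lin3 (osc1 q p) (osc2 q p) (osc3 q p)) (at p within cap a)"
proof (cases "p $ 3 < upper")
  case True
  have 1: "((\<lambda>x. amp q (x $ 3)) has_derivative (\<lambda>w. w $ 3 * amp' q (p $ 3))) (at p within cap a)"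
    by (rule cap_height_has_derivative[OF amp_derivative])
  have 2: "((\<lambda>x. phase x ^ (2 ^ q)) has_derivative (\<lambda>w. of_nat (2 ^ q) * phase' p w * phase p ^ (2 ^ q - 1)))
      (at p within cap a)"
    by (rule has_derivative_power[OF phase_derivative[OF p True]])
  have "lin3 (osc1 q p) (osc2 q p) (osc3 q p) = (\<lambda>w. amp q (p $ 3) *\<^sub>R (of_nat (2 ^ q) * phase' p w * phase p ^ (2 ^ q - 1))
      + (w $ 3 * amp' q (p $ 3)) *\<^sub>R phase p ^ (2 ^ q))"
    unfolding lin3_osc[abs_def] amp_def amp'_def pow_half_sqrt[symmetric]
    by (simp add: fun_eq_iff scaleR_conv_of_real algebra_simps)
  then show ?thesis
    using has_derivative_scaleR[OF 1 2] unfolding osc_def[abs_def] by simp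
next
  case False
  \<comment> \<open>The phase power is merely bounded here; amplitude and derivative of the
    amplitude both vanish.\<close>
  then have z: "amp q (p $ 3) = 0" "amp' q (p $ 3) = 0" using amp_upper by auto
  have "((\<lambda>x. amp q (x $ 3)) has_derivative (\<lambda>_. 0)) (at p within cap a)"
    using cap_height_has_derivative[OF amp_derivative[of q "p $ 3"]] z by simp
  from has_derivative_zero_scaleR[OF this z(1), of "\<lambda>x. phase x ^ (2 ^ q)" 1]
  have "(osc q has_derivative (\<lambda>_. 0)) (at p within cap a)"
    using norm_phase_le by (simp add: osc_def[abs_def] norm_power power_le_one)
  moreover have "4 \<le> 2 ^ q * sc (p $ 3)"
    using sc_upper[of "p $ 3"] False mult_mono[of 1 "2 ^ q" 4 "sc (p $ 3)"] by simp
  then have "lin3 (osc1 q p) (osc2 q p) (osc3 q p) = (\<lambda>_. 0)"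
    by (simp add: fun_eq_iff lin3_osc profile_eq_0)
  ultimately show ?thesis by simp
qed

lemma lip_ctl_height: "lip.ctl {a..1} f \<Longrightarrow> lip.ctl (cap a) (\<lambda>q x. f q (x $ 3))"
  by (rule lip.ctl_comp_nonexpansive[OF _ component_lipschitz cap_component_3])

lemma hol_ctl_height: "hol.ctl {a..1} f \<Longrightarrow> hol.ctl (cap a) (\<lambda>q x. f q (x $ 3))"
  by (rule hol.ctl_comp_nonexpansive[OF _ component_lipschitz cap_component_3])

lemma lip_ctl_plane: "lip.ctl (cap a) (\<lambda>_. plane)"
proof -
  obtain K where "K-lipschitz_on (cap a) plane"
    using bounded_linear.lipschitz_boundE[OF bounded_linear_plane] by metis
  then show ?thesis by (rule lip.ctl_lipschitz[OF _ cap_subset_ball])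
qed

lemma lip_ctl_of_real: "lip.ctl S f \<Longrightarrow> lip.ctl S (\<lambda>q x. complex_of_real (f q x))"
  by (rule lip.ctl_bounded_linear[OF bounded_linear_of_real])

lemma lip_ctl_id: "lip.ctl {a..1} (\<lambda>_ h. h)"
  by (rule lip.ctl_lipschitz[OF lipschitz_on_id]) simp

text \<open>Every factor behind the weight varies at frequency at most of order 2^q. Interpolation
  turns this into exponent 1/2 with a constant independent of q, as the accumulation of bands
  requires.\<close>

lemma hol_ctl_osc: "hol.ctl (cap a) osc1" "hol.ctl (cap a) osc2" "hol.ctl (cap a) osc3"
proof -
  have ir: "lip.ctl (cap a) (\<lambda>_ x. complex_of_real (irad (x $ 3)))"
    by (intro lip_ctl_of_real lip_ctl_height lip_ctl_irad)
  have ir3: "lip.ctl (cap a) (\<lambda>_ x. complex_of_real (x $ 3 * (irad (x $ 3)) ^ 3))"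
    using lip_ctl_of_real[OF lip_ctl_height[OF lip.ctl_mult[OF lip_ctl_id lip.ctl_power[OF lip_ctl_irad, of 3]]]] by simp
  have "lip.ctl (cap a) (\<lambda>_. phase)"
    unfolding phase_def[abs_def] by (intro lip.ctl_mult lip_ctl_plane ir)
  then obtain L where L: "L-lipschitz_on (cap a) phase" by (rule lip_ctl_lipschitz)
  have ph: "lip.ctl (cap a) (\<lambda>q x. phase x ^ (2 ^ q))" "lip.ctl (cap a) (\<lambda>q x. phase x ^ (2 ^ q - 1))"
    by (rule lip_ctl_power[OF L]; simp add: norm_phase_le)+
  have pr: "lip.ctl (cap a) (\<lambda>q x. profile (2 ^ q * sc (x $ 3)))"
    "lip.ctl (cap a) (\<lambda>q x. profile' (2 ^ q * sc (x $ 3)))"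
    by (rule lip_ctl_height lip_ctl_rescale[OF _ sc_lipschitz] lip_ctl_profile lip_ctl_profile')+
  show "hol.ctl (cap a) osc1"
    unfolding osc1_def[abs_def] by (intro hol_ctl_interpolate lip.ctl_scaleR lip.ctl_mult pr ph ir)
  show "hol.ctl (cap a) osc2"
    unfolding osc2_def[abs_def] by (intro hol_ctl_interpolate lip.ctl_scaleR lip.ctl_mult lip.ctl_const pr ph ir)
  show "hol.ctl (cap a) osc3"
    unfolding osc3_def[abs_def]
    by (intro hol_ctl_interpolate lip.ctl_add lip.ctl_scaleR lip.ctl_mult lip.ctl_const lip_ctl_plane pr ph ir3)
qed

definition idx where "idx j x = active j (sc (x $ 3))" for x :: "real^3"

lemma osc_inactive:
  assumes "q \<in> {q. \<exists>m. q = 2 * m + j}" "q \<noteq> idx j x"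
  shows "osc q x = 0" "osc1 q x = 0" "osc2 q x = 0" "osc3 q x = 0"
  using inactive[OF assms(1), of "sc (x $ 3)"] assms(2)
  by (simp_all add: idx_def osc_def amp_def osc1_def osc2_def osc3_def profile_eq_0)

lemma hol_ctl_selected:
  "hol.ctl (cap a) (\<lambda>_ x. osc1 (idx j x) x)" "hol.ctl (cap a) (\<lambda>_ x. osc2 (idx j x) x)"
  "hol.ctl (cap a) (\<lambda>_ x. osc3 (idx j x) x)"
proof -
  have *: "hol.ctl (cap a) (\<lambda>_ x. u (idx j x) x)"
    if "hol.ctl (cap a) u" "\<And>q x. q \<in> {q. \<exists>m. q = 2 * m + j} \<Longrightarrow> q \<noteq> idx j x \<Longrightarrow> u q x = 0"
    for u :: "nat \<Rightarrow> real^3 \<Rightarrow> complex"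
  proof (rule hol.ctl_select[OF refl that(1)])
    show "idx j x \<in> {q. \<exists>m. q = 2 * m + j}" for x unfolding idx_def by (rule active_parity)
  qed (rule that(2))
  show "hol.ctl (cap a) (\<lambda>_ x. osc1 (idx j x) x)" "hol.ctl (cap a) (\<lambda>_ x. osc2 (idx j x) x)"
    "hol.ctl (cap a) (\<lambda>_ x. osc3 (idx j x) x)"
    by (rule *, rule hol_ctl_osc, erule (1) osc_inactive)+
qed

text \<open>A bound uniform in q and superlinear in the distance to the boundary: it yields
  differentiability where infinitely many bands accumulate.\<close>

lemma norm_osc_le: "p \<in> cap a \<Longrightarrow> norm (osc q p) \<le> sc (p $ 3) * sqrt (sc (p $ 3))"
proof -
  assume p: "p \<in> cap a"
  define s where "s = sc (p $ 3)"
  have s: "0 \<le> s" using sc_nonneg cap_height p by (simp add: s_def)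
  \<comment> \<open>\<open>bump\<close> vanishes up to 1 and is at most 1 afterwards, so it lies
    below the identity.\<close>
  have "\<bar>bump (2 ^ q * s)\<bar> \<le> 2 ^ q * s"
    using abs_bump_le_1[of "2 ^ q * s"] bump_eq_0(1)[of "2 ^ q * s"] s by (cases "2 ^ q * s \<le> 1") auto
  then have "sqrt (2 ^ q * s) * \<bar>bump (2 ^ q * s)\<bar> \<le> sqrt (2 ^ q * s) * (2 ^ q * s)"
    using s by (intro mult_left_mono) auto
  then have "\<bar>profile (2 ^ q * s)\<bar> \<le> (2 * sqrt 2) ^ q * (s * sqrt s)"
    using s by (simp add: profile_def abs_mult real_sqrt_mult real_sqrt_power power_mult_distrib ac_simps)
  then have "(1 / (2 * sqrt 2)) ^ q * \<bar>profile (2 ^ q * s)\<bar> \<le> (1 / (2 * sqrt 2)) ^ q * ((2 * sqrt 2) ^ q * (s * sqrt s))"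
    by (intro mult_left_mono) auto
  also have "\<dots> = s * sqrt s" by (simp add: power_divide)
  finally have "\<bar>amp q (p $ 3)\<bar> \<le> s * sqrt s" by (simp add: amp_def s_def abs_mult)
  moreover have "norm (phase p ^ 2 ^ q) \<le> 1" using norm_phase_le[OF p] by (simp add: norm_power power_le_one)
  ultimately show ?thesis
    using mult_mono[of "\<bar>amp q (p $ 3)\<bar>" "s * sqrt s" "norm (phase p ^ 2 ^ q)" 1] s
    by (simp add: osc_def s_def)
qed

text \<open>At the boundary the superlinear bound gives derivative zero. Elsewhere only finitely
  many bands meet a neighbourhood, and the selected oscillation coincides there with a finite sum of
  fixed ones.\<close>

lemma selected_derivative:
  assumes p: "p \<in> cap a"
  shows "((\<lambda>x. osc (idx j x) x) has_derivative
     lin3 (osc1 (idx j p) p) (osc2 (idx j p) p) (osc3 (idx j p) p)) (at p within cap a)"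
proof (cases "p $ 3 = a")
  case True
  have "lin3 (osc1 (idx j p) p) (osc2 (idx j p) p) (osc3 (idx j p) p) = (\<lambda>_. 0)"
    by (simp add: fun_eq_iff lin3_osc True sc_a profile_eq_0)
  moreover have "((\<lambda>x. osc (idx j x) x) has_derivative (\<lambda>_. 0)) (at p within cap a)"
    unfolding has_derivative_iff_norm
  proof (intro conjI bounded_linear_zero)
    have z: "osc (idx j p) p = 0" by (simp add: osc_def amp_def True sc_a profile_eq_0)
    show "((\<lambda>y. norm (osc (idx j y) y - osc (idx j p) p - 0) / norm (y - p)) \<longlongrightarrow> 0) (at p within cap a)"
    proof (rule Lim_null_comparison)
      show "\<forall>\<^sub>F y in at p within cap a. norm (norm (osc (idx j y) y - osc (idx j p) p - 0) / norm (y - p))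
          \<le> inverse len * sqrt (sc (y $ 3))"
        unfolding eventually_at_filter
      proof (intro always_eventually allI impI)
        fix y assume y: "y \<noteq> p" "y \<in> cap a"
        have "\<bar>y $ 3 - p $ 3\<bar> \<le> norm (y - p)" using component_le_norm_cart[of "y - p" 3] by simp
        then have "sc (y $ 3) \<le> inverse len * norm (y - p)"
          using mult_left_mono[of "y $ 3 - a" "norm (y - p)" "inverse len"] len True
          by (simp add: sc_def divide_inverse mult.commute abs_le_iff)
        then have "norm (osc (idx j y) y) \<le> inverse len * norm (y - p) * sqrt (sc (y $ 3))"
          using sc_nonneg[OF cap_height(1)[OF y(2)]]
          by (intro order_trans[OF norm_osc_le[OF y(2)] mult_right_mono]) auto
        then have "norm (osc (idx j y) y) / norm (y - p) \<le> inverse len * sqrt (sc (y $ 3))"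
          using y(1) by (simp add: divide_le_eq ac_simps)
        then show "norm (norm (osc (idx j y) y - osc (idx j p) p - 0) / norm (y - p))
            \<le> inverse len * sqrt (sc (y $ 3))" by (simp add: z)
      qed
      have "((\<lambda>y. inverse len * sqrt ((y $ 3 - a) / len)) \<longlongrightarrow> inverse len * sqrt ((p $ 3 - a) / len)) (at p within cap a)"
        using len by (intro tendsto_intros tendsto_vec_nth) auto
      then show "((\<lambda>y. inverse len * sqrt (sc (y $ 3))) \<longlongrightarrow> 0) (at p within cap a)"
        by (simp add: sc_def True)
    qed
  qed
  ultimately show ?thesis by simp
next
  case False
  then have ap: "a < p $ 3" using cap_height(1)[OF p] by simp
  define s where "s = sc (p $ 3)"
  have s: "0 < s" using ap len by (simp add: s_def sc_def)
  \<comment> \<open>From index n on, the bands lie below s/2: \<open>2 ^ q * t\<close> is at least 4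
    as soon as t > s/2.\<close>
  obtain n where n: "8 / s < 2 ^ n" using real_arch_pow[of 2 "8 / s"] by auto
  define F where "F = {q. q < n \<and> (\<exists>m. q = 2 * m + j)}"
  have F: "finite F" by (simp add: F_def)
  have large: "profile (2 ^ q * t) = 0" "profile' (2 ^ q * t) = 0" if "n \<le> q" "s / 2 < t" for q t
  proof -
    have "(2::real) ^ n \<le> 2 ^ q" using that by simp
    then have "8 / s \<le> 2 ^ q" using n by linarith
    then have "8 / s * (s / 2) \<le> 2 ^ q * t" using that s by (intro mult_mono) auto
    then have "4 \<le> 2 ^ q * t" using s by simp
    then show "profile (2 ^ q * t) = 0" "profile' (2 ^ q * t) = 0" by (simp_all add: profile_eq_0)
  qed
  have idx_mem: "idx j x \<in> {q. \<exists>m. q = 2 * m + j}" for x unfolding idx_def by (rule active_parity)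
  \<comment> \<open>At most one summand survives. If the selected index is not in \<open>F\<close>,
    its own term is zero as well, so both sides vanish.\<close>
  have pick: "(\<Sum>q\<in>F. u q) = u (idx j x)"
    if 1: "\<And>q. \<exists>m. q = 2 * m + j \<Longrightarrow> q \<noteq> idx j x \<Longrightarrow> u q = 0" and 2: "n \<le> idx j x \<Longrightarrow> u (idx j x) = 0"
    for u :: "nat \<Rightarrow> 'b::real_vector" and x
  proof (cases "idx j x \<in> F")
    case True
    then have "(\<Sum>q\<in>F. u q) = (\<Sum>q\<in>{idx j x}. u q)"
      using F 1 by (intro sum.mono_neutral_right) (auto simp: F_def)
    then show ?thesis by simp
  next
    case False
    then have "n \<le> idx j x" using idx_mem[of x] by (auto simp: F_def not_less)
    moreover have "(\<Sum>q\<in>F. u q) = 0"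
    proof (intro sum.neutral ballI)
      fix q assume "q \<in> F"
      then have "q \<noteq> idx j x" "\<exists>m. q = 2 * m + j" using False by (blast, simp add: F_def)
      then show "u q = 0" by (intro 1)
    qed
    ultimately show ?thesis using 2 by simp
  qed
  have D: "(\<Sum>q\<in>F. lin3 (osc1 q p) (osc2 q p) (osc3 q p) w)
      = lin3 (osc1 (idx j p) p) (osc2 (idx j p) p) (osc3 (idx j p) p) w" for w
  proof (rule pick)
    show "lin3 (osc1 q p) (osc2 q p) (osc3 q p) w = 0" if "\<exists>m. q = 2 * m + j" "q \<noteq> idx j p" for q
      using osc_inactive[of q j p] that by (simp add: lin3_def)
    show "lin3 (osc1 (idx j p) p) (osc2 (idx j p) p) (osc3 (idx j p) p) w = 0" if "n \<le> idx j p"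
      using large[OF that, of s] s by (simp add: lin3_osc s_def)
  qed
  have "((\<lambda>x. \<Sum>q\<in>F. osc q x) has_derivative (\<lambda>w. \<Sum>q\<in>F. lin3 (osc1 q p) (osc2 q p) (osc3 q p) w)) (at p within cap a)"
    by (intro has_derivative_sum osc_derivative p)
  then have sumd: "((\<lambda>x. \<Sum>q\<in>F. osc q x) has_derivative lin3 (osc1 (idx j p) p) (osc2 (idx j p) p) (osc3 (idx j p) p)) (at p within cap a)"
    by (simp only: D)
  show ?thesis
  proof (rule has_derivative_transform_within[OF sumd])
    show "0 < (p $ 3 - a) / 2" using ap by simp
    show "(\<Sum>q\<in>F. osc q x) = osc (idx j x) x" if "x \<in> cap a" "dist x p < (p $ 3 - a) / 2" for x
    proof (rule pick)
      show "osc q x = 0" if "\<exists>m. q = 2 * m + j" "q \<noteq> idx j x" for q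
        using osc_inactive(1)[of q j x] that by simp
      have "\<bar>x $ 3 - p $ 3\<bar> < (p $ 3 - a) / 2"
        using component_le_norm_cart[of "x - p" 3] that(2) by (simp add: dist_norm)
      moreover have "(t - a) / 2 < u - a" if "\<bar>u - t\<bar> < (t - a) / 2" for t u :: real
        using that[THEN abs_less_iff[THEN iffD1]] by simp
      ultimately have "(p $ 3 - a) / 2 < x $ 3 - a" by blast
      from divide_strict_right_mono[OF this len] have "s / 2 < sc (x $ 3)" by (simp add: s_def sc_def)
      then show "osc (idx j x) x = 0" if "n \<le> idx j x"
        using large[OF that] by (simp add: osc_def amp_def)
    qed
  qed (rule p)
qed

text \<open>After division by a phase of modulus 1, the change of amplitude is real and the rotation
  imaginary, so there is no cross term and no dependence on the angle. Above \<open>upper\<close>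
  both sides vanish.\<close>

lemma norm_selected_derivative:
  assumes p: "p \<in> cap a" and w: "w \<in> tangent_space p"
  shows "(norm (lin3 (osc1 (idx j p) p) (osc2 (idx j p) p) (osc3 (idx j p) p) w))\<^sup>2
    = (wave' j (p $ 3))\<^sup>2 * (w $ 3)\<^sup>2
      + (wave j (p $ 3))\<^sup>2 * ((p $ 1 * w $ 2 - p $ 2 * w $ 1) * (irad (p $ 3))\<^sup>2)\<^sup>2"
proof (cases "p $ 3 \<le> upper")
  case True
  define q where "q = idx j p"
  define T where "T = (p $ 1 * w $ 2 - p $ 2 * w $ 1) * (irad (p $ 3))\<^sup>2"
  define A where "A = wave' j (p $ 3) * w $ 3"
  define B where "B = wave j (p $ 3) * T"
  have "phase p ^ (2 ^ q - 1) * phase p = phase p ^ (2 ^ q)"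
    using power_minus_mult[of "2 ^ q" "phase p"] by simp
  then have "lin3 (osc1 q p) (osc2 q p) (osc3 q p) w = Complex A B * phase p ^ (2 ^ q)"
    unfolding lin3_osc phase'_tangent[OF p True w] T_def[symmetric]
    by (simp add: A_def B_def wave_def wave'_def q_def idx_def Complex_eq scaleR_conv_of_real algebra_simps)
  then have "(norm (lin3 (osc1 q p) (osc2 q p) (osc3 q p) w))\<^sup>2 = A\<^sup>2 + B\<^sup>2"
    by (simp add: norm_mult norm_power norm_phase_eq[OF p True] cmod_power2)
  then show ?thesis by (simp add: A_def B_def T_def q_def power_mult_distrib)
next
  case False
  then have t: "upper \<le> p $ 3" by simp
  have "4 \<le> 2 ^ q * sc (p $ 3)" for q :: nat
    using sc_upper[OF t] mult_mono[of 1 "2 ^ q" 4 "sc (p $ 3)"] by simp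
  then show ?thesis by (simp add: lin3_osc profile_eq_0 wave_upper[OF t])
qed

end

section \<open>The bent cap\<close>

lemma hol_ctl_continuous:
  assumes "hol.ctl S (\<lambda>_. f)"
  shows "continuous_on S f"
  unfolding continuous_on_def
proof
  fix x assume x: "x \<in> S"
  obtain C where C: "0 \<le> C" "\<And>x y. x \<in> S \<Longrightarrow> y \<in> S \<Longrightarrow> norm (f x - f y) \<le> C * sqrt (dist x y)"
    using assms by (rule hol.ctlE) (rule that; blast)
  have "((\<lambda>y. f y - f x) \<longlongrightarrow> 0) (at x within S)"
  proof (rule Lim_null_comparison)
    show "\<forall>\<^sub>F y in at x within S. norm (f y - f x) \<le> C * sqrt (dist y x)"
      using C(2)[OF _ x] by (auto simp: eventually_at_filter)
    have "((\<lambda>y. C * sqrt (dist y x)) \<longlongrightarrow> C * sqrt (dist x x)) (at x within S)"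
      by (intro tendsto_intros)
    then show "((\<lambda>y. C * sqrt (dist y x)) \<longlongrightarrow> 0) (at x within S)" by simp
  qed
  then show "(f \<longlongrightarrow> f x) (at x within S)" by (simp add: LIM_zero_iff)
qed

lemma bounded_linear_lin3: "bounded_linear (lin3 A B C)"
  unfolding lin3_def[abs_def]
  by (intro bounded_linear_add bounded_linear_compose[OF bounded_linear_scaleR_left bounded_linear_vec_nth])

lemma norm_lin3_diff_le:
  "norm (lin3 A B C w - lin3 A' B' C' w) \<le> (norm (A - A') + norm (B - B') + norm (C - C')) * norm w"
proof -
  have 1: "norm (w $ i *\<^sub>R X) \<le> norm X * norm w" for i and X :: 'a
    using component_le_norm_cart[of w i] by (simp add: mult.commute mult_left_mono)
  have "lin3 A B C w - lin3 A' B' C' w = w $ 1 *\<^sub>R (A - A') + w $ 2 *\<^sub>R (B - B') + w $ 3 *\<^sub>R (C - C')"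
    by (simp add: lin3_def algebra_simps)
  also have "norm \<dots> \<le> norm (A - A') * norm w + norm (B - B') * norm w + norm (C - C') * norm w"
    by (intro order_trans[OF norm_triangle_ineq] add_mono 1)
  finally show ?thesis by (simp add: algebra_simps)
qed

lemma sqrt_le_powr:
  assumes "0 \<le> d" "d \<le> 2" "0 < \<alpha>" "\<alpha> \<le> 1/2"
  shows "sqrt d \<le> 2 * d powr \<alpha>"
proof (cases "d = 0")
  case False
  then have "sqrt d = d powr (1/2 - \<alpha>) * d powr \<alpha>"
    using assms by (simp add: powr_half_sqrt flip: powr_add)
  moreover have "d powr (1/2 - \<alpha>) \<le> 2 powr (1/2 - \<alpha>)" using assms by (intro powr_mono2) auto
  moreover have "(2::real) powr (1/2 - \<alpha>) \<le> 2 powr 1" using assms by (intro powr_mono) auto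
  ultimately show ?thesis by (simp add: mult_right_mono)
qed (use assms in simp)

text \<open>Preserving the norm of tangent vectors suffices: polarization gives the metric, and
  injectivity follows. Control with exponent 1/2 passes to smaller exponents because the cap has
  diameter at most 2.\<close>

lemma isometric_immersionsI:
  fixes v :: "real^3 \<Rightarrow> (real^2) \<times> (real^'k::finite)"
  assumes a: "-1 < a" "a < 1" and \<alpha>: "0 < \<alpha>" "\<alpha> \<le> 1/2"
    and d: "\<And>p. p \<in> cap a \<Longrightarrow> (v has_derivative lin3 (A p) (B p) (C p)) (at p within cap a)"
    and ctl: "hol.ctl (cap a) (\<lambda>_. A)" "hol.ctl (cap a) (\<lambda>_. B)" "hol.ctl (cap a) (\<lambda>_. C)"
    and norm: "\<And>p w. p \<in> cap a \<Longrightarrow> w \<in> tangent_space p \<Longrightarrow> norm (lin3 (A p) (B p) (C p) w) = norm w"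
    and bd: "\<And>x. x \<in> cap_boundary a \<Longrightarrow> v x = (vector [x$1, x$2], 0)"
  shows "v \<in> isometric_immersions \<alpha> a"
proof -
  define D where "D = (\<lambda>p. lin3 (A p) (B p) (C p))"
  have lin: "linear (D p)" for p unfolding D_def by (rule bounded_linear.linear[OF bounded_linear_lin3])
  have tan: "cap_differential a v p w = D p w" if "p \<in> cap a" "w \<in> tangent_space p" for p w
    unfolding D_def by (rule cap_differential_eq[OF a that d[OF that(1)]])
  have nrm: "norm (D p w) = norm w" if "p \<in> cap a" "w \<in> tangent_space p" for p w
    unfolding D_def by (rule norm[OF that])
  have sub: "u - w \<in> tangent_space p" "u + w \<in> tangent_space p"
    if "u \<in> tangent_space p" "w \<in> tangent_space p" for u w p
    using that by (simp_all add: tangent_space_def inner_diff_right inner_add_right)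
  have "immersion_cap a v"
    unfolding immersion_cap_def
  proof (intro ballI inj_onI)
    fix p u w assume p: "p \<in> cap a" and uw: "u \<in> tangent_space p" "w \<in> tangent_space p"
      and e: "cap_differential a v p u = cap_differential a v p w"
    have "D p (u - w) = 0" using e tan[OF p] uw linear_diff[OF lin] by simp
    then have "norm (u - w) = 0" using nrm[OF p sub(1)[OF uw]] by simp
    then show "u = w" by simp
  qed
  moreover have "isometric_cap a v"
    unfolding isometric_cap_def
  proof (intro ballI)
    fix p u w assume p: "p \<in> cap a" and uw: "u \<in> tangent_space p" "w \<in> tangent_space p"
    have "D p u \<bullet> D p w = ((norm (D p u + D p w))\<^sup>2 - (norm (D p u))\<^sup>2 - (norm (D p w))\<^sup>2) / 2"
      by (simp add: dot_norm)
    also have "D p u + D p w = D p (u + w)" by (simp add: linear_add[OF lin])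
    also have "((norm (D p (u + w)))\<^sup>2 - (norm (D p u))\<^sup>2 - (norm (D p w))\<^sup>2) / 2 = u \<bullet> w"
      using nrm[OF p] uw sub(2)[OF uw] by (simp add: dot_norm)
    finally show "cap_differential a v p u \<bullet> cap_differential a v p w = u \<bullet> w"
      using tan[OF p] uw by simp
  qed
  moreover have "C1_holder_cap \<alpha> a v"
    unfolding C1_holder_cap_def
  proof (intro conjI ballI)
    show "v differentiable (at p within cap a)" if "p \<in> cap a" for p
      using d[OF that] by (auto simp: differentiable_def)
    \<comment> \<open>Extending by zero along the normal subtracts from the i-th column
      \<open>p $ i\<close> times the value at p; these corrected columns are still Hoelder.\<close>
    define Q where "Q = (\<lambda>p. lin3 (A p) (B p) (C p) p)"
    define F where "F = (\<lambda>i X p. X p - p $ i *\<^sub>R Q p)"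
    have comp: "hol.ctl (cap a) (\<lambda>_ p. p $ i)" for i :: 3
      by (rule hol.ctl_lipschitz[OF component_lipschitz cap_subset_ball])
    have Q: "hol.ctl (cap a) (\<lambda>_. Q)"
      unfolding Q_def lin3_def by (intro hol.ctl_add hol.ctl_scaleR comp ctl)
    have Fc: "hol.ctl (cap a) (\<lambda>_. F i X)" if "hol.ctl (cap a) (\<lambda>_. X)" for i X
      unfolding F_def by (intro hol.ctl_diff hol.ctl_scaleR comp Q that)
    have cd: "cap_differential a v p w = lin3 (F 1 A p) (F 2 B p) (F 3 C p) w" if p: "p \<in> cap a" for p w
    proof -
      have "cap_differential a v p w = D p (tangent_proj p w)"
        using cap_differential_tangent_proj[OF p, of v w] tan[OF p tangent_proj_in_tangent_space[OF p]] by simp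
      also have "\<dots> = D p w - (p \<bullet> w) *\<^sub>R D p p"
        by (simp add: tangent_proj_def linear_diff[OF lin] linear_scale[OF lin])
      also have "\<dots> = lin3 (F 1 A p) (F 2 B p) (F 3 C p) w"
        unfolding D_def Q_def[symmetric] F_def by (simp add: lin3_def inner_3 Q_def algebra_simps)
      finally show ?thesis .
    qed
    obtain K1 where K1: "0 \<le> K1" "\<And>p q. p \<in> cap a \<Longrightarrow> q \<in> cap a \<Longrightarrow> norm (F 1 A p - F 1 A q) \<le> K1 * sqrt (dist p q)"
      using Fc[OF ctl(1)] by (rule hol.ctlE) (rule that; blast)
    obtain K2 where K2: "0 \<le> K2" "\<And>p q. p \<in> cap a \<Longrightarrow> q \<in> cap a \<Longrightarrow> norm (F 2 B p - F 2 B q) \<le> K2 * sqrt (dist p q)"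
      using Fc[OF ctl(2)] by (rule hol.ctlE) (rule that; blast)
    obtain K3 where K3: "0 \<le> K3" "\<And>p q. p \<in> cap a \<Longrightarrow> q \<in> cap a \<Longrightarrow> norm (F 3 C p - F 3 C q) \<le> K3 * sqrt (dist p q)"
      using Fc[OF ctl(3)] by (rule hol.ctlE) (rule that; blast)
    show "\<exists>K. \<forall>p\<in>cap a. \<forall>q\<in>cap a. onorm (\<lambda>w. cap_differential a v p w - cap_differential a v q w)
        \<le> K * dist p q powr \<alpha>"
    proof (intro exI[of _ "(K1 + K2 + K3) * 2"] ballI)
      fix p q assume pq: "p \<in> cap a" "q \<in> cap a"
      have "dist p q \<le> 2"
        using pq norm_triangle_ineq4[of p q] by (simp add: cap_iff_norm dist_norm)
      then have s: "sqrt (dist p q) \<le> 2 * dist p q powr \<alpha>" using \<alpha> by (intro sqrt_le_powr) auto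
      have "onorm (\<lambda>w. cap_differential a v p w - cap_differential a v q w) \<le> (K1 + K2 + K3) * sqrt (dist p q)"
      proof (rule onorm_le)
        fix w
        have "norm (cap_differential a v p w - cap_differential a v q w)
            \<le> (norm (F 1 A p - F 1 A q) + norm (F 2 B p - F 2 B q) + norm (F 3 C p - F 3 C q)) * norm w"
          unfolding cd[OF pq(1)] cd[OF pq(2)] by (rule norm_lin3_diff_le)
        also have "\<dots> \<le> ((K1 + K2 + K3) * sqrt (dist p q)) * norm w"
          using K1(2)[OF pq] K2(2)[OF pq] K3(2)[OF pq] by (intro mult_right_mono) (auto simp: algebra_simps)
        finally show "norm (cap_differential a v p w - cap_differential a v q w)
            \<le> (K1 + K2 + K3) * sqrt (dist p q) * norm w" .
      qed
      also have "\<dots> \<le> (K1 + K2 + K3) * (2 * dist p q powr \<alpha>)"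
        using s K1 K2 K3 by (intro mult_left_mono) auto
      finally show "onorm (\<lambda>w. cap_differential a v p w - cap_differential a v q w)
          \<le> (K1 + K2 + K3) * 2 * dist p q powr \<alpha>" by (simp only: mult.assoc)
    qed
  qed
  ultimately show ?thesis using bd by (simp add: isometric_immersions_def)
qed

text \<open>The balance of the metric below \<open>upper\<close>: \<open>T\<close> is the angular
  and \<open>t\<close> the vertical velocity, \<open>r\<close> the squared \<open>irad\<close>,
  \<open>I\<close> the inverse of \<open>1 - \<epsilon> * d\<close>, \<open>E\<close> the energy.
  The factor of \<open>t\<^sup>2\<close> in the last summand is \<open>slope2\<close>, designed so
  that all terms with \<epsilon> cancel.\<close>

lemma bent_identity:
  "(1 - \<epsilon> * d) * ((1 - h\<^sup>2) * T\<^sup>2 + h\<^sup>2 * t\<^sup>2 * r) + 2 * t * (- \<epsilon> * d' / 2) * (- h * t)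
     + t\<^sup>2 * (\<epsilon>\<^sup>2 * d'\<^sup>2 / 4 * I) * (1 - h\<^sup>2)
     + (\<epsilon> * (E * t\<^sup>2 + d * (1 - h\<^sup>2) * T\<^sup>2)
        + t\<^sup>2 * (1 + \<epsilon> * (d * h\<^sup>2 * r - d' * h - \<epsilon> * d'\<^sup>2 * (1 - h\<^sup>2) / 4 * I - E)))
   = (1 - h\<^sup>2) * T\<^sup>2 + h\<^sup>2 * t\<^sup>2 * r + t\<^sup>2" for \<epsilon> :: real
  by (simp add: field_simps power2_eq_square)

section \<open>Slope of the last coordinate and size of the perturbation\<close>

context positive_cap
begin

definition energy where "energy h = (wave' 0 h)\<^sup>2 + (wave' 1 h)\<^sup>2"

text \<open>The squared slope of the last coordinate, as a function of the height, that makes the meridians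
  unit speed.\<close>
definition slope2 where
  "slope2 \<epsilon> h = 1 + \<epsilon> * (defect h * h\<^sup>2 * (irad h)\<^sup>2 - defect' h * h
     - \<epsilon> * (defect' h)\<^sup>2 * (1 - h\<^sup>2) / 4 * inverse (1 - \<epsilon> * defect h) - energy h)"

lemma hol_ctl_energy: "hol.ctl {a..1} (\<lambda>_. energy)"
  unfolding energy_def[abs_def] by (intro hol.ctl_add hol.ctl_power hol_ctl_wave')

lemma ex_small:
  obtains \<epsilon> where "0 < \<epsilon>" "\<And>h. h \<in> {a..1} \<Longrightarrow> \<epsilon> * defect h \<le> 1/2" "\<And>h. h \<in> {a..1} \<Longrightarrow> 1/2 \<le> slope2 \<epsilon> h"
proof -
  \<comment> \<open>Packing the four functions into one tuple yields a common bound.\<close>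
  have "hol.ctl {a..1} (\<lambda>_ h. (defect h, defect h * h\<^sup>2 * (irad h)\<^sup>2 - defect' h * h,
      (defect' h)\<^sup>2 * (1 - h\<^sup>2) , energy h))"
    by (intro hol.ctl_Pair hol.ctl_diff hol.ctl_mult hol.ctl_power hol.ctl_const
        hol_ctl_defect hol_ctl_defect' hol_ctl_irad hol_ctl_id hol_ctl_energy)
  then obtain B where B0: "0 \<le> B" and B: "\<And>h. h \<in> {a..1} \<Longrightarrow> norm (defect h, defect h * h\<^sup>2 * (irad h)\<^sup>2 - defect' h * h,
      (defect' h)\<^sup>2 * (1 - h\<^sup>2) , energy h) \<le> B"
    by (rule hol.ctlE) (rule that; blast)
  \<comment> \<open>This gives \<epsilon> B \<le> 1/8. As the inverse is at most 2 and \<epsilon> at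
    most 1, the bracket in \<open>slope2\<close> is at least -3B, so at most 3/8 is lost from
    1.\<close>
  define \<epsilon> where "\<epsilon> = 1 / (8 * (B + 1))"
  have e: "0 < \<epsilon>" "\<epsilon> * (B + 1) = 1/8" using B0 by (simp_all add: \<epsilon>_def field_simps)
  then have eB: "\<epsilon> * B \<le> 1/8" by (simp add: distrib_left)
  have e1: "\<epsilon> \<le> 1" using B0 by (simp add: \<epsilon>_def field_simps)
  have "\<epsilon> * defect h \<le> 1/2 \<and> 1/2 \<le> slope2 \<epsilon> h" if h: "h \<in> {a..1}" for h
  proof -
    define P where "P = defect h * h\<^sup>2 * (irad h)\<^sup>2 - defect' h * h"
    define R where "R = (defect' h)\<^sup>2 * (1 - h\<^sup>2)"
    have "norm (defect h, P, R, energy h) \<le> B" unfolding P_def R_def by (rule B[OF h])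
    then have b: "\<bar>defect h\<bar> \<le> B" "\<bar>P\<bar> \<le> B" "\<bar>R\<bar> \<le> B" "\<bar>energy h\<bar> \<le> B"
      using norm_fst_le[of "defect h" "(P, R, energy h)"] norm_snd_le[of "(P, R, energy h)" "defect h"]
        norm_fst_le[of P "(R, energy h)"] norm_snd_le[of "(R, energy h)" P]
        norm_fst_le[of R "energy h"] norm_snd_le[of "energy h" R] by auto
    have d: "\<epsilon> * defect h \<le> 1/8"
    proof -
      have "\<epsilon> * defect h \<le> \<epsilon> * B" using b(1) e(1) by (intro mult_left_mono) auto
      then show ?thesis using eB by (rule order_trans)
    qed
    define I where "I = inverse (1 - \<epsilon> * defect h)"
    have I: "0 \<le> I" "I \<le> 2"
      using d le_imp_inverse_le[of "1/2" "1 - \<epsilon> * defect h"] by (auto simp: I_def)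
    have "\<epsilon> * \<bar>R\<bar> * I \<le> 1 * B * 2"
      using e e1 b(3) I B0 by (intro mult_mono) auto
    moreover have "\<epsilon> * R * I \<le> \<epsilon> * \<bar>R\<bar> * I"
      using e(1) I(1) by (intro mult_right_mono mult_left_mono) auto
    ultimately have "\<epsilon> * R * I \<le> 2 * B" by linarith
    then have "- (3 * B) \<le> P - \<epsilon> * R / 4 * I - energy h"
      using b(2,4) by (simp add: abs_le_iff) 
    then have "\<epsilon> * (- (3 * B)) \<le> \<epsilon> * (P - \<epsilon> * R / 4 * I - energy h)"
      using e by (intro mult_left_mono) auto
    moreover have "slope2 \<epsilon> h = 1 + \<epsilon> * (P - \<epsilon> * R / 4 * I - energy h)"
      by (simp add: slope2_def P_def R_def I_def mult.assoc)
    moreover have "\<epsilon> * (- (3 * B)) = - 3 * (\<epsilon> * B)" by simp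
    ultimately have "1/2 \<le> slope2 \<epsilon> h" using eB by linarith
    then show ?thesis using d by simp
  qed
  then show ?thesis using e by (intro that) auto
qed

end

section \<open>The bent immersion, its metric and its boundary normal\<close>

definition vec2 :: "real^3 \<Rightarrow> real^2" where "vec2 x = x $ 1 *\<^sub>R axis 1 1 + x $ 2 *\<^sub>R axis 2 1"

lemma vec2_eq: "vec2 x = vector [x $ 1, x $ 2]"
  by (simp add: vec2_def vec_eq_iff forall_2 axis_def)

lemma inner_vec2: "vec2 x \<bullet> vec2 y = x $ 1 * y $ 1 + x $ 2 * y $ 2"
  by (simp add: vec2_eq inner_vec_def sum_2)

lemma bounded_linear_vec2: "bounded_linear vec2"
  unfolding vec2_def[abs_def]
  by (intro bounded_linear_add bounded_linear_compose[OF bounded_linear_scaleR_left bounded_linear_vec_nth])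

text \<open>\<open>L\<close> places the two oscillation planes and the last coordinate isometrically
  into the normal directions.\<close>

locale bent_cap = positive_cap +
  fixes \<epsilon> :: real and L :: "complex \<times> complex \<times> real \<Rightarrow> real^'k::finite"
  assumes eps: "0 < \<epsilon>" "\<And>h. h \<in> {a..1} \<Longrightarrow> \<epsilon> * defect h \<le> 1/2"
    and slope2: "\<And>h. h \<in> {a..1} \<Longrightarrow> 1/2 \<le> slope2 \<epsilon> h"
    and L: "linear L" "\<And>x. norm (L x) = norm x"
begin

definition scal where "scal h = sqrt (1 - \<epsilon> * defect h)"
definition scal' where "scal' h = - \<epsilon> / 2 * (defect' h * inverse (scal h))"
definition slope where "slope h = sqrt (slope2 \<epsilon> h)"
definition height where "height h = integral {a..h} slope"

text \<open>The factor \<open>sqrt \<epsilon>\<close> makes the squared oscillations match the loss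
  in \<open>(scal h)\<^sup>2\<close>. Since \<open>height\<close> is integrated from a, the boundary
  stays in the horizontal plane.\<close>

definition bent :: "real^3 \<Rightarrow> (real^2) \<times> (real^'k)" where
  "bent x = (scal (x $ 3) *\<^sub>R vec2 x,
     L (sqrt \<epsilon> *\<^sub>R osc (idx 0 x) x, sqrt \<epsilon> *\<^sub>R osc (idx 1 x) x, height (x $ 3)))"

lemma L_bounded: "bounded_linear L"
  using L(1) by (rule linear_conv_bounded_linear[THEN iffD1])

lemma scal_arg: "h \<in> {a..1} \<Longrightarrow> 1/2 \<le> 1 - \<epsilon> * defect h"
  using eps(2)[of h] by simp

lemma scal_ge: "h \<in> {a..1} \<Longrightarrow> sqrt (1/2) \<le> scal h"
  unfolding scal_def by (rule real_sqrt_le_mono[OF scal_arg])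

lemma scal_sq: "h \<in> {a..1} \<Longrightarrow> (scal h)\<^sup>2 = 1 - \<epsilon> * defect h"
  using scal_arg[of h] by (simp add: scal_def)

lemma scal_pos: "h \<in> {a..1} \<Longrightarrow> 0 < scal h"
  using scal_arg[of h] by (simp add: scal_def)

lemma hol_ctl_scal_arg: "hol.ctl {a..1} (\<lambda>_ h. 1 - \<epsilon> * defect h)"
  by (intro hol.ctl_diff hol.ctl_mult hol.ctl_const hol_ctl_defect)

lemma hol_ctl_scal: "hol.ctl {a..1} (\<lambda>_. scal)"
  unfolding scal_def[abs_def]
  by (rule hol.ctl_compose_lipschitz[OF hol_ctl_scal_arg sqrt_lipschitz[of "1/2"]]) (use scal_arg in auto)

lemma hol_ctl_scal': "hol.ctl {a..1} (\<lambda>_. scal')"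
proof -
  have "hol.ctl {a..1} (\<lambda>_ h. inverse (scal h))"
    by (rule hol.ctl_compose_lipschitz[OF hol_ctl_scal inverse_lipschitz[of "sqrt (1/2)"]]) (use scal_ge in auto)
  then show ?thesis
    unfolding scal'_def[abs_def] by (intro hol.ctl_mult hol.ctl_const hol_ctl_defect')
qed

lemma hol_ctl_slope: "hol.ctl {a..1} (\<lambda>_. slope)"
proof -
  have 1: "hol.ctl {a..1} (\<lambda>_ h. inverse (1 - \<epsilon> * defect h))"
    by (rule hol.ctl_compose_lipschitz[OF hol_ctl_scal_arg inverse_lipschitz[of "1/2"]]) (use scal_arg in auto)
  have 2: "hol.ctl {a..1} (\<lambda>_ h. 1 + \<epsilon> * (defect h * h\<^sup>2 * (irad h)\<^sup>2 - defect' h * h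
     - \<epsilon> * (defect' h)\<^sup>2 * (1 - h\<^sup>2) * (1 / 4) * inverse (1 - \<epsilon> * defect h) - energy h))"
    by (intro hol.ctl_add hol.ctl_diff hol.ctl_mult hol.ctl_power hol.ctl_const
        hol_ctl_defect hol_ctl_defect' hol_ctl_irad hol_ctl_id hol_ctl_energy 1)
  have "hol.ctl {a..1} (\<lambda>_. slope2 \<epsilon>)"
    by (rule hol.ctl_cong[OF 2]) (simp add: slope2_def)
  then show ?thesis
    unfolding slope_def[abs_def]
    by (rule hol.ctl_compose_lipschitz[OF _ sqrt_lipschitz[of "1/2"]]) (use slope2 in auto)
qed

lemma slope_sq: "h \<in> {a..1} \<Longrightarrow> (slope h)\<^sup>2 = slope2 \<epsilon> h"
  using slope2[of h] by (simp add: slope_def)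

lemma scal_derivative: "h \<in> {a..1} \<Longrightarrow> (scal has_real_derivative scal' h) (at h within {a..1})"
proof -
  assume h: "h \<in> {a..1}"
  then have d: "(defect has_real_derivative defect' h) (at h within {a..1})"
    by (intro defect_derivative) auto
  have pos: "0 < 1 - \<epsilon> * defect h" using scal_arg[OF h] by simp
  have "((\<lambda>h. 1 - \<epsilon> * defect h) has_real_derivative - (\<epsilon> * defect' h)) (at h within {a..1})"
    using DERIV_diff[OF DERIV_const DERIV_cmult[OF d, of \<epsilon>], of 1] by simp
  from DERIV_chain2[where f = sqrt and g = "\<lambda>h. 1 - \<epsilon> * defect h", OF DERIV_real_sqrt[OF pos] this]
  show ?thesis unfolding scal_def[abs_def] scal'_def by (simp add: ac_simps)
qed

lemma height_derivative: "h \<in> {a..1} \<Longrightarrow> (height has_real_derivative slope h) (at h within {a..1})"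
  unfolding height_def[abs_def]
  by (rule integral_has_real_derivative[OF hol_ctl_continuous[OF hol_ctl_slope]])

definition bent1 where
  "bent1 p = (scal (p $ 3) *\<^sub>R axis 1 1, L (sqrt \<epsilon> *\<^sub>R osc1 (idx 0 p) p, sqrt \<epsilon> *\<^sub>R osc1 (idx 1 p) p, 0))"
definition bent2 where
  "bent2 p = (scal (p $ 3) *\<^sub>R axis 2 1, L (sqrt \<epsilon> *\<^sub>R osc2 (idx 0 p) p, sqrt \<epsilon> *\<^sub>R osc2 (idx 1 p) p, 0))"
definition bent3 where
  "bent3 p = (scal' (p $ 3) *\<^sub>R vec2 p, L (sqrt \<epsilon> *\<^sub>R osc3 (idx 0 p) p, sqrt \<epsilon> *\<^sub>R osc3 (idx 1 p) p, slope (p $ 3)))"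

definition dosc where "dosc j p = lin3 (osc1 (idx j p) p) (osc2 (idx j p) p) (osc3 (idx j p) p)"

lemma lin3_bent:
  "lin3 (bent1 p) (bent2 p) (bent3 p) w = (scal (p $ 3) *\<^sub>R vec2 w + (w $ 3 * scal' (p $ 3)) *\<^sub>R vec2 p,
     L (sqrt \<epsilon> *\<^sub>R dosc 0 p w, sqrt \<epsilon> *\<^sub>R dosc 1 p w, w $ 3 * slope (p $ 3)))"
  unfolding lin3_def bent1_def bent2_def bent3_def dosc_def
  by (simp add: linear_add[OF L(1), symmetric] linear_scale[OF L(1), symmetric] vec2_def algebra_simps)

lemma bent_derivative:
  assumes p: "p \<in> cap a"
  shows "(bent has_derivative lin3 (bent1 p) (bent2 p) (bent3 p)) (at p within cap a)"
proof -
  have h: "p $ 3 \<in> {a..1}" using cap_height[OF p] by simp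
  have 1: "((\<lambda>x. scal (x $ 3) *\<^sub>R vec2 x) has_derivative
      (\<lambda>w. scal (p $ 3) *\<^sub>R vec2 w + (w $ 3 * scal' (p $ 3)) *\<^sub>R vec2 p)) (at p within cap a)"
    by (rule has_derivative_scaleR[OF cap_height_has_derivative[OF scal_derivative[OF h]]
          bounded_linear_imp_has_derivative[OF bounded_linear_vec2]])
  have 2: "((\<lambda>x. sqrt \<epsilon> *\<^sub>R osc (idx j x) x) has_derivative (\<lambda>w. sqrt \<epsilon> *\<^sub>R dosc j p w)) (at p within cap a)" for j
    unfolding dosc_def by (rule has_derivative_scaleR_right[OF selected_derivative[OF p]])
  have 3: "((\<lambda>x. height (x $ 3)) has_derivative (\<lambda>w. w $ 3 * slope (p $ 3))) (at p within cap a)"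
    by (rule cap_height_has_derivative[OF height_derivative[OF h]])
  have "(bent has_derivative (\<lambda>w. (scal (p $ 3) *\<^sub>R vec2 w + (w $ 3 * scal' (p $ 3)) *\<^sub>R vec2 p,
     L (sqrt \<epsilon> *\<^sub>R dosc 0 p w, sqrt \<epsilon> *\<^sub>R dosc 1 p w, w $ 3 * slope (p $ 3))))) (at p within cap a)"
    unfolding bent_def[abs_def]
    by (intro has_derivative_Pair bounded_linear.has_derivative[OF L_bounded] 1 2 3)
  then show ?thesis unfolding lin3_bent[abs_def, symmetric] .
qed

lemma hol_ctl_bent: "hol.ctl (cap a) (\<lambda>_. bent1)" "hol.ctl (cap a) (\<lambda>_. bent2)" "hol.ctl (cap a) (\<lambda>_. bent3)"
proof -
  obtain K where "K-lipschitz_on (cap a) vec2"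
    using bounded_linear.lipschitz_boundE[OF bounded_linear_vec2] by metis
  then have v: "hol.ctl (cap a) (\<lambda>_. vec2)" by (rule hol.ctl_lipschitz[OF _ cap_subset_ball])
  note rules = hol.ctl_Pair hol.ctl_bounded_linear[OF L_bounded] hol.ctl_scaleR hol.ctl_const
    hol_ctl_selected hol_ctl_height hol_ctl_scal hol_ctl_scal' hol_ctl_slope v
  show "hol.ctl (cap a) (\<lambda>_. bent1)" unfolding bent1_def[abs_def] by (intro rules)
  show "hol.ctl (cap a) (\<lambda>_. bent2)" unfolding bent2_def[abs_def] by (intro rules)
  show "hol.ctl (cap a) (\<lambda>_. bent3)" unfolding bent3_def[abs_def] by (intro rules)
qed

lemma norm_bent_derivative:
  assumes p: "p \<in> cap a" and w: "w \<in> tangent_space p"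
  shows "norm (lin3 (bent1 p) (bent2 p) (bent3 p) w) = norm w"
proof -
  define h r where "h = p $ 3" and "r = (irad h)\<^sup>2"
  define x y u v t where "x = p $ 1" and "y = p $ 2" and "u = w $ 1" and "v = w $ 2" and "t = w $ 3"
  define T where "T = (x * v - y * u) * r"
  define m m' d d' where "m = scal h" and "m' = scal' h" and "d = defect h" and "d' = defect' h"
  have h: "h \<in> {a..1}" using cap_height[OF p] by (simp add: h_def)
  have o: "x * u + y * v = - h * t"
    using w by (simp add: tangent_space_def inner_3 x_def y_def h_def u_def v_def t_def)
  have xy: "x\<^sup>2 + y\<^sup>2 = 1 - h\<^sup>2" using p by (simp add: cap_def x_def y_def h_def)
  have m2: "m\<^sup>2 = 1 - \<epsilon> * d" "0 < m" using scal_sq[OF h] scal_pos[OF h] by (simp_all add: m_def d_def)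
  \<comment> \<open>Only these root-free combinations of the scaling and its derivative enter the
    metric.\<close>
  have mm': "m * m' = - \<epsilon> * d' / 2" using m2(2) by (simp add: m_def m'_def scal'_def d'_def)
  have m'2: "m'\<^sup>2 = \<epsilon>\<^sup>2 * d'\<^sup>2 / 4 * inverse (1 - \<epsilon> * d)"
    using m2 by (simp add: m'_def scal'_def m_def d'_def power_mult_distrib power_inverse power_divide)
  have W: "\<epsilon> * ((norm (dosc 0 p w))\<^sup>2 + (norm (dosc 1 p w))\<^sup>2) = \<epsilon> * (energy h * t\<^sup>2 + sc h * (fall (sc h))\<^sup>2 * T\<^sup>2)"
    using norm_selected_derivative[OF p w, of 0] norm_selected_derivative[OF p w, of 1]
      wave_square_sum[of h] h
    by (simp add: dosc_def energy_def T_def r_def h_def x_def y_def u_def v_def t_def)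
      (simp add: algebra_simps flip: distrib_right)
  have "(norm (lin3 (bent1 p) (bent2 p) (bent3 p) w))\<^sup>2
      = (norm (m *\<^sub>R vec2 w + (t * m') *\<^sub>R vec2 p))\<^sup>2
        + (\<epsilon> * ((norm (dosc 0 p w))\<^sup>2 + (norm (dosc 1 p w))\<^sup>2) + t\<^sup>2 * (slope h)\<^sup>2)"
    unfolding lin3_bent norm_Pair
    using eps(1) by (simp add: L(2) norm_Pair m_def m'_def h_def t_def power_mult_distrib distrib_left)
  also have "(norm (m *\<^sub>R vec2 w + (t * m') *\<^sub>R vec2 p))\<^sup>2
      = m\<^sup>2 * (u\<^sup>2 + v\<^sup>2) + 2 * t * (m * m') * (x * u + y * v) + t\<^sup>2 * m'\<^sup>2 * (x\<^sup>2 + y\<^sup>2)"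
    unfolding power2_norm_eq_inner
    by (simp add: inner_add_left inner_add_right inner_vec2 x_def y_def u_def v_def power2_eq_square algebra_simps)
  also have "\<dots> + (\<epsilon> * ((norm (dosc 0 p w))\<^sup>2 + (norm (dosc 1 p w))\<^sup>2) + t\<^sup>2 * (slope h)\<^sup>2)
      = u\<^sup>2 + v\<^sup>2 + t\<^sup>2"
  proof (cases "h \<le> upper")
    case True
    have r: "r * (1 - h\<^sup>2) = 1" using irad_sq[of h] True h by (simp add: r_def)
    have dW: "sc h * (fall (sc h))\<^sup>2 = d * (1 - h\<^sup>2)"
      using r by (simp add: d_def defect_def r_def[symmetric])
    \<comment> \<open>Lagrange's identity splits the horizontal part of w into angular and radial
      parts; tangency expresses the radial one through the vertical velocity.\<close>
    have uv: "u\<^sup>2 + v\<^sup>2 = (1 - h\<^sup>2) * T\<^sup>2 + h\<^sup>2 * t\<^sup>2 * r"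
    proof -
      have "(x\<^sup>2 + y\<^sup>2) * (u\<^sup>2 + v\<^sup>2) = (x * v - y * u)\<^sup>2 + (x * u + y * v)\<^sup>2" by algebra
      then have "(1 - h\<^sup>2) * (u\<^sup>2 + v\<^sup>2) = (x * v - y * u)\<^sup>2 + (h * t)\<^sup>2"
        unfolding xy o by simp
      then have "r * ((1 - h\<^sup>2) * (u\<^sup>2 + v\<^sup>2)) = r * (x * v - y * u)\<^sup>2 + r * (h * t)\<^sup>2"
        by (simp only: distrib_left)
      moreover have "r * ((1 - h\<^sup>2) * (u\<^sup>2 + v\<^sup>2)) = u\<^sup>2 + v\<^sup>2" using r by (simp flip: mult.assoc)
      moreover have "(1 - h\<^sup>2) * T\<^sup>2 = r * (1 - h\<^sup>2) * (r * (x * v - y * u)\<^sup>2)"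
        by (simp add: T_def power_mult_distrib power2_eq_square ac_simps)
      then have "(1 - h\<^sup>2) * T\<^sup>2 = r * (x * v - y * u)\<^sup>2" using r by simp
      ultimately show ?thesis by (simp add: power_mult_distrib ac_simps)
    qed
    show ?thesis
      unfolding W dW slope_sq[OF h] slope2_def d_def[symmetric] d'_def[symmetric] r_def[symmetric]
        o xy m2(1) mm' m'2 uv
      by (rule bent_identity)
  next
    case False
    then have t: "upper \<le> h" by simp
    \<comment> \<open>Above \<open>upper\<close> nothing is perturbed: the differential leaves the
      horizontal part unchanged and the last coordinate has slope 1.\<close>
    have z: "d = 0" "d' = 0" "energy h = 0" "sc h * (fall (sc h))\<^sup>2 = 0"
      using defect_upper[OF t] wave_upper[OF t] sc_upper[OF t]
      by (simp_all add: d_def d'_def energy_def fall_ge_4)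
    have "m\<^sup>2 = 1" "m' = 0" using z m2(1) by (simp_all add: m'_def scal'_def d'_def[symmetric])
    then show ?thesis
      unfolding W slope_sq[OF h] slope2_def using z by (simp add: d_def d'_def)
  qed
  also have "\<dots> = (norm w)\<^sup>2"
    unfolding power2_norm_eq_inner inner_3 u_def v_def t_def by (simp add: power2_eq_square)
  finally show ?thesis by (rule power2_eq_imp_eq) simp_all
qed

lemma bent_boundary: "x \<in> cap_boundary a \<Longrightarrow> bent x = (vector [x $ 1, x $ 2], 0)"
proof -
  assume "x \<in> cap_boundary a"
  then have x: "x $ 3 = a" by (simp add: cap_boundary_def)
  have "osc q x = 0" for q by (simp add: osc_def amp_def x sc_a profile_eq_0)
  moreover have "L (0, 0, 0) = 0" using linear_0[OF L(1)] by (simp add: zero_prod_def)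
  ultimately show ?thesis
    by (simp add: bent_def x scal_def height_def defect_a vec2_eq)
qed

lemma bent_isometric:
  fixes \<alpha> :: real
  assumes "0 < \<alpha>" "\<alpha> \<le> 1/2"
  shows "bent \<in> isometric_immersions \<alpha> a"
  by (rule isometric_immersionsI[OF _ a(2) assms bent_derivative hol_ctl_bent norm_bent_derivative bent_boundary])
    (use a in auto)

text \<open>\<open>Z\<close> is horizontal, so oscillations and height do not contribute. The
  derivative of the scaling along the normal adds \<open>- scal' a * (\<rho> * \<rho>)\<close> to a,
  which is positive because the defect starts with positive slope.\<close>

lemma bent_normal:
  fixes \<alpha> :: real
  assumes "0 < \<alpha>" "\<alpha> \<le> 1/2" and q: "q \<in> boundary_circle a"
  shows "a < Y_field a bent q \<bullet> Z_field a q"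
proof -
  have iso: "bent \<in> isometric_immersions \<alpha> a" by (rule bent_isometric[OF assms(1,2)])
  have a': "-1 < a" using a by simp
  have "q \<in> bent ` cap_boundary a" unfolding boundary_circle_eq_image(1)[OF iso] by (rule q)
  then obtain p where p: "p \<in> cap_boundary a" "bent p = q" by (elim imageE) simp
  have inv: "the_inv_into (cap_boundary a) bent q = p"
    using the_inv_into_f_f[OF boundary_circle_eq_image(2)[OF iso] p(1)] p(2) by simp
  have pc: "p \<in> cap a" and p3: "p $ 3 = a" using p(1) by (auto simp: cap_boundary_def)
  define \<rho> where "\<rho> = sqrt (1 - a\<^sup>2)"
  have "a\<^sup>2 < 1" using a by (simp add: abs_square_less_1)
  then have \<rho>: "0 < \<rho>" "\<rho> * \<rho> = 1 - a * a" by (simp_all add: \<rho>_def power2_eq_square)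
  have v2: "vec2 p \<bullet> vec2 p = \<rho> * \<rho>"
    using pc \<rho> p3 by (simp add: inner_vec2 cap_def power2_eq_square)
  define n where "n = interior_unit_normal p"
  have n: "n \<in> tangent_space p"
    using interior_unit_normal_eq[OF a' a(2) p(1)] by (simp add: n_def is_interior_unit_normal_def)
  have nn: "\<rho> *\<^sub>R n = axis 3 1 - a *\<^sub>R p"
    using interior_unit_normal_eq(2)[OF a' a(2) p(1)] \<rho>(1) by (simp add: \<rho>_def[symmetric] n_def)
  have n3: "n $ 3 = \<rho>"
  proof -
    have "\<rho> * n $ 3 = (\<rho> *\<^sub>R n) $ 3" by simp
    also have "\<dots> = \<rho> * \<rho>" unfolding nn by (simp add: p3 \<rho>(2) axis_def)
    finally show ?thesis using \<rho>(1) by simp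
  qed
  have n12: "\<rho> *\<^sub>R vec2 n = - a *\<^sub>R vec2 p"
  proof -
    have "\<rho> *\<^sub>R vec2 n = vec2 (\<rho> *\<^sub>R n)" by (simp add: vec2_def algebra_simps)
    also have "\<dots> = - a *\<^sub>R vec2 p" unfolding nn by (simp add: vec2_def axis_def algebra_simps)
    finally show ?thesis .
  qed
  have m: "scal a = 1" by (simp add: scal_def defect_a)
  have m': "scal' a < 0"
    using defect_a(2) eps(1) by (simp add: scal'_def m mult_pos_pos)
  have "Y_field a bent q = cap_differential a bent p n"
    by (simp add: Y_field_def inv Let_def n_def)
  also have "\<dots> = lin3 (bent1 p) (bent2 p) (bent3 p) n"
    by (rule cap_differential_eq[OF a' a(2) pc n bent_derivative[OF pc]])
  finally have "fst (Y_field a bent q) = vec2 n + (\<rho> * scal' a) *\<^sub>R vec2 p"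
    by (simp add: lin3_bent p3 m n3)
  moreover have "Z_field a q = (- (1 / \<rho>) *\<^sub>R vec2 p, 0)"
    using bent_boundary[OF p(1)] p(2) by (simp add: Z_field_def \<rho>_def[symmetric] vec2_eq)
  ultimately have "Y_field a bent q \<bullet> Z_field a q = (vec2 n + (\<rho> * scal' a) *\<^sub>R vec2 p) \<bullet> (- (1 / \<rho>) *\<^sub>R vec2 p)"
    by (simp add: inner_prod_def)
  also have "\<dots> = - (1 / \<rho>) * (vec2 n \<bullet> vec2 p) - scal' a * (vec2 p \<bullet> vec2 p)"
    using \<rho>(1) by (simp add: inner_add_left field_simps)
  also have "vec2 n \<bullet> vec2 p = - a * \<rho>"
  proof -
    have "\<rho> * (vec2 n \<bullet> vec2 p) = (\<rho> *\<^sub>R vec2 n) \<bullet> vec2 p" by simp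
    also have "\<dots> = \<rho> * (- a * \<rho>)" unfolding n12 using v2 by simp
    finally show ?thesis unfolding mult_cancel_left using \<rho>(1) by simp
  qed
  finally have "Y_field a bent q \<bullet> Z_field a q = a - scal' a * (\<rho> * \<rho>)"
    using \<rho>(1) v2 by simp
  moreover have "scal' a * (\<rho> * \<rho>) < 0" using m' \<rho>(1) by (simp add: mult_neg_pos)
  ultimately show ?thesis by simp
qed

end

theorem flexible_immersion:
  assumes a: "0 < a" "a < 1" and \<alpha>: "0 < \<alpha>" "\<alpha> \<le> 1/2" and k: "5 \<le> CARD('k::finite)"
  shows "\<exists>v :: real^3 \<Rightarrow> (real^2) \<times> (real^'k). v \<in> isometric_immersions \<alpha> a \<and>
    (\<forall>q \<in> boundary_circle a. a < Y_field a v q \<bullet> Z_field a q)"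
proof -
  interpret positive_cap a by standard (fact a)+
  obtain \<epsilon> where \<epsilon>: "0 < \<epsilon>" "\<And>h. h \<in> {a..1} \<Longrightarrow> \<epsilon> * defect h \<le> 1/2" "\<And>h. h \<in> {a..1} \<Longrightarrow> 1/2 \<le> slope2 \<epsilon> h"
    by (rule ex_small) (rule that; blast)
  \<comment> \<open>Dimension 5 is two planes for the parities and one line for the corrected
    height.\<close>
  have "dim (UNIV :: (complex \<times> complex \<times> real) set) \<le> dim (UNIV :: (real^'k) set)"
    using k by simp
  then obtain L :: "complex \<times> complex \<times> real \<Rightarrow> real^'k" where L: "linear L" "\<And>x. norm (L x) = norm x"
    using isometry_subset_subspace[OF subspace_UNIV subspace_UNIV] by (metis UNIV_I)
  interpret bent_cap a \<epsilon> L
    by (rule bent_cap.intro[OF positive_cap_axioms bent_cap_axioms.intro]) (rule \<epsilon> L | assumption)+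
  show ?thesis using bent_isometric[OF \<alpha>] bent_normal[OF \<alpha>] by blast
qed

theorem theorem1p2:
  shows "(\<forall>\<alpha> a. \<forall>v :: real^3 \<Rightarrow> (real^2) \<times> (real^'k::finite).
            1/2 < \<alpha> \<and> \<alpha> < 1 \<and> -1 < a \<and> a < 1 \<and> CARD('k) \<ge> 1 \<and> v \<in> isometric_immersions \<alpha> a \<longrightarrow>
            (\<forall>q \<in> boundary_circle a. Y_field a v q \<bullet> Z_field a q = a))
       \<and> (\<forall>\<alpha> a. 0 < \<alpha> \<and> \<alpha> < 1/2 \<and> 0 < a \<and> a < 1 \<and> CARD('k) \<ge> 12 \<longrightarrow>
            (\<exists>v :: real^3 \<Rightarrow> (real^2) \<times> (real^'k). v \<in> isometric_immersions \<alpha> a \<and>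
              (\<forall>q \<in> boundary_circle a. Y_field a v q \<bullet> Z_field a q > a)))"
proof (intro conjI allI impI)
  fix \<alpha> a and v :: "real^3 \<Rightarrow> (real^2) \<times> (real^'k)"
  assume *: "1/2 < \<alpha> \<and> \<alpha> < 1 \<and> -1 < a \<and> a < 1 \<and> CARD('k) \<ge> 1 \<and> v \<in> isometric_immersions \<alpha> a"
  show "\<forall>q \<in> boundary_circle a. Y_field a v q \<bullet> Z_field a q = a"
    using * boundary_normal_rigid by blast
next
  fix \<alpha> a :: real
  assume *: "0 < \<alpha> \<and> \<alpha> < 1/2 \<and> 0 < a \<and> a < 1 \<and> CARD('k) \<ge> 12"
  show "\<exists>v :: real^3 \<Rightarrow> (real^2) \<times> (real^'k). v \<in> isometric_immersions \<alpha> a \<and>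
      (\<forall>q \<in> boundary_circle a. Y_field a v q \<bullet> Z_field a q > a)"
    using * by (intro flexible_immersion) auto
qed

end
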